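(* Let $n\ge1$ and let $\lambda=(\lambda_1,\ldots,\lambda_n)\in\mathbb{Z}_{\ge0}^n$ with $\lambda_1\ge\cdots\ge\lambda_n$. Then $$P_\lambda(1,t,t^2,\ldots,t^{n-1};q,t)=t^{n(\lambda)}\prod_{b\in\lambda}\frac{1-q^{\mathrm{coarm}_\lambda(b)}t^{\,n-\mathrm{coleg}_\lambda(b)}}{1-q^{\mathrm{arm}_\lambda(b)}t^{\,\mathrm{leg}_\lambda(b)+1}},$$ where $n(\lambda)=\sum_{i=1}^n(i-1)\lambda_i$ and the product is over the boxes $b$ of $\lambda$.
   Context: Let $q,t^{1/2}$ be independent indeterminates over $\mathbb{C}$, $t=(t^{1/2})^2$, $K=\mathbb{C}(q,t^{1/2})$, $K[X]=K[x_1^{\pm1},\ldots,x_n^{\pm1}]$. $S_n$ acts on $K[X]$ by permuting variables and on $\mathbb{Z}^n$ by $(w\mu)_{w(i)}=\mu_i$; $s_i=(i,i+1)$. Put $x^\mu=x_1^{\mu_1}\cdots x_n^{\mu_n}$, $\partial_if=\frac{f-s_if}{x_i-x_{i+1}}$. For $\mu\in\mathbb{Z}^n$, $v_\mu\in S_n$ is the minimal length permutation such that $v_\mu\mu$ is weakly increasing; explicitly $v_\mu(r)=1+\#\{r'<r:\mu_{r'}\le\mu_r\}+\#\{r'>r:\mu_{r'}<\mu_r\}$. The electronic (nonsymmetric) Macdonald polynomials $E_\mu\in K[X]$, $\mu\in\mathbb{Z}^n$, are determined by: (E0) $E_{(0,\ldots,0)}=1$; (E1) $E_{(\mu_n+1,\mu_1,\ldots,\mu_{n-1})}=q^{\mu_n}x_1E_\mu(x_2,\ldots,x_n,q^{-1}x_1)$;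 (E2) if $\mu\in\mathbb{Z}_{\ge0}^n$ and $\mu_i>\mu_{i+1}$ then $E_{s_i\mu}=\partial_i(x_iE_\mu)-tx_i\partial_iE_\mu+\frac{(1-t)a}{1-a}E_\mu$ with $a=q^{\mu_i-\mu_{i+1}}t^{v_\mu(i)-v_\mu(i+1)}$; (E3) $E_{(\mu_1-1,\ldots,\mu_n-1)}=x_1^{-1}\cdots x_n^{-1}E_\mu$. The bosonic (symmetric) Macdonald polynomial is $P_\lambda=P_\lambda(x_1,\ldots,x_n;q,t)=\frac1{W_\lambda(t)}\sum_{w\in S_n}w\big(E_\lambda\prod_{i<j}\frac{x_i-tx_j}{x_i-x_j}\big)$, where $W_\lambda(t)$ is the constant making the coefficient of $x^\lambda$ in $P_\lambda$ equal to $1$. A box in $\lambda$ is a pair $b=(r,c)$ with $r\in\{1,\ldots,n\}$, $c\in\{1,\ldots,\lambda_r\}$. With $\lambda'_c=\#\{j:\lambda_j\ge c\}$, set $\mathrm{arm}_\lambda(b)=\lambda_r-c$, $\mathrm{leg}_\lambda(b)=\lambda'_c-r$, $\mathrm{coarm}_\lambda(b)=c-1$, $\mathrm{coleg}_\lambda(b)=r-1$. *)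

theory Defs
  imports
    "HOL-Library.Poly_Mapping"
    "HOL-Computational_Algebra.Polynomial_Factorial"
    "HOL-Combinatorics.Permutations"
begin

text \<open>
  The field \<open>K = \<complex>(q, t\<^sup>1\<^sup>/\<^sup>2)\<close> is the fraction field of \<open>\<complex>[q][t\<^sup>1\<^sup>/\<^sup>2]\<close>.
\<close>

type_synonym coeff_field = "complex poly poly fract"

definition qq :: coeff_field where
  "qq = to_fract [:[:0, 1:]:]"

definition t_half :: coeff_field where
  "t_half = to_fract [:0, 1:]"

definition tt :: coeff_field where
  "tt = t_half ^ 2"

text \<open>
  Indices are 1-based.  An element \<open>\<mu>\<close> of \<open>\<int>\<^sup>n\<close> is a finitely supported function
  \<open>nat \<Rightarrow> int\<close> that vanishes outside \<open>{1..n}\<close>.  A Laurent polynomial maps each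
  exponent vector to its coefficient; multiplication of \<open>poly_mapping\<close> is convolution.
  The type \<open>laurent\<close> has a variable for every natural number, and \<open>K[X]\<close> is the subring
  using only those with index in \<open>{1..n}\<close>.
\<close>

abbreviation lookup :: "('a \<Rightarrow>\<^sub>0 'b::zero) \<Rightarrow> 'a \<Rightarrow> 'b" where
  "lookup \<equiv> Poly_Mapping.lookup"

abbreviation keys :: "('a \<Rightarrow>\<^sub>0 'b::zero) \<Rightarrow> 'a set" where
  "keys \<equiv> Poly_Mapping.keys"

type_synonym expo = "nat \<Rightarrow>\<^sub>0 int"

type_synonym laurent = "expo \<Rightarrow>\<^sub>0 coeff_field"

type_synonym ratfun = "laurent fract"

definition expos :: "nat \<Rightarrow> expo set" where
  "expos n = {\<mu>. keys \<mu> \<subseteq> {1..n}}"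

definition laurents :: "nat \<Rightarrow> laurent set" where
  "laurents n = {f. keys f \<subseteq> expos n}"

definition tuple :: "nat \<Rightarrow> (nat \<Rightarrow> int) \<Rightarrow> expo" where
  "tuple n f = Abs_poly_mapping (\<lambda>i. if i \<in> {1..n} then f i else 0)"

lemma lookup_tuple: "lookup (tuple n f) i = (if i \<in> {1..n} then f i else 0)"
proof -
  have "finite {i. (if i \<in> {1..n} then f i else 0) \<noteq> 0}"
    by (rule finite_subset[of _ "{1..n}"]) auto
  then show ?thesis
    by (simp add: tuple_def)
qed

lemma tuple_in_expos: "tuple n f \<in> expos n"
  by (auto simp: expos_def in_keys_iff lookup_tuple split: if_splits)

definition xvar :: "nat \<Rightarrow> laurent" where
  "xvar i = Poly_Mapping.single (Poly_Mapping.single i 1) 1"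

definition rvar :: "nat \<Rightarrow> ratfun" where
  "rvar i = to_fract (xvar i)"

definition const :: "coeff_field \<Rightarrow> ratfun" where
  "const a = to_fract (Poly_Mapping.single 0 a)"

text \<open>
  \<open>laurent_eval \<phi> y f\<close> is \<open>f(y\<^sub>1, \<dots>, y\<^sub>n)\<close> for a point \<open>y\<close> of a field into which \<open>\<phi>\<close> embeds
  the coefficients.  It is used with \<open>\<phi> = id\<close> for evaluation at points of \<open>K\<close>, and with
  \<open>\<phi> = const\<close> for substitutions with values in \<open>K(X)\<close>.
\<close>

definition laurent_eval ::
    "(coeff_field \<Rightarrow> 'f::field) \<Rightarrow> (nat \<Rightarrow> 'f) \<Rightarrow> laurent \<Rightarrow> 'f" where
  "laurent_eval \<phi> y f =
     (\<Sum>m\<in>keys f. \<phi> (lookup f m) * (\<Prod>i\<in>keys m. y i powi lookup m i))"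

text \<open>The action \<open>f(x\<^sub>1, \<dots>, x\<^sub>n) \<mapsto> f(x\<^bsub>w(1)\<^esub>, \<dots>, x\<^bsub>w(n)\<^esub>)\<close>, as an element of \<open>K(X)\<close>.\<close>

definition perm_act :: "(nat \<Rightarrow> nat) \<Rightarrow> laurent \<Rightarrow> ratfun" where
  "perm_act w f = laurent_eval const (\<lambda>i. rvar (w i)) f"

definition div_diff :: "nat \<Rightarrow> laurent \<Rightarrow> ratfun" where
  "div_diff i f = (to_fract f - perm_act (transpose i (i + 1)) f) / (rvar i - rvar (i + 1))"

definition v_perm :: "nat \<Rightarrow> expo \<Rightarrow> nat \<Rightarrow> nat" where
  "v_perm n \<mu> r = 1 + card {r' \<in> {1..n}. r' < r \<and> lookup \<mu> r' \<le> lookup \<mu> r}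
               + card {r' \<in> {1..n}. r < r' \<and> lookup \<mu> r' < lookup \<mu> r}"

text \<open>
  The relations that determine the electronic Macdonald polynomials in \<open>n\<close> variables.  They are
  stated in \<open>K(X)\<close>, which contains \<open>K[X]\<close> by \<open>to_fract\<close>.
\<close>

definition electronic_macdonald :: "nat \<Rightarrow> (expo \<Rightarrow> laurent) \<Rightarrow> bool" where
  "electronic_macdonald n E \<longleftrightarrow>
     (\<forall>\<mu>\<in>expos n. E \<mu> \<in> laurents n) \<and>
     E 0 = 1 \<and>
     (\<forall>\<mu>\<in>expos n.
        to_fract (E (tuple n (\<lambda>r. if r = 1 then lookup \<mu> n + 1 else lookup \<mu> (r - 1)))) =
        const (qq powi lookup \<mu> n) * rvar 1 *
        laurent_eval const (\<lambda>r. if r = n then const (inverse qq) * rvar 1 else rvar (r + 1)) (E \<mu>)) \<and>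
     (\<forall>\<mu>\<in>expos n. \<forall>i\<in>{1..<n}.
        (\<forall>r\<in>{1..n}. 0 \<le> lookup \<mu> r) \<longrightarrow> lookup \<mu> (i + 1) < lookup \<mu> i \<longrightarrow>
        (let a = qq powi (lookup \<mu> i - lookup \<mu> (i + 1)) *
                 tt powi (int (v_perm n \<mu> i) - int (v_perm n \<mu> (i + 1)))
         in to_fract (E (tuple n (\<lambda>r. lookup \<mu> (transpose i (i + 1) r)))) =
            div_diff i (xvar i * E \<mu>) - const tt * rvar i * div_diff i (E \<mu>)
            + const ((1 - tt) * a / (1 - a)) * to_fract (E \<mu>))) \<and>
     (\<forall>\<mu>\<in>expos n.
        to_fract (E (tuple n (\<lambda>r. lookup \<mu> r - 1))) =
        (\<Prod>i\<in>{1..n}. inverse (rvar i)) * to_fract (E \<mu>))"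

text \<open>\<open>\<Sum>\<^bsub>w \<in> S\<^sub>n\<^esub> w (f \<Prod>\<^bsub>i<j\<^esub> (x\<^sub>i - t x\<^sub>j) / (x\<^sub>i - x\<^sub>j))\<close>\<close>

definition t_symmetrization :: "nat \<Rightarrow> laurent \<Rightarrow> ratfun" where
  "t_symmetrization n f =
     (\<Sum>w | w permutes {1..n}.
        perm_act w f *
        (\<Prod>(i, j) | 1 \<le> i \<and> i < j \<and> j \<le> n.
           (rvar (w i) - const tt * rvar (w j)) / (rvar (w i) - rvar (w j))))"

text \<open>
  The bosonic Macdonald polynomial built from the family \<open>E\<close>: the Laurent polynomial of the form
  \<open>1/W\<close> times the symmetrization of \<open>E \<lambda>\<close>, where the scalar \<open>W\<close> is such that the coefficient
  of \<open>x\<^sup>\<lambda>\<close> is 1.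
\<close>

definition bosonic_macdonald :: "nat \<Rightarrow> (expo \<Rightarrow> laurent) \<Rightarrow> expo \<Rightarrow> laurent" where
  "bosonic_macdonald n E lam =
     (THE P. \<exists>W. to_fract P = const (1 / W) * t_symmetrization n (E lam) \<and> lookup P lam = 1)"

text \<open>
  Box statistics are integer valued, so that no subtraction is truncated.
\<close>

definition boxes :: "nat \<Rightarrow> expo \<Rightarrow> (nat \<times> int) set" where
  "boxes n lam = (SIGMA r:{1..n}. {1..lookup lam r})"

definition arm :: "expo \<Rightarrow> nat \<times> int \<Rightarrow> int" where
  "arm lam b = lookup lam (fst b) - snd b"

definition leg :: "nat \<Rightarrow> expo \<Rightarrow> nat \<times> int \<Rightarrow> int" where
  "leg n lam b = int (card {j \<in> {1..n}. snd b \<le> lookup lam j}) - int (fst b)"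

definition coarm :: "nat \<times> int \<Rightarrow> int" where
  "coarm b = snd b - 1"

definition coleg :: "nat \<times> int \<Rightarrow> int" where
  "coleg b = int (fst b) - 1"

definition n_stat :: "nat \<Rightarrow> expo \<Rightarrow> int" where
  "n_stat n lam = (\<Sum>i\<in>{1..n}. (int i - 1) * lookup lam i)"

end

theory Submission
  imports Defs
begin

text \<open>
  Put \<open>e(\<mu>) = E\<^sub>\<mu>(1, t, \<dots>, t\<^bsup>n-1\<^esup>)\<close>.  The relation (E2) applies a Demazure--Lusztig operator \<open>D\<^sub>i\<close> plus a
  scalar, and \<open>D\<^sub>i f\<close> and \<open>f\<close> agree at \<open>(1, t, \<dots>, t\<^bsup>n-1\<^esup>)\<close>; hence
  \<open>e(s\<^sub>i\<mu>) = (1 - ta)/(1 - a) e(\<mu>)\<close>.  By (E1) and (E2) the \<open>E\<^sub>\<mu>\<close> are joint eigenfunctions of the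
  Cherednik operators.  One of these is \<open>D\<^bsub>n-1\<^esub> \<dots> D\<^sub>1 G\<close> with
  \<open>(G f)(x) = f(x\<^sub>2, \<dots>, x\<^sub>n, x\<^sub>1/q)\<close>, and its eigenvalue gives \<open>e(\<mu>\<^sub>n + 1, \<mu>\<^sub>1, \<dots>, \<mu>\<^bsub>n-1\<^esub>)\<close> in terms of
  \<open>e(\<mu>)\<close>.  Every \<open>\<mu> \<in> \<nat>\<^sup>n\<close> is reached from \<open>0\<close> by these two steps, which determines \<open>e(\<mu>)\<close> as a
  product over pairs of indices.

  In the symmetrization of \<open>E\<^sub>\<lambda>\<close> only the summand of the identity survives at
  \<open>(1, t, \<dots>, t\<^bsup>n-1\<^esup>)\<close>.  Bounds on the support of \<open>E\<^sub>\<lambda>\<close> identify \<open>W\<^sub>\<lambda>\<close> with the length generating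
  function of the stabilizer of \<open>\<lambda>\<close>.  The resulting product over pairs telescopes, row by row, to
  the product over boxes.
\<close>

section \<open>Demazure--Lusztig operators on functions of points\<close>

text \<open>Write Y_i for the Cherednik operator with index i. Every D_i acts as the identity at the
  point (1, t, ..., t^(n-1)), so Y_n = D_(n-1) ... D_1 G takes f there to f(t, ..., t^(n-1), 1/q),
  which is exactly the value that (E1) asks for. Only Y_n is ever evaluated. The other Y_i are
  carried along because the eigenvalue statement is proved by induction: raising shifts the index of
  Y_i cyclically, with a factor 1/q at the wrap, and (E2) exchanges the eigenvalues of Y_i and
  Y_(i+1).

  The operators divide by x_i - x_(i+1). They act on functions of points rather than on rational
  functions, so that the Hecke relations become pointwise identities in a field; the evaluation
  point is admissible because no nontrivial power of t is a power of q.

  For W the difficulty is that x^lambda can arise in the summand of w from any monomial of E_lambda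
  whose exponent is a rearrangement of lambda. A bound by dominance alone does not exclude these
  monomials, so the support bound has to tell rearrangements apart.\<close>

definition swap_pt :: "nat \<Rightarrow> (nat \<Rightarrow> 'a) \<Rightarrow> nat \<Rightarrow> 'a" where
  "swap_pt i y = (\<lambda>r. y (transpose i (i + 1) r))"

lemma swap_pt_simps [simp]:
  "swap_pt i y i = y (Suc i)" "swap_pt i y (Suc i) = y i"
  "r \<noteq> i \<Longrightarrow> r \<noteq> Suc i \<Longrightarrow> swap_pt i y r = y r"
  by (simp_all add: swap_pt_def)

lemma swap_pt_swap_pt [simp]: "swap_pt i (swap_pt i y) = y"
  by (simp add: swap_pt_def)

lemma swap_pt_commute: "i + 2 \<le> j \<Longrightarrow> swap_pt i (swap_pt j y) = swap_pt j (swap_pt i y)"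
  by (rule ext) (auto simp: swap_pt_def transpose_def)

lemma swap_pt_braid:
  "swap_pt i (swap_pt (Suc i) (swap_pt i y)) = swap_pt (Suc i) (swap_pt i (swap_pt (Suc i) y))"
  by (rule ext) (auto simp: swap_pt_def transpose_def)

type_synonym 'a ptfun = "(nat \<Rightarrow> 'a) \<Rightarrow> 'a"

text \<open>
  At the non-generic points, where the denominators may vanish, the operators \<open>dop\<close> and \<open>xop\<close> are
  the identity and zero.  Thus every relation below is an equality of functions on all points.
\<close>

locale dl_operators =
  fixes n :: nat and q t :: "'a::field"
  assumes n_pos: "n \<ge> 1" and q_nz: "q \<noteq> 0" and t_nz: "t \<noteq> 0"
begin

text \<open>All powers of q are excluded, not only q^0, because repeated shifts multiply coordinates
  by 1/q; this makes the set stable under swaps and shifts. Nonvanishing is asked of every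
  coordinate, as multiplicativity of evaluation (\<open>ev_mult\<close>) requires.\<close>

definition generic :: "(nat \<Rightarrow> 'a) \<Rightarrow> bool" where
  "generic y \<longleftrightarrow> (\<forall>i. y i \<noteq> 0) \<and>
     (\<forall>i\<in>{1..n}. \<forall>j\<in>{1..n}. i \<noteq> j \<longrightarrow> (\<forall>k::int. y i \<noteq> q powi k * y j))"

definition shift_pt :: "(nat \<Rightarrow> 'a) \<Rightarrow> nat \<Rightarrow> 'a" where
  "shift_pt y = (\<lambda>r. if r = n then inverse q * y 1 else if 1 \<le> r \<and> r < n then y (r + 1) else y r)"

definition hc :: "'a \<Rightarrow> 'a \<Rightarrow> 'a" where
  "hc a b = (t * a - b) / (a - b)"

text \<open>On generic points this is the operator f -> del_i(x_i f) - t x_i del_i f of (E2),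
  rearranged so that it visibly fixes the value of f wherever t y_i = y_(i+1).\<close>

definition dop :: "nat \<Rightarrow> 'a ptfun \<Rightarrow> 'a ptfun" where
  "dop i f y = (if generic y
     then f y + hc (y i) (y (Suc i)) * (f (swap_pt i y) - f y) else f y)"

text \<open>The inverse of D_i, read off from the quadratic relation D_i (D_i - (1 - t)) =
  t.\<close>

definition dinv :: "nat \<Rightarrow> 'a ptfun \<Rightarrow> 'a ptfun" where
  "dinv i f y = (dop i f y - (1 - t) * f y) / t"

definition gop :: "'a ptfun \<Rightarrow> 'a ptfun" where
  "gop f y = f (shift_pt y)"

definition xop :: "nat \<Rightarrow> 'a ptfun \<Rightarrow> 'a ptfun" where
  "xop i f y = (if generic y then y i * f y else 0)"

definition smul :: "'a \<Rightarrow> 'a ptfun \<Rightarrow> 'a ptfun" where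
  "smul c f y = c * f y"

lemma generic_distinct:
  assumes "generic y" "i \<in> {1..n}" "j \<in> {1..n}" "i \<noteq> j"
  shows "y i \<noteq> y j"
  using assms unfolding generic_def by (metis mult_1 power_int_0_right)

text \<open>Swaps, the shift and its inverse all permute the coordinates and scale them by powers of
  q, so one argument serves for all of them.\<close>

lemma generic_reindex:
  assumes g: "generic y" and nz: "\<And>r. z r \<noteq> 0"
    and z: "\<And>r. r \<in> {1..n} \<Longrightarrow> z r = q powi e r * y (\<sigma> r)"
    and \<sigma>: "bij_betw \<sigma> {1..n} {1..n}"
  shows "generic z"
proof -
  have "z i \<noteq> q powi k * z j" if i: "i \<in> {1..n}" and j: "j \<in> {1..n}" and ij: "i \<noteq> j" for i j k
  proof
    assume eq: "z i = q powi k * z j"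
    have "y (\<sigma> i) = q powi (- e i) * z i"
      using z[OF i] q_nz by (simp add: power_int_minus)
    also have "\<dots> = q powi (- e i + k + e j) * y (\<sigma> j)"
      unfolding eq z[OF j] by (simp only: power_int_add[OF disjI1[OF q_nz]] mult.assoc)
    finally have "y (\<sigma> i) = q powi (- e i + k + e j) * y (\<sigma> j)" .
    moreover have "\<sigma> i \<in> {1..n}" "\<sigma> j \<in> {1..n}" "\<sigma> i \<noteq> \<sigma> j"
      using \<sigma> i j ij unfolding bij_betw_def inj_on_def by blast+
    ultimately show False using g unfolding generic_def by blast
  qed
  then show ?thesis using nz unfolding generic_def by blast
qed

lemma generic_swap:
  assumes "1 \<le> i" "i < n"
  shows "generic (swap_pt i y) \<longleftrightarrow> generic y"
proof -
  have b: "bij_betw (transpose i (i + 1)) {1..n} {1..n}"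
    by (rule bij_betw_byWitness[where f' = "transpose i (i + 1)"]) (use assms in \<open>auto simp: transpose_def\<close>)
  have "generic (swap_pt i y)" if "generic y" for y
    by (rule generic_reindex[OF that _ _ b, of _ "\<lambda>_. 0"])
      (use that in \<open>simp_all add: swap_pt_def generic_def\<close>)
  from this[of y] this[of "swap_pt i y"] show ?thesis by auto
qed

lemma generic_shift: "generic (shift_pt y) \<longleftrightarrow> generic y"
proof
  assume g: "generic y"
  show "generic (shift_pt y)"
  proof (rule generic_reindex[OF g])
    show "bij_betw (\<lambda>r. if r = n then 1 else r + 1) {1..n} {1..n}"
      by (rule bij_betw_byWitness[where f' = "\<lambda>r. if r = 1 then n else r - 1"]) auto
    show "shift_pt y r = q powi (if r = n then -1 else 0) * y (if r = n then 1 else r + 1)" if "r \<in> {1..n}" for r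
      using that by (auto simp: shift_pt_def power_int_minus)
    show "shift_pt y r \<noteq> 0" for r using g q_nz by (simp add: generic_def shift_pt_def)
  qed
next
  assume g: "generic (shift_pt y)"
  have z: "y r = q powi (if r = 1 then 1 else 0) * shift_pt y (if r = 1 then n else r - 1)" if "r \<in> {1..n}" for r
    using that q_nz by (auto simp: shift_pt_def)
  show "generic y"
  proof (rule generic_reindex[OF g _ z])
    show "bij_betw (\<lambda>r. if r = 1 then n else r - 1) {1..n} {1..n}"
      by (rule bij_betw_byWitness[where f' = "\<lambda>r. if r = n then 1 else r + 1"]) (use n_pos in auto)
    show "y r \<noteq> 0" for r
    proof (cases "r \<in> {1..n}")
      case True
      then show ?thesis using z[OF True] g q_nz unfolding generic_def by simp
    next
      case False
      then have "shift_pt y r = y r" using n_pos by (auto simp: shift_pt_def)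
      then show ?thesis using g unfolding generic_def by metis
    qed
  qed
qed

lemma smul_smul [simp]: "smul a (smul b f) = smul (a * b) f"
  by (simp add: smul_def fun_eq_iff mult.assoc)

lemma smul_1 [simp]: "smul 1 f = f"
  by (simp add: smul_def fun_eq_iff)

lemma dop_smul: "dop i (smul c f) = smul c (dop i f)"
  by (rule ext) (simp add: dop_def smul_def algebra_simps)

lemma dinv_smul: "dinv i (smul c f) = smul c (dinv i f)"
  by (rule ext) (simp add: dinv_def dop_smul smul_def right_diff_distrib mult.left_commute)

lemma gop_smul: "gop (smul c f) = smul c (gop f)"
  by (simp add: gop_def smul_def fun_eq_iff)

lemma xop_smul: "xop i (smul c f) = smul c (xop i f)"
  by (simp add: xop_def smul_def fun_eq_iff)

lemma dop_add: "dop i (\<lambda>y. f y + g y) = (\<lambda>y. dop i f y + dop i g y)"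
  by (rule ext) (simp add: dop_def algebra_simps)

lemma dinv_add: "dinv i (\<lambda>y. f y + g y) = (\<lambda>y. dinv i f y + dinv i g y)"
  by (rule ext) (simp add: dinv_def dop_add diff_divide_distrib add_divide_distrib distrib_left)

lemma gop_add: "gop (\<lambda>y. f y + g y) = (\<lambda>y. gop f y + gop g y)"
  by (simp add: gop_def fun_eq_iff)

text \<open>The Hecke relation (D_i - 1)(D_i + t) = 0. It comes down to \<open>u + v = 1 + t\<close>
  for the coefficients \<open>u\<close> at \<open>y\<close> and \<open>v\<close> at the swapped
  point.\<close>

lemma dop_quadratic:
  assumes "1 \<le> i" "i < n"
  shows "dop i (dop i f) y = (1 - t) * dop i f y + t * f y"
proof (cases "generic y")
  case True
  then have g: "generic (swap_pt i y)" using generic_swap[OF assms] by simp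
  define a b where "a = y i" and "b = y (Suc i)"
  have ab: "a - b \<noteq> 0" using generic_distinct[OF True, of i "Suc i"] assms by (simp add: a_def b_def)
  then have ba: "b - a \<noteq> 0" by auto
  define f0 f1 where "f0 = f y" and "f1 = f (swap_pt i y)"
  define u v where "u = (t * a - b) / (a - b)" and "v = (t * b - a) / (b - a)"
  have uv: "u + v = 1 + t"
  proof -
    have "v = (a - t * b) / (a - b)" unfolding v_def by (metis minus_diff_eq minus_divide_divide)
    then show ?thesis unfolding u_def using ab by (simp add: field_simps)
  qed
  have d0: "dop i f y = f0 + u * (f1 - f0)"
    using True by (simp add: dop_def hc_def u_def a_def b_def f0_def f1_def)
  have d1: "dop i f (swap_pt i y) = f1 + v * (f0 - f1)"
    using g by (simp add: dop_def hc_def v_def a_def b_def f0_def f1_def)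
  have d2: "dop i (dop i f) y = dop i f y + u * (dop i f (swap_pt i y) - dop i f y)"
    using True by (subst dop_def) (simp add: hc_def u_def a_def b_def)
  have v: "v = 1 + t - u" using uv by (simp add: algebra_simps)
  show ?thesis unfolding d2 d0 d1 v f0_def[symmetric] by (simp add: algebra_simps)
next
  case False
  then show ?thesis by (simp add: dop_def algebra_simps)
qed

lemma dop_dinv:
  assumes "1 \<le> i" "i < n"
  shows "dop i (dinv i f) = f"
proof -
  have "dinv i f = (\<lambda>y. smul (inverse t) (dop i f) y + smul (- (1 - t) / t) f y)"
    by (simp add: dinv_def smul_def fun_eq_iff field_simps t_nz)
  then have "dop i (dinv i f) = (\<lambda>y. smul (inverse t) (dop i (dop i f)) y + smul (- (1 - t) / t) (dop i f) y)"
    by (simp add: dop_add dop_smul)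
  then show ?thesis
    by (simp add: smul_def fun_eq_iff dop_quadratic[OF assms] field_simps t_nz)
qed

lemma dinv_dop:
  assumes "1 \<le> i" "i < n"
  shows "dinv i (dop i f) = f"
  by (simp add: dinv_def fun_eq_iff dop_quadratic[OF assms] t_nz)

lemma dop_commute:
  assumes "1 \<le> i" "i + 2 \<le> j" "j < n"
  shows "dop i (dop j f) = dop j (dop i f)"
proof
  fix y
  show "dop i (dop j f) y = dop j (dop i f) y"
  proof (cases "generic y")
    case True
    have g: "generic (swap_pt i y)" "generic (swap_pt j y)" using True assms by (simp_all add: generic_swap)
    have v: "swap_pt j y i = y i" "swap_pt j y (Suc i) = y (Suc i)"
      "swap_pt i y j = y j" "swap_pt i y (Suc j) = y (Suc j)" using assms by simp_all
    have c: "swap_pt i (swap_pt j y) = swap_pt j (swap_pt i y)" by (rule swap_pt_commute) (use assms in simp)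
    show ?thesis using True g v c by (simp add: dop_def algebra_simps)
  qed (simp add: dop_def)
qed

text \<open>When both sides of the braid relation are expanded over the six permutations of three
  coordinates, these are the coefficients of the identity and of the two simple swaps. The other
  three agree by commutativity of multiplication alone.\<close>

lemma braid_coeffs:
  fixes a b c :: 'a
  assumes "a \<noteq> b" "b \<noteq> c" "a \<noteq> c"
  defines "u \<equiv> \<lambda>a b. (t * a - b) / (a - b)"
  shows "(1 - u a b) * (1 - u b c) * (1 - u a b) + u a b * (1 - u a c) * u b a
       = (1 - u b c) * (1 - u a b) * (1 - u b c) + u b c * (1 - u a c) * u c b"
    and "(1 - u a b) * (1 - u b c) * u a b + u a b * (1 - u a c) * (1 - u b a) = (1 - u b c) * u a b * (1 - u a c)"
    and "(1 - u a b) * u b c * (1 - u a c) = (1 - u b c) * (1 - u a b) * u b c + u b c * (1 - u a c) * (1 - u c b)"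
proof -
  have "a - b \<noteq> 0" "b - c \<noteq> 0" "a - c \<noteq> 0" "b - a \<noteq> 0" "c - b \<noteq> 0" using assms by auto
  note nz = this
  have w: "u b a = (a - t * b) / (a - b)" "u c b = (b - t * c) / (b - c)"
    unfolding u_def by (metis minus_diff_eq minus_divide_divide)+
  have w1: "1 - u a b = (1 - t) * a / (a - b)" "1 - u b c = (1 - t) * b / (b - c)"
    "1 - u a c = (1 - t) * a / (a - c)" "1 - u b a = - (1 - t) * b / (a - b)" "1 - u c b = - (1 - t) * c / (b - c)"
    unfolding w unfolding u_def using nz by (simp_all add: field_simps)
  show "(1 - u a b) * (1 - u b c) * (1 - u a b) + u a b * (1 - u a c) * u b a
       = (1 - u b c) * (1 - u a b) * (1 - u b c) + u b c * (1 - u a c) * u c b"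
    unfolding w1 unfolding w unfolding u_def
    using nz by (simp add: divide_simps) (simp add: algebra_simps)
  show "(1 - u a b) * (1 - u b c) * u a b + u a b * (1 - u a c) * (1 - u b a) = (1 - u b c) * u a b * (1 - u a c)"
    unfolding w1 unfolding u_def
    using nz by (simp add: divide_simps) (simp add: algebra_simps)
  show "(1 - u a b) * u b c * (1 - u a c) = (1 - u b c) * (1 - u a b) * u b c + u b c * (1 - u a c) * (1 - u c b)"
    unfolding w1 unfolding u_def
    using nz by (simp add: divide_simps) (simp add: algebra_simps)
qed

lemma dop_generic:
  assumes "generic y"
  shows "dop i f y = (1 - hc (y i) (y (Suc i))) * f y + hc (y i) (y (Suc i)) * f (swap_pt i y)"
  using assms by (simp add: dop_def algebra_simps)

lemma dop_braid:
  assumes "1 \<le> i" "i + 1 < n"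
  shows "dop i (dop (Suc i) (dop i f)) = dop (Suc i) (dop i (dop (Suc i) f))"
proof
  fix y
  show "dop i (dop (Suc i) (dop i f)) y = dop (Suc i) (dop i (dop (Suc i) f)) y"
  proof (cases "generic y")
    case True
    define a b c where "a = y i" and "b = y (Suc i)" and "c = y (Suc (Suc i))"
    define u where "u = hc"
    have ne: "a \<noteq> b" "b \<noteq> c" "a \<noteq> c" using generic_distinct[OF True] assms by (simp_all add: a_def b_def c_def)
    let ?s = "swap_pt i" and ?r = "swap_pt (Suc i)"
    have g [simp]: "generic (?s z) \<longleftrightarrow> generic z" "generic (?r z) \<longleftrightarrow> generic z" for z
      using assms by (simp_all add: generic_swap)
    define f0 f1 f2 f12 f21 f3 where "f0 = f y" and "f1 = f (?s y)" and "f2 = f (?r y)"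
      and "f12 = f (?s (?r y))" and "f21 = f (?r (?s y))" and "f3 = f (?s (?r (?s y)))"
    note B = braid_coeffs[OF ne, folded hc_def, folded u_def]
    have L: "dop i (dop (Suc i) (dop i f)) y =
       (1 - u a b) * ((1 - u b c) * ((1 - u a b) * f0 + u a b * f1) + u b c * ((1 - u a c) * f2 + u a c * f12))
       + u a b * ((1 - u a c) * ((1 - u b a) * f1 + u b a * f0) + u a c * ((1 - u b c) * f21 + u b c * f3))"
      using True by (simp add: dop_generic u_def a_def b_def c_def f0_def f1_def f2_def f12_def f21_def f3_def)
    have R: "dop (Suc i) (dop i (dop (Suc i) f)) y =
       (1 - u b c) * ((1 - u a b) * ((1 - u b c) * f0 + u b c * f2) + u a b * ((1 - u a c) * f1 + u a c * f21))
       + u b c * ((1 - u a c) * ((1 - u c b) * f2 + u c b * f0) + u a c * ((1 - u a b) * f12 + u a b * f3))"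
      using True by (simp add: dop_generic u_def a_def b_def c_def f0_def f1_def f2_def f12_def f21_def f3_def swap_pt_braid)
    have "dop i (dop (Suc i) (dop i f)) y =
       ((1 - u a b) * (1 - u b c) * (1 - u a b) + u a b * (1 - u a c) * u b a) * f0
       + ((1 - u a b) * (1 - u b c) * u a b + u a b * (1 - u a c) * (1 - u b a)) * f1
       + ((1 - u a b) * u b c * (1 - u a c)) * f2 + (1 - u a b) * u b c * u a c * f12
       + u a b * u a c * (1 - u b c) * f21 + u a b * u a c * u b c * f3"
      unfolding L by (simp only: distrib_left distrib_right mult.assoc mult.commute mult.left_commute add.assoc add.commute add.left_commute)
    also have "\<dots> = ((1 - u b c) * (1 - u a b) * (1 - u b c) + u b c * (1 - u a c) * u c b) * f0
       + ((1 - u b c) * u a b * (1 - u a c)) * f1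
       + ((1 - u b c) * (1 - u a b) * u b c + u b c * (1 - u a c) * (1 - u c b)) * f2 + (1 - u a b) * u b c * u a c * f12
       + u a b * u a c * (1 - u b c) * f21 + u a b * u a c * u b c * f3"
      by (simp only: B)
    also have "\<dots> = dop (Suc i) (dop i (dop (Suc i) f)) y"
      unfolding R by (simp only: distrib_left distrib_right mult.assoc mult.commute mult.left_commute add.assoc add.commute add.left_commute)
    finally show ?thesis .
  next
    case False
    then show ?thesis by (simp add: dop_def)
  qed
qed

lemma gop_dop:
  assumes "1 \<le> i" "i + 1 < n"
  shows "gop (dop i f) = dop (Suc i) (gop f)"
proof
  fix y
  have s: "swap_pt i (shift_pt y) = shift_pt (swap_pt (Suc i) y)"
    using assms by (intro ext) (auto simp: swap_pt_def transpose_def shift_pt_def)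
  show "gop (dop i f) y = dop (Suc i) (gop f) y"
    using assms by (simp add: gop_def dop_def generic_shift s) (simp add: shift_pt_def)
qed

text \<open>The cyclic index n - 1 -> n -> 1 closes up only after two shifts. Then both coordinates
  involved carry the factor 1/q, which cancels in \<open>hc\<close>.\<close>

lemma gop_gop_dop:
  assumes "2 \<le> n"
  shows "gop (gop (dop (n - 1) f)) = dop 1 (gop (gop f))"
proof
  fix y
  have s: "swap_pt (n - 1) (shift_pt (shift_pt y)) = shift_pt (shift_pt (swap_pt 1 y))"
    using assms by (intro ext) (auto simp: swap_pt_def transpose_def shift_pt_def)
  have v: "shift_pt (shift_pt y) (n - 1) = inverse q * y 1" "shift_pt (shift_pt y) n = inverse q * y 2"
    using assms by (auto simp: shift_pt_def numeral_2_eq_2)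
  have "(t * (inverse q * y 1) - inverse q * y 2) / (inverse q * y 1 - inverse q * y 2)
     = (inverse q * (t * y 1 - y 2)) / (inverse q * (y 1 - y 2))"
    by (simp add: algebra_simps)
  also have "\<dots> = (t * y 1 - y 2) / (y 1 - y 2)" using q_nz by simp
  finally show "gop (gop (dop (n - 1) f)) y = dop 1 (gop (gop f)) y"
    using assms v by (simp add: gop_def dop_def hc_def generic_shift s[unfolded One_nat_def] numeral_2_eq_2)
qed

lemma xop_dop:
  assumes i: "1 \<le> i" "i < n" and "j \<noteq> i" "j \<noteq> Suc i"
  shows "dop i (xop j f) = xop j (dop i f)"
  using assms i by (auto simp: dop_def xop_def fun_eq_iff algebra_simps generic_swap)

lemma gop_xop: "1 \<le> i \<Longrightarrow> i < n \<Longrightarrow> gop (xop i f) = xop (Suc i) (gop f)"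
  by (auto simp: gop_def xop_def generic_shift fun_eq_iff) (simp add: shift_pt_def)

lemma gop_xop_n: "gop (xop n f) = smul (inverse q) (xop 1 (gop f))"
  by (auto simp: gop_def xop_def generic_shift smul_def fun_eq_iff) (simp add: shift_pt_def)

text \<open>The relation D_i x_(i+1) D_i = t x_i of the double affine Hecke algebra;
  \<open>dinv_xop\<close> and \<open>dop_xop_Suc\<close> are its two rearrangements.\<close>

lemma dop_xop_Suc_dop:
  assumes "1 \<le> i" "i < n"
  shows "dop i (xop (Suc i) (dop i f)) = smul t (xop i f)"
proof
  fix y
  show "dop i (xop (Suc i) (dop i f)) y = smul t (xop i f) y"
  proof (cases "generic y")
    case True
    then have g: "generic (swap_pt i y)" using generic_swap[OF assms] by simp
    define a b where "a = y i" and "b = y (Suc i)"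
    have ab: "a - b \<noteq> 0" using generic_distinct[OF True, of i "Suc i"] assms by (simp add: a_def b_def)
    then have ba: "b - a \<noteq> 0" by auto
    define f0 f1 where "f0 = f y" and "f1 = f (swap_pt i y)"
    define u v where "u = (t * a - b) / (a - b)" and "v = (t * b - a) / (b - a)"
    have v: "v = (a - t * b) / (a - b)" unfolding v_def by (metis minus_diff_eq minus_divide_divide)
    have d0: "dop i f y = f0 + u * (f1 - f0)"
      using True by (simp add: dop_def hc_def u_def a_def b_def f0_def f1_def)
    have d1: "dop i f (swap_pt i y) = f1 + v * (f0 - f1)"
      using g by (simp add: dop_def hc_def v_def a_def b_def f0_def f1_def)
    have d2: "dop i (xop (Suc i) (dop i f)) y = b * dop i f y + u * (a * dop i f (swap_pt i y) - b * dop i f y)"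
      using True g by (subst dop_def) (simp add: hc_def u_def a_def b_def xop_def)
    have c0: "(1 - u) * b * (1 - u) + u * a * v = t * a"
      unfolding v u_def using ab by (simp add: divide_simps) (simp add: algebra_simps)
    have c1: "(1 - u) * b * u + u * a * (1 - v) = 0"
      unfolding v u_def using ab by (simp add: divide_simps) (simp add: algebra_simps)
    have "dop i (xop (Suc i) (dop i f)) y
       = ((1 - u) * b * (1 - u) + u * a * v) * f0 + ((1 - u) * b * u + u * a * (1 - v)) * f1"
      unfolding d2 d1 d0 by (simp add: algebra_simps)
    also have "\<dots> = t * (y i * f y)" unfolding c0 c1 by (simp add: a_def f0_def)
    finally show ?thesis using True by (simp add: smul_def xop_def)
  next
    case False
    then show ?thesis by (simp add: dop_def xop_def smul_def)
  qed
qed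

end

section \<open>Cherednik operators and their commutation with the D_i\<close>

context dl_operators
begin

lemma dinv_dop_commute:
  assumes "1 \<le> i" "i + 2 \<le> j" "j < n"
  shows "dinv i (dop j f) = dop j (dinv i f)" and "dop i (dinv j f) = dinv j (dop i f)"
proof -
  have i: "1 \<le> i" "i < n" and j: "1 \<le> j" "j < n" using assms by auto
  note c = dop_commute[OF assms]
  have 1: "dinv i (dop j f) = dop j (dinv i f)" for f
    by (metis c dop_dinv[OF i] dinv_dop[OF i])
  show "dinv i (dop j f) = dop j (dinv i f)" by (rule 1)
  show "dop i (dinv j f) = dinv j (dop i f)"
    by (metis c dop_dinv[OF j] dinv_dop[OF j])
qed

text \<open>The braid relation with two factors moved across. In this form it carries D_(i+1)
  through D_i^-1 D_(i+1)^-1 and turns it into D_i, as \<open>cop_dop_commute\<close>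
  requires.\<close>

lemma dinv_braid:
  assumes "1 \<le> i" "i + 1 < n"
  shows "dop (Suc i) (dinv i (dinv (Suc i) f)) = dinv i (dinv (Suc i) (dop i f))"
    and "dop i (dinv (Suc i) (dinv i f)) = dinv (Suc i) (dinv i (dop (Suc i) f))"
proof -
  have i: "1 \<le> i" "i < n" and j: "1 \<le> Suc i" "Suc i < n" using assms by auto
  note b = dop_braid[OF assms]
  note s = dop_dinv[OF i] dop_dinv[OF j] dinv_dop[OF i] dinv_dop[OF j]
  show "dop (Suc i) (dinv i (dinv (Suc i) f)) = dinv i (dinv (Suc i) (dop i f))"
    by (metis b s)
  show "dop i (dinv (Suc i) (dinv i f)) = dinv (Suc i) (dinv i (dop (Suc i) f))"
    by (metis b s)
qed

text \<open>\<open>dchain m = D\<^sub>m \<dots> D\<^sub>1\<close>, and \<open>uchain k = D\<^bsub>n-1\<^esub> \<dots> D\<^bsub>n-k\<^esub>\<close>.\<close>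

primrec dchain :: "nat \<Rightarrow> 'a ptfun \<Rightarrow> 'a ptfun" where
  "dchain 0 f = f"
| "dchain (Suc m) f = dop (Suc m) (dchain m f)"

primrec uchain :: "nat \<Rightarrow> 'a ptfun \<Rightarrow> 'a ptfun" where
  "uchain 0 f = f"
| "uchain (Suc k) f = uchain k (dop (n - Suc k) f)"

text \<open>\<open>cop k\<close> is the Cherednik operator with index \<open>n - k\<close>.\<close>

primrec cop :: "nat \<Rightarrow> 'a ptfun \<Rightarrow> 'a ptfun" where
  "cop 0 f = dchain (n - 1) (gop f)"
| "cop (Suc k) f = smul t (dinv (n - Suc k) (cop k (dinv (n - Suc k) f)))"

text \<open>Up to a power of \<open>q\<close>, the raising operator of (E1).\<close>

definition phi :: "'a ptfun \<Rightarrow> 'a ptfun" where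
  "phi f = xop 1 (gop f)"

lemma phi_smul: "phi (smul c f) = smul c (phi f)"
  by (simp add: phi_def gop_smul xop_smul)

lemma dchain_smul: "dchain m (smul c f) = smul c (dchain m f)"
  by (induction m) (simp_all add: dop_smul)

lemma dchain_add: "dchain m (\<lambda>y. f y + g y) = (\<lambda>y. dchain m f y + dchain m g y)"
  by (induction m) (simp_all add: dop_add)

lemma cop_smul: "cop k (smul c f) = smul c (cop k f)"
proof (induction k arbitrary: f)
  case 0
  then show ?case by (simp add: gop_smul dchain_smul)
next
  case (Suc k)
  then show ?case by (simp add: dinv_smul mult.commute)
qed

lemma smul_add: "smul c (\<lambda>y. f y + g y) = (\<lambda>y. smul c f y + smul c g y)"
  by (rule ext) (simp add: smul_def distrib_left)

lemma cop_add: "cop k (\<lambda>y. f y + g y) = (\<lambda>y. cop k f y + cop k g y)"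
proof (induction k arbitrary: f g)
  case 0
  then show ?case by (simp add: gop_add dchain_add)
next
  case (Suc k)
  then show ?case by (simp add: dinv_add smul_add)
qed

lemma dop_dchain_far:
  "m + 2 \<le> j \<Longrightarrow> j < n \<Longrightarrow> dop j (dchain m f) = dchain m (dop j f)"
proof (induction m)
  case (Suc m)
  have "dop j (dchain (Suc m) f) = dop (Suc m) (dop j (dchain m f))"
    using Suc.prems dop_commute[of "Suc m" j "dchain m f"] by simp
  then show ?case using Suc by simp
qed simp

text \<open>D_j passes the factors D_m, ..., D_(j+2), becomes D_(j+1) by the braid relation D_j
  D_(j+1) D_j = D_(j+1) D_j D_(j+1), and passes the remaining factors D_(j-1), ..., D_1.\<close>

lemma dop_dchain:
  assumes "1 \<le> j" "j < m" "m < n"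
  shows "dop j (dchain m f) = dchain m (dop (Suc j) f)"
  using assms
proof (induction m)
  case (Suc m)
  show ?case
  proof (cases "j = m")
    case True
    then obtain l where l: "m = Suc l" using Suc.prems by (cases m) auto
    have "dop j (dchain (Suc m) f) = dop m (dop (Suc m) (dop m (dchain l f)))" using True l by simp
    also have "\<dots> = dop (Suc m) (dop m (dop (Suc m) (dchain l f)))"
      using Suc.prems True by (intro dop_braid) auto
    also have "dop (Suc m) (dchain l f) = dchain l (dop (Suc m) f)"
      using Suc.prems l by (intro dop_dchain_far) auto
    finally show ?thesis using True l by simp
  next
    case False
    then have "dop j (dchain m f) = dchain m (dop (Suc j) f)" using Suc by auto
    then show ?thesis using Suc.prems False dop_commute[of j "Suc m"] by simp
  qed
qed simp

text \<open>Passing the chain raises the index by one, and so does passing from inside G to outside;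
  the two effects cancel.\<close>

lemma cop_0_dop:
  assumes "1 \<le> j" "j + 1 < n"
  shows "dop j (cop 0 f) = cop 0 (dop j f)"
  using assms by (simp add: dop_dchain gop_dop)

text \<open>D_j commutes with Y_i unless j is i or i - 1. In Y_i = t D_i^-1 Y_(i+1) D_i^-1 all three
  factors commute with D_j, except when j = i + 1.\<close>

lemma cop_dop_commute:
  assumes "k < n" "1 \<le> j" "j < n" "j \<noteq> n - k" "j + 1 \<noteq> n - k"
  shows "dop j (cop k f) = cop k (dop j f)"
  using assms
proof (induction k arbitrary: j f rule: less_induct)
  case (less k)
  show ?case
  proof (cases k)
    case 0
    then show ?thesis using less.prems cop_0_dop[of j] by auto
  next
    case (Suc l)
    define i where "i = n - Suc l"
    have i: "1 \<le> i" "i < n" using less.prems Suc by (auto simp: i_def)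
    show ?thesis
    proof (cases "j = Suc i")
      case False
      have IH: "dop j (cop l g) = cop l (dop j g)" for g
        using False less.prems Suc by (intro less.IH) (auto simp: i_def)
      have c: "dop j (dinv i g) = dinv i (dop j g)" for g
      proof (cases "j < i")
        case True
        then show ?thesis using dinv_dop_commute(2)[of j i] less.prems i Suc by (auto simp: i_def)
      next
        case False
        then show ?thesis
          using dinv_dop_commute(1)[of i j] \<open>j \<noteq> Suc i\<close> less.prems i Suc by (auto simp: i_def)
      qed
      show ?thesis unfolding Suc by (simp add: i_def[symmetric] dop_smul c IH)
    next
      case True
      then obtain m where m: "l = Suc m" using less.prems Suc by (cases l) (auto simp: i_def)
      have j: "n - Suc m = Suc i" using less.prems Suc m i by (auto simp: i_def)
      have IH: "dop i (cop m g) = cop m (dop i g)" for g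
        using less.prems Suc m i by (intro less.IH) (auto simp: i_def)
      have b: "1 \<le> i" "i + 1 < n" using i True less.prems by auto
      \<comment> \<open>For j = i + 1 the recursion is unfolded twice: D_(i+1) becomes D_i in
        passing the first two inverses, commutes with Y_(i+2), and turns back into D_(i+1) in
        passing the last two.\<close>
      have "cop k f = smul (t * t) (dinv i (dinv (Suc i) (cop m (dinv (Suc i) (dinv i f)))))" for f
        unfolding Suc m using j by (simp add: i_def[symmetric, unfolded m] dinv_smul)
      then show ?thesis
        unfolding True by (simp add: dop_smul dinv_braid[OF b] IH)
    qed
  qed
qed

lemma dop_cop_dop:
  assumes "Suc k < n"
  shows "dop (n - Suc k) (cop (Suc k) (dop (n - Suc k) f)) = smul t (cop k f)"
  using assms by (simp add: dop_smul dop_dinv dinv_dop)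

lemma dinv_phi:
  assumes "1 \<le> i" "i + 1 < n"
  shows "dop (Suc i) (phi f) = phi (dop i f)" and "dinv (Suc i) (phi f) = phi (dinv i f)"
proof -
  have 1: "dop (Suc i) (phi f) = phi (dop i f)" for f
    using assms by (simp add: phi_def xop_dop gop_dop)
  show "dop (Suc i) (phi f) = phi (dop i f)" by (rule 1)
  show "dinv (Suc i) (phi f) = phi (dinv i f)"
    using 1[of "dinv i f"] assms by (metis add.commute dop_dinv dinv_dop le_SucI plus_1_eq_Suc Suc_lessD)
qed

lemma dinv_xop:
  assumes "1 \<le> i" "i < n"
  shows "dinv i (xop i f) = smul (inverse t) (xop (Suc i) (dop i f))"
proof -
  have "smul t (xop i f) = dop i (xop (Suc i) (dop i f))" using dop_xop_Suc_dop[OF assms] by simp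
  then have "smul t (dinv i (xop i f)) = xop (Suc i) (dop i f)"
    by (metis dinv_smul dinv_dop[OF assms])
  then have "smul (inverse t) (smul t (dinv i (xop i f))) = smul (inverse t) (xop (Suc i) (dop i f))" by simp
  then show ?thesis using t_nz by simp
qed

lemma dop_xop_Suc:
  assumes "1 \<le> i" "i < n"
  shows "dop i (xop (Suc i) f) = smul t (xop i (dinv i f))"
  using dop_xop_Suc_dop[OF assms, of "dinv i f"] by (simp add: dop_dinv[OF assms])

end

section \<open>Cherednik operators against raising, intertwiners, and the base point\<close>

context dl_operators
begin

text \<open>This is D_(m+1) ... D_2, the chain without its innermost factor. Having no factor D_1,
  it commutes with x_1 and passes through G as D_m ... D_1.\<close>

primrec echain :: "nat \<Rightarrow> 'a ptfun \<Rightarrow> 'a ptfun" where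
  "echain 0 f = f"
| "echain (Suc m) f = dop (Suc (Suc m)) (echain m f)"

lemma dchain_Suc_echain: "dchain (Suc m) f = echain m (dop 1 f)"
  by (induction m) simp_all

lemma echain_smul: "echain m (smul c f) = smul c (echain m f)"
  by (induction m) (simp_all add: dop_smul)

lemma echain_gop: "Suc m < n \<Longrightarrow> echain m (gop f) = gop (dchain m f)"
  by (induction m) (simp_all add: gop_dop)

lemma echain_xop: "Suc m < n \<Longrightarrow> echain m (xop 1 f) = xop 1 (echain m f)"
  by (induction m) (simp_all add: xop_dop)

lemma gop_gop_dinv:
  assumes "2 \<le> n"
  shows "gop (gop (dinv (n - 1) f)) = dinv 1 (gop (gop f))"
  using gop_gop_dop[OF assms, of "dinv (n - 1) f"] assms
  by (metis One_nat_def Suc_1 Suc_le_eq diff_less dop_dinv dinv_dop le_refl less_le_trans n_pos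
      one_le_numeral diff_le_mono diff_add_inverse plus_1_eq_Suc zero_less_one)

text \<open>Y_n phi = phi Y_(n-1). In D_(n-1) ... D_1 G x_1 G one uses G x_1 = x_2 G, then D_1 x_2 =
  t x_1 D_1^-1, then D_1^-1 G^2 = G^2 D_(n-1)^-1; the factors D_(n-1), ..., D_2 left over move
  inside x_1 G with indices lowered by one.\<close>

lemma cop_0_phi:
  assumes "2 \<le> n"
  shows "cop 0 (phi f) = phi (cop 1 f)"
proof -
  define m where "m = n - 2"
  have m: "n - 1 = Suc m" "n - Suc 0 = Suc m" "Suc m < n" "1 < n" using assms by (auto simp: m_def)
  define h where "h = dinv (Suc m) f"
  have h: "dinv 1 (gop (gop f)) = gop (gop h)" using gop_gop_dinv[OF assms] m by (simp add: h_def)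
  have "cop 0 (phi f) = dchain (Suc m) (xop 2 (gop (gop f)))"
    using m by (simp add: phi_def gop_xop numeral_2_eq_2)
  also have "\<dots> = echain m (dop 1 (xop 2 (gop (gop f))))"
    by (rule dchain_Suc_echain)
  also have "dop 1 (xop 2 (gop (gop f))) = smul t (xop 1 (gop (gop h)))"
    using dop_xop_Suc[of 1 "gop (gop f)"] m h by (simp add: numeral_2_eq_2)
  also have "echain m \<dots> = smul t (phi (dchain m (gop h)))"
    using m by (simp add: echain_smul echain_xop[unfolded One_nat_def] echain_gop phi_def)
  also have "\<dots> = phi (cop 1 f)"
    using m by (simp add: h_def phi_smul dinv_dop)
  finally show ?thesis .
qed

text \<open>Each step of the recursion for Y_i conjugates by an inverse D, and phi lowers the index
  of that D by one.\<close>

lemma cop_phi: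
  assumes "k + 1 < n"
  shows "cop k (phi f) = phi (cop (Suc k) f)"
  using assms
proof (induction k arbitrary: f)
  case 0
  then show ?case using cop_0_phi by simp
next
  case (Suc k)
  define j where "j = n - Suc (Suc k)"
  have j: "n - Suc k = Suc j" "1 \<le> j" "j + 1 < n" using Suc.prems by (auto simp: j_def)
  have "cop (Suc k) (phi f) = smul t (dinv (Suc j) (cop k (phi (dinv j f))))"
    using j by (simp add: dinv_phi)
  also have "\<dots> = smul t (phi (dinv j (cop (Suc k) (dinv j f))))"
    using Suc.IH[of "dinv j f"] Suc.prems by (simp only: dinv_phi(2)[OF j(2,3), symmetric])
  also have "\<dots> = phi (cop (Suc (Suc k)) f)"
    by (simp only: cop.simps(2)[of "Suc k"] j_def[symmetric] phi_smul)
  finally show ?case .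
qed

text \<open>The inductive form of the computation of Y_1 x_1. Each step of the recursion removes the
  outermost factor of the left chain through D_i^-1 and adds a factor D_i to the chain inside G; at
  k = n - 1 the left chain is empty and the inner one is complete. The factor 1/q comes from G x_n =
  q^-1 x_1 G.\<close>

lemma cop_xop:
  assumes "k < n"
  shows "cop k (xop (n - k) g) = smul (inverse q) (dchain (n - Suc k) (xop 1 (gop (uchain k g))))"
  using assms
proof (induction k arbitrary: g)
  case 0
  then show ?case by (simp add: gop_xop_n dchain_smul)
next
  case (Suc k)
  define j where "j = n - Suc (Suc k)"
  define i where "i = n - Suc k"
  have i: "1 \<le> i" "i < n" "i = Suc j" "n - k = Suc i" using Suc.prems by (auto simp: i_def j_def)
  have "cop (Suc k) (xop i g) = smul t (dinv i (cop k (smul (inverse t) (xop (Suc i) (dop i g)))))"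
    using i by (simp add: i_def[symmetric] dinv_xop)
  also have "\<dots> = dinv i (cop k (xop (n - k) (dop i g)))"
    using t_nz by (simp add: i(4) cop_smul dinv_smul)
  also have "\<dots> = dinv i (smul (inverse q) (dchain i (xop 1 (gop (uchain k (dop i g))))))"
    using Suc.IH[of "dop i g"] Suc.prems by (simp add: i_def)
  also have "\<dots> = smul (inverse q) (dchain j (xop 1 (gop (uchain (Suc k) g))))"
    using dinv_dop[OF i(1,2)] by (simp add: i(3) dinv_smul i_def[symmetric])
  finally show ?case by (simp only: i_def j_def)
qed

lemma uchain_dchain:
  assumes "k < n"
  shows "uchain k (dchain (n - Suc k) f) = dchain (n - 1) f"
  using assms
proof (induction k)
  case (Suc k)
  then have "n - Suc k = Suc (n - Suc (Suc k))" by simp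
  then have "dop (n - Suc k) (dchain (n - Suc (Suc k)) f) = dchain (n - Suc k) f" by simp
  then show ?case using Suc by simp
qed simp

text \<open>Y_1 phi = q^-1 phi Y_n: the case k = n - 1 of \<open>cop_xop\<close>, where the full
  inner chain applied to G f is Y_n f.\<close>

lemma cop_last_phi: "cop (n - 1) (phi f) = smul (inverse q) (phi (cop 0 f))"
proof -
  have "n - 1 < n" using n_pos by simp
  from cop_xop[OF this, of "gop f"] uchain_dchain[OF this, of "gop f"]
  show ?thesis using n_pos by (simp add: phi_def)
qed

text \<open>The constant polynomial 1, under the convention that functions coming from Laurent
  polynomials vanish at the non-generic points. It represents E_0.\<close>

definition generic_one :: "(nat \<Rightarrow> 'a) \<Rightarrow> 'a" where
  "generic_one y = (if generic y then 1 else 0)"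

lemma dop_generic_one:
  assumes "1 \<le> i" "i < n"
  shows "dop i generic_one = generic_one" and "dinv i generic_one = generic_one"
proof -
  show 1: "dop i generic_one = generic_one"
    using assms by (auto simp: fun_eq_iff dop_def generic_one_def generic_swap)
  show "dinv i generic_one = generic_one"
    using dinv_dop[OF assms, of generic_one] 1 by simp
qed

lemma gop_generic_one: "gop generic_one = generic_one"
  by (simp add: fun_eq_iff gop_def generic_one_def generic_shift)

lemma dchain_generic_one: "m < n \<Longrightarrow> dchain m generic_one = generic_one"
  by (induction m) (simp_all add: dop_generic_one)

lemma cop_generic_one: "k < n \<Longrightarrow> cop k generic_one = smul (t ^ k) generic_one"
  by (induction k) (simp_all add: gop_generic_one dchain_generic_one dop_generic_one dinv_smul n_pos)

text \<open>Since t D_i^-1 = D_i - (1 - t), one gets Y_i D_i f = t D_i^-1 Y_(i+1) f = beta (D_i f -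
  (1 - t) f). Comparing the multiples of f in Y_i g and in beta g gives the condition on
  \<open>c\<close>. The claim for Y_(i+1) uses D_i Y_i D_i = t Y_(i+1) on D_i f.\<close>

lemma cop_intertwiner:
  fixes c :: 'a
  assumes i: "1 \<le> i" "i < n"
    and a: "cop (n - i) f = smul \<alpha> f" and b: "cop (n - Suc i) f = smul \<beta> f"
    and c: "c * (\<alpha> - \<beta>) = (1 - t) * \<beta>"
  defines "g \<equiv> \<lambda>y. dop i f y + smul c f y"
  shows "cop (n - i) g = smul \<beta> g" and "cop (n - Suc i) g = smul \<alpha> g"
proof -
  define k where "k = n - Suc i"
  have k: "n - i = Suc k" "n - Suc k = i" "Suc k < n" using i by (auto simp: k_def)
  have q: "dop i (dop i h) = (\<lambda>y. smul (1 - t) (dop i h) y + smul t h y)" for h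
    by (rule ext) (simp add: dop_quadratic[OF i] smul_def)
  have "cop (Suc k) (dop i f) = smul t (dinv i (smul \<beta> f))"
    using k b i by (simp add: dinv_dop k_def[symmetric])
  then have 1: "cop (Suc k) (dop i f) y = \<beta> * (dop i f y - (1 - t) * f y)" for y
    using t_nz by (simp add: dinv_smul smul_def dinv_def)
  have g1: "cop (Suc k) g y = \<beta> * (dop i f y - (1 - t) * f y) + c * \<alpha> * f y" for y
    unfolding g_def cop_add cop_smul 1 using a k by (simp add: smul_def)
  have ca: "c * \<alpha> = c * \<beta> + (1 - t) * \<beta>" using c by (simp add: algebra_simps)
  show "cop (n - i) g = smul \<beta> g"
    unfolding k by (rule ext, unfold g1 ca) (simp add: g_def smul_def algebra_simps)
  have "smul t (cop k (dop i f)) = dop i (cop (Suc k) (dop i (dop i f)))"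
    using dop_cop_dop[OF k(3)] k by simp
  also have "\<dots> = dop i (\<lambda>y. smul (1 - t) (cop (Suc k) (dop i f)) y + smul (t * \<alpha>) f y)"
    unfolding q cop_add cop_smul using a k by simp
  also have "\<dots> = (\<lambda>y. smul (1 - t) (dop i (cop (Suc k) (dop i f))) y + smul (t * \<alpha>) (dop i f) y)"
    by (simp only: dop_add dop_smul)
  also have "dop i (cop (Suc k) (dop i f)) = smul t (cop k f)"
    using dop_cop_dop[OF k(3)] k by simp
  finally have "t * cop k (dop i f) y = (1 - t) * (t * (\<beta> * f y)) + t * \<alpha> * dop i f y" for y
    using b by (simp add: k_def[symmetric] smul_def fun_eq_iff)
  then have "t * cop k (dop i f) y = t * ((1 - t) * \<beta> * f y + \<alpha> * dop i f y)" for y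
    by (simp add: algebra_simps)
  then have 2: "cop k (dop i f) y = (1 - t) * \<beta> * f y + \<alpha> * dop i f y" for y
    using t_nz mult_left_cancel by blast
  have g2: "cop k g y = (1 - t) * \<beta> * f y + \<alpha> * dop i f y + c * \<beta> * f y" for y
    unfolding g_def cop_add cop_smul 2 using b by (simp add: smul_def k_def)
  have cb: "c * \<beta> = c * \<alpha> - (1 - t) * \<beta>" using c by (simp add: algebra_simps)
  show "cop (n - Suc i) g = smul \<alpha> g"
    unfolding k_def[symmetric] by (rule ext, unfold g2 cb) (simp add: g_def smul_def algebra_simps)
qed

lemma cop_intertwiner_other:
  fixes c :: 'a
  assumes i: "1 \<le> i" "i < n" and k: "k < n" "k \<noteq> n - i" "k \<noteq> n - Suc i"
    and a: "cop k f = smul \<alpha> f"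
  defines "g \<equiv> \<lambda>y. dop i f y + smul c f y"
  shows "cop k g = smul \<alpha> g"
proof -
  have "cop k (dop i f) = smul \<alpha> (dop i f)"
    using cop_dop_commute[of k i f] assms by (auto simp: dop_smul)
  then show ?thesis
    unfolding g_def by (simp add: cop_add cop_smul a smul_add mult.commute)
qed

definition base_pt :: "nat \<Rightarrow> 'a" where
  "base_pt r = t ^ (r - 1)"

text \<open>The numerator t y_i - y_(i+1) of \<open>hc\<close> vanishes at this point.\<close>

lemma dop_base_pt: "1 \<le> i \<Longrightarrow> dop i f base_pt = f base_pt"
  by (cases i) (simp_all add: dop_def hc_def base_pt_def)

lemma dchain_base_pt: "dchain m f base_pt = f base_pt"
  by (induction m) (simp_all add: dop_base_pt)

lemma cop_0_base_pt: "cop 0 f base_pt = f (shift_pt base_pt)"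
  by (simp add: dchain_base_pt gop_def)

end

section \<open>Evaluation and monomial substitutions\<close>

abbreviation single :: "'a \<Rightarrow> 'b \<Rightarrow> 'a \<Rightarrow>\<^sub>0 'b::zero" where
  "single \<equiv> Poly_Mapping.single"

text \<open>Algebraic independence of q and t, by comparing degrees in the polynomial ring. The
  generator is the square root of t, hence the exponents 2b and 2d.\<close>

lemma qq_tt_monomial_eq:
  assumes "qq ^ a * tt ^ b = qq ^ c * tt ^ d"
  shows "a = c \<and> b = d"
proof -
  have Q: "([:[:0, 1:]:] :: complex poly poly) ^ a = monom (monom 1 a) 0" for a
    by (simp add: monom_0 poly_const_pow monom_altdef)
  have T: "([:0, 1:] :: complex poly poly) ^ b = monom 1 b" for b
    by (simp add: monom_altdef)
  have P: "to_fract (x ^ k) = to_fract x ^ k" for x :: "complex poly poly" and k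
    by (induction k) simp_all
  have e: "qq ^ a * tt ^ b = to_fract (monom (monom 1 a) (2 * b))" for a b
  proof -
    have "qq ^ a * tt ^ b = to_fract ([:[:0, 1:]:] ^ a * [:0, 1:] ^ (2 * b))"
      unfolding qq_def tt_def t_half_def by (simp only: P power_mult to_fract_mult)
    then show ?thesis unfolding Q T by (simp add: mult_monom)
  qed
  have "monom (monom 1 a) (2 * b) = monom (monom (1::complex) c) (2 * d)"
    using assms unfolding e by simp
  then have m: "coeff (monom (monom 1 a) (2 * b)) k = coeff (monom (monom (1::complex) c) (2 * d)) k" for k
    by simp
  have bd: "b = d" using m[of "2 * b"] by (auto split: if_splits)
  have "monom 1 a = monom (1::complex) c" using m[of "2 * b"] bd by simp
  then have "degree (monom (1::complex) a) = degree (monom (1::complex) c)" by simp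
  then show ?thesis using bd by (simp add: degree_monom_eq)
qed

lemma qq_nz [simp]: "qq \<noteq> 0" and tt_nz [simp]: "tt \<noteq> 0"
  by (simp_all add: qq_def tt_def t_half_def)

lemma qq_tt_powi_eq:
  assumes "qq powi a * tt powi b = 1"
  shows "a = 0 \<and> b = 0"
proof -
  have s: "x powi k = x ^ nat k / x ^ nat (- k)" if "x \<noteq> 0" for x :: coeff_field and k
    using that by (cases "k \<ge> 0") (simp_all add: power_int_def field_simps)
  have "qq ^ nat a * tt ^ nat b = qq ^ nat (- a) * tt ^ nat (- b)"
    using assms by (simp add: s field_simps)
  from qq_tt_monomial_eq[OF this] show ?thesis by (auto simp: nat_eq_iff split: if_splits)
qed

lemma const_0 [simp]: "const 0 = 0" and const_1 [simp]: "const 1 = 1"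
  by (simp_all add: const_def)

lemma const_add: "const (a + b) = const a + const b"
  by (simp add: const_def single_add)

lemma const_mult: "const (a * b) = const a * const b"
  by (simp add: const_def mult_single flip: to_fract_mult)

lemma const_powi: "const (a powi k) = const a powi k"
proof -
  have p: "const (a ^ m) = const a ^ m" for a m by (induction m) (simp_all add: const_mult)
  have i: "const (inverse a) = inverse (const a)"
  proof (cases "a = 0")
    case False
    have "const a * const (inverse a) = 1" using False by (simp flip: const_mult)
    then show ?thesis using inverse_unique by metis
  qed simp
  show ?thesis by (simp add: power_int_def p i)
qed

lemma xvar_nz [simp]: "xvar i \<noteq> 0"
  by (simp add: xvar_def flip: keys_eq_empty)

lemma rvar_nz [simp]: "rvar i \<noteq> 0"
  by (simp add: rvar_def)

lemma xvar_eq_iff [simp]: "xvar i = xvar j \<longleftrightarrow> i = j"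
proof
  assume "xvar i = xvar j"
  then have "keys (xvar i) = keys (xvar j)" by simp
  then have "(single i 1 :: expo) = single j 1" by (simp add: xvar_def)
  then have "keys (single i 1 :: expo) = keys (single j 1 :: expo)" by simp
  then show "i = j" by simp
qed simp

lemma poly_mapping_sum_single: "(\<Sum>m\<in>keys f. single m (lookup f m)) = f"
proof (rule poly_mapping_eqI)
  fix k
  have "(\<Sum>m\<in>keys f. lookup (single m (lookup f m)) k) = (\<Sum>m\<in>keys f. if m = k then lookup f k else 0)"
    by (rule sum.cong) (auto simp: lookup_single when_def)
  also have "\<dots> = lookup f k" by (simp add: in_keys_iff)
  finally show "lookup (\<Sum>m\<in>keys f. single m (lookup f m)) k = lookup f k"
    by (simp add: lookup_sum)
qed

text \<open>Stated for general coefficients because it is used at two levels: for Laurent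
  polynomials, and for exponent vectors, which are finitely supported functions as well.\<close>

lemma laurent_induct [case_names single add]:
  fixes f :: "'a \<Rightarrow>\<^sub>0 'b::comm_monoid_add"
  assumes s: "\<And>m c. P (single m c)" and a: "\<And>f g. P f \<Longrightarrow> P g \<Longrightarrow> P (f + g)"
  shows "P f"
proof -
  have "P (\<Sum>m\<in>A. single m (lookup f m))" if "finite A" for A
    using that
  proof induction
    case empty
    show ?case using s[of _ 0] by simp
  qed (simp add: a s)
  from this[of "keys f"] show ?thesis by (simp add: poly_mapping_sum_single)
qed

definition monomial_eval :: "(nat \<Rightarrow> 'f::field) \<Rightarrow> expo \<Rightarrow> 'f" where
  "monomial_eval y m = (\<Prod>i\<in>keys m. y i powi lookup m i)"

lemma monomial_eval_superset:
  assumes "finite A" "keys m \<subseteq> A"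
  shows "monomial_eval y m = (\<Prod>i\<in>A. y i powi lookup m i)"
  unfolding monomial_eval_def using assms
  by (intro prod.mono_neutral_left) (auto simp: in_keys_iff)

lemma monomial_eval_add:
  assumes "\<And>i. y i \<noteq> 0"
  shows "monomial_eval y (m + m') = monomial_eval y m * monomial_eval y m'"
proof -
  let ?A = "keys m \<union> keys m'"
  have "keys (m + m') \<subseteq> ?A" by (rule keys_add)
  then have "monomial_eval y (m + m') = (\<Prod>i\<in>?A. y i powi lookup (m + m') i)"
    by (intro monomial_eval_superset) auto
  also have "\<dots> = (\<Prod>i\<in>?A. y i powi lookup m i) * (\<Prod>i\<in>?A. y i powi lookup m' i)"
    by (simp add: lookup_add power_int_add assms prod.distrib)
  also have "\<dots> = monomial_eval y m * monomial_eval y m'"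
    by (simp add: monomial_eval_superset[of ?A])
  finally show ?thesis .
qed

lemma monomial_eval_0 [simp]: "monomial_eval y 0 = 1"
  by (simp add: monomial_eval_def)

lemma laurent_eval_monomial: "laurent_eval \<phi> y f = (\<Sum>m\<in>keys f. \<phi> (lookup f m) * monomial_eval y m)"
  by (simp add: laurent_eval_def monomial_eval_def)

lemma laurent_eval_superset:
  assumes "finite A" "keys f \<subseteq> A" "\<phi> 0 = 0"
  shows "laurent_eval \<phi> y f = (\<Sum>m\<in>A. \<phi> (lookup f m) * monomial_eval y m)"
  unfolding laurent_eval_monomial using assms
  by (intro sum.mono_neutral_left) (auto simp: in_keys_iff)

lemma laurent_eval_single:
  "\<phi> 0 = 0 \<Longrightarrow> laurent_eval \<phi> y (single m c) = \<phi> c * monomial_eval y m"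
  by (subst laurent_eval_superset[of "{m}"]) (auto split: if_splits)

lemma laurent_eval_add:
  assumes "\<phi> 0 = 0" "\<And>a b. \<phi> (a + b) = \<phi> a + \<phi> b"
  shows "laurent_eval \<phi> y (f + g) = laurent_eval \<phi> y f + laurent_eval \<phi> y g"
proof -
  let ?A = "keys f \<union> keys g"
  have "keys (f + g) \<subseteq> ?A" by (rule keys_add)
  then have "laurent_eval \<phi> y (f + g) = (\<Sum>m\<in>?A. \<phi> (lookup (f + g) m) * monomial_eval y m)"
    using assms by (intro laurent_eval_superset) auto
  also have "\<dots> = (\<Sum>m\<in>?A. \<phi> (lookup f m) * monomial_eval y m) + (\<Sum>m\<in>?A. \<phi> (lookup g m) * monomial_eval y m)"
    by (simp add: lookup_add assms(2) distrib_right sum.distrib)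
  also have "\<dots> = laurent_eval \<phi> y f + laurent_eval \<phi> y g"
    using assms by (simp add: laurent_eval_superset[of ?A])
  finally show ?thesis .
qed

lemma laurent_eval_mult:
  assumes "\<phi> 0 = 0" "\<And>a b. \<phi> (a + b) = \<phi> a + \<phi> b" "\<And>a b. \<phi> (a * b) = \<phi> a * \<phi> b"
    and "\<And>i. y i \<noteq> 0"
  shows "laurent_eval \<phi> y (f * g) = laurent_eval \<phi> y f * laurent_eval \<phi> y g"
proof (induction f rule: laurent_induct)
  case f: (single m c)
  show ?case
    by (induction g rule: laurent_induct)
      (simp_all add: mult_single laurent_eval_single laurent_eval_add assms monomial_eval_add algebra_simps)
next
  case (add f f')
  then show ?case by (simp add: distrib_right laurent_eval_add assms)
qed

text \<open>
  Evaluation at a point of \<open>K\<close>, and the endomorphism \<open>x\<^sub>i \<mapsto> c\<^sub>i x\<^bsub>\<sigma>(i)\<^esub>\<close>.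
  It stays inside the Laurent polynomials, so that relations in \<open>K(X)\<close> can be pulled back.
\<close>

abbreviation ev :: "(nat \<Rightarrow> coeff_field) \<Rightarrow> laurent \<Rightarrow> coeff_field" where
  "ev \<equiv> laurent_eval id"

text \<open>The map on indices may identify variables, in which case their exponents add up. The
  substitution x_j := x_i will be of this kind.\<close>

definition push :: "(nat \<Rightarrow> nat) \<Rightarrow> expo \<Rightarrow> expo" where
  "push \<sigma> m = (\<Sum>i\<in>keys m. single (\<sigma> i) (lookup m i))"

definition msubst :: "(nat \<Rightarrow> nat) \<Rightarrow> (nat \<Rightarrow> coeff_field) \<Rightarrow> laurent \<Rightarrow> laurent" where
  "msubst \<sigma> c f = (\<Sum>m\<in>keys f. single (push \<sigma> m) (lookup f m * monomial_eval c m))"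

lemma push_superset:
  assumes "finite A" "keys m \<subseteq> A"
  shows "push \<sigma> m = (\<Sum>i\<in>A. single (\<sigma> i) (lookup m i))"
  unfolding push_def using assms by (intro sum.mono_neutral_left) (auto simp: in_keys_iff)

lemma push_add: "push \<sigma> (m + m') = push \<sigma> m + push \<sigma> m'"
proof -
  let ?A = "keys m \<union> keys m'"
  have "keys (m + m') \<subseteq> ?A" by (rule keys_add)
  then have "push \<sigma> (m + m') = (\<Sum>i\<in>?A. single (\<sigma> i) (lookup (m + m') i))"
    by (intro push_superset) auto
  also have "\<dots> = push \<sigma> m + push \<sigma> m'"
    by (simp add: lookup_add single_add sum.distrib push_superset[of ?A])
  finally show ?thesis .
qed

lemma push_single [simp]: "push \<sigma> (single i a) = single (\<sigma> i) a"
  by (simp add: push_def)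

lemma push_0 [simp]: "push \<sigma> 0 = 0"
  by (simp add: push_def)

lemma lookup_push_inj:
  assumes "inj \<sigma>"
  shows "lookup (push \<sigma> m) (\<sigma> i) = lookup m i"
proof (induction m rule: laurent_induct)
  case (single j a)
  then show ?case using assms by (simp add: lookup_single inj_eq)
qed (simp add: push_add lookup_add)

lemma msubst_single [simp]:
  "msubst \<sigma> c (single m a) = single (push \<sigma> m) (a * monomial_eval c m)"
  by (simp add: msubst_def)

lemma msubst_add: "msubst \<sigma> c (f + g) = msubst \<sigma> c f + msubst \<sigma> c g"
proof -
  let ?A = "keys f \<union> keys g"
  have s: "msubst \<sigma> c f = (\<Sum>m\<in>?A. single (push \<sigma> m) (lookup f m * monomial_eval c m))"
    if "keys f \<subseteq> ?A" for f
    unfolding msubst_def using that by (intro sum.mono_neutral_left) (auto simp: in_keys_iff)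
  have "keys (f + g) \<subseteq> ?A" by (rule keys_add)
  then show ?thesis by (simp add: s lookup_add distrib_right single_add sum.distrib)
qed

lemma msubst_0 [simp]: "msubst \<sigma> c 0 = 0"
  by (simp add: msubst_def)

lemma msubst_uminus: "msubst \<sigma> c (- f) = - msubst \<sigma> c f"
  using msubst_add[of \<sigma> c f "- f"] by (simp add: eq_neg_iff_add_eq_0 add.commute)

lemma msubst_diff: "msubst \<sigma> c (f - g) = msubst \<sigma> c f - msubst \<sigma> c g"
  using msubst_add[of \<sigma> c f "- g"] by (simp add: msubst_uminus)

lemma msubst_mult:
  assumes "\<And>i. c i \<noteq> 0"
  shows "msubst \<sigma> c (f * g) = msubst \<sigma> c f * msubst \<sigma> c g"
proof (induction f rule: laurent_induct)
  case f: (single m a)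
  show ?case
    by (induction g rule: laurent_induct)
      (simp_all add: mult_single msubst_add distrib_left distrib_right monomial_eval_add assms push_add mult_ac)
next
  case (add f f')
  then show ?case by (simp add: distrib_right msubst_add)
qed

lemma laurent_eval_0 [simp]: "laurent_eval \<phi> y 0 = 0"
  by (simp add: laurent_eval_def)

lemma monomial_eval_push:
  fixes y :: "nat \<Rightarrow> 'f::field"
  assumes "\<And>i. y i \<noteq> 0"
  shows "monomial_eval y (push \<sigma> m) = monomial_eval (\<lambda>i. y (\<sigma> i)) m"
proof (induction m rule: laurent_induct)
  case (single i a)
  then show ?case by (cases "a = 0") (simp_all add: monomial_eval_def)
qed (simp add: push_add monomial_eval_add assms)

lemma monomial_eval_mult: "monomial_eval (\<lambda>i. a i * b i) m = monomial_eval a m * monomial_eval b m"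
  by (simp add: monomial_eval_def power_int_mult_distrib prod.distrib)

lemma ev_msubst:
  assumes "\<And>i. y i \<noteq> 0"
  shows "ev y (msubst \<sigma> c f) = ev (\<lambda>i. c i * y (\<sigma> i)) f"
  by (induction f rule: laurent_induct)
    (simp_all add: msubst_add laurent_eval_add laurent_eval_single monomial_eval_push assms monomial_eval_mult)

lemma to_fract_single:
  "to_fract (single m a) = const a * monomial_eval rvar m"
proof -
  have x: "to_fract (single (single i k) 1) = rvar i powi k" for i k
  proof -
    have nn: "to_fract (single (single i (int k)) 1) = rvar i ^ k" for k
    proof (induction k)
      case (Suc k)
      have "single (single i (int (Suc k))) (1::coeff_field)
          = xvar i * single (single i (int k)) 1"
        by (simp add: xvar_def mult_single flip: single_add)
      then show ?case using Suc by (simp add: rvar_def)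
    qed simp
    show ?thesis
    proof (cases "k \<ge> 0")
      case True
      then show ?thesis using nn[of "nat k"] by (simp add: power_int_def)
    next
      case False
      define j where "j = nat (- k)"
      have k: "k = - int j" using False by (simp add: j_def)
      have "to_fract (single (single i k) 1) * rvar i ^ j
          = to_fract (single (single i k) 1 * single (single i (int j)) 1)"
        by (simp only: nn to_fract_mult)
      also have "\<dots> = 1" by (simp add: mult_single k flip: single_add)
      finally show ?thesis by (simp add: k power_int_minus field_simps)
    qed
  qed
  have m: "to_fract (single m 1) = monomial_eval rvar m"
  proof (induction m rule: laurent_induct)
    case (single i k)
    then show ?case by (cases "k = 0") (simp_all add: x monomial_eval_def)
  next
    case (add f g)
    have "single (f + g) (1::coeff_field) = single f 1 * single g 1"
      by (simp add: mult_single)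
    then show ?case using add by (simp add: monomial_eval_add)
  qed
  have "single m a = single 0 a * single m 1"
    by (simp add: mult_single)
  then show ?thesis using m by (simp add: const_def)
qed

lemma monomial_eval_const: "monomial_eval (\<lambda>i. const (c i)) m = const (monomial_eval c m)"
proof -
  have "const (\<Prod>i\<in>A. g i) = (\<Prod>i\<in>A. const (g i))" for A and g :: "nat \<Rightarrow> coeff_field"
    by (induction A rule: infinite_finite_induct) (simp_all add: const_mult)
  then show ?thesis by (simp add: monomial_eval_def const_powi)
qed

text \<open>Both the permutation action and the substitution in (E1) have this shape, so the
  relations given in K(X) descend to identities of Laurent polynomials.\<close>

lemma to_fract_msubst:
  "to_fract (msubst \<sigma> c f) = laurent_eval const (\<lambda>i. const (c i) * rvar (\<sigma> i)) f"
  by (induction f rule: laurent_induct)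
    (simp_all add: msubst_add laurent_eval_add laurent_eval_single const_add to_fract_single const_mult
      monomial_eval_mult monomial_eval_push monomial_eval_const)

lemma ev_cong:
  assumes "f \<in> laurents n" "\<And>i. i \<in> {1..n} \<Longrightarrow> y i = z i"
  shows "ev y f = ev z f"
proof -
  have "monomial_eval y m = monomial_eval z m" if "m \<in> keys f" for m
  proof -
    have "keys m \<subseteq> {1..n}" using that assms(1) by (auto simp: laurents_def expos_def)
    then have "y i = z i" if "i \<in> keys m" for i using that assms(2) by blast
    then show ?thesis by (simp add: monomial_eval_def)
  qed
  then show ?thesis by (simp add: laurent_eval_monomial)
qed

lemma ev_add: "ev y (f + g) = ev y f + ev y g"
  by (simp add: laurent_eval_add)

lemma ev_uminus: "ev y (- f) = - ev y f"
  using ev_add[of y f "- f"] by (simp add: eq_neg_iff_add_eq_0 add.commute)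

lemma ev_diff: "ev y (f - g) = ev y f - ev y g"
  using ev_add[of y f "- g"] by (simp add: ev_uminus)

lemma ev_mult: "(\<And>i. y i \<noteq> 0) \<Longrightarrow> ev y (f * g) = ev y f * ev y g"
  by (simp add: laurent_eval_mult)

lemma ev_xvar [simp]: "ev y (xvar i) = y i"
  by (simp add: xvar_def laurent_eval_single monomial_eval_def)

lemma ev_single_0 [simp]: "ev y (single 0 a) = a"
  by (simp add: laurent_eval_single)

lemma ev_1 [simp]: "ev y 1 = 1"
  using ev_single_0[of y 1] by simp

section \<open>Compositions\<close>

definition pi_exp :: "nat \<Rightarrow> expo \<Rightarrow> expo" where
  "pi_exp n \<mu> = tuple n (\<lambda>r. if r = 1 then lookup \<mu> n + 1 else lookup \<mu> (r - 1))"

definition swap_exp :: "nat \<Rightarrow> nat \<Rightarrow> expo \<Rightarrow> expo" where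
  "swap_exp n i \<mu> = tuple n (\<lambda>r. lookup \<mu> (transpose i (i + 1) r))"

text \<open>The raising step sends entry r of an exponent vector to position \<open>cyc n r\<close>;
  the substitution in (E1) moves the variables in the same way.\<close>

definition cyc :: "nat \<Rightarrow> nat \<Rightarrow> nat" where
  "cyc n r = (if r = n then 1 else r + 1)"

definition nonneg_expos :: "nat \<Rightarrow> expo set" where
  "nonneg_expos n = {\<mu> \<in> expos n. \<forall>i\<in>{1..n}. 0 \<le> lookup \<mu> i}"

lemma bij_cyc: "bij_betw (cyc n) {1..n} {1..n}"
  by (rule bij_betw_byWitness[where f' = "\<lambda>r. if r = 1 then n else r - 1"]) (auto simp: cyc_def)

lemma bij_transpose_interval:
  assumes "1 \<le> i" "i < n"
  shows "bij_betw (transpose i (Suc i)) {1..n} {1..n}"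
  by (rule bij_betw_byWitness[where f' = "transpose i (Suc i)"]) (use assms in \<open>auto simp: transpose_def\<close>)

lemma cyc_mem: "r \<in> {1..n} \<Longrightarrow> cyc n r \<in> {1..n}"
  by (auto simp: cyc_def)

lemma lookup_pi_exp:
  "r \<in> {1..n} \<Longrightarrow> lookup (pi_exp n \<mu>) (cyc n r) = lookup \<mu> r + (if r = n then 1 else 0)"
  by (auto simp: pi_exp_def lookup_tuple cyc_def)

lemma lookup_swap_exp:
  "1 \<le> i \<Longrightarrow> i < n \<Longrightarrow> r \<in> {1..n} \<Longrightarrow> lookup (swap_exp n i \<mu>) (transpose i (Suc i) r) = lookup \<mu> r"
  by (auto simp: swap_exp_def lookup_tuple transpose_def)

lemma expos_eqI:
  assumes "\<mu> \<in> expos n" "\<nu> \<in> expos n" "\<And>r. r \<in> {1..n} \<Longrightarrow> lookup \<mu> r = lookup \<nu> r"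
  shows "\<mu> = \<nu>"
proof (rule poly_mapping_eqI)
  fix k
  show "lookup \<mu> k = lookup \<nu> k"
  proof (cases "k \<in> {1..n}")
    case False
    then have "k \<notin> keys \<mu>" "k \<notin> keys \<nu>" using assms by (auto simp: expos_def)
    then show ?thesis by (simp add: in_keys_iff)
  qed (simp add: assms)
qed

lemma swap_exp_in_nonneg:
  "1 \<le> i \<Longrightarrow> i < n \<Longrightarrow> \<mu> \<in> nonneg_expos n \<Longrightarrow> swap_exp n i \<mu> \<in> nonneg_expos n"
  by (auto simp: nonneg_expos_def swap_exp_def tuple_in_expos lookup_tuple transpose_def)

lemma swap_swap_exp:
  assumes "1 \<le> i" "i < n" "\<mu> \<in> expos n"
  shows "swap_exp n i (swap_exp n i \<mu>) = \<mu>"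
proof (rule expos_eqI)
  fix r assume r: "r \<in> {1..n}"
  have "lookup (swap_exp n i (swap_exp n i \<mu>)) r = lookup (swap_exp n i \<mu>) (transpose i (Suc i) r)"
    using r by (simp add: swap_exp_def lookup_tuple)
  then show "lookup (swap_exp n i (swap_exp n i \<mu>)) r = lookup \<mu> r"
    using lookup_swap_exp[OF assms(1,2) r, of \<mu>] by simp
qed (use assms in \<open>auto simp: swap_exp_def tuple_in_expos\<close>)

lemma sum_pi_exp: "1 \<le> n \<Longrightarrow> (\<Sum>r\<in>{1..n}. lookup (pi_exp n \<mu>) r) = (\<Sum>r\<in>{1..n}. lookup \<mu> r) + 1"
proof -
  assume n: "1 \<le> n"
  have "(\<Sum>r\<in>{1..n}. lookup (pi_exp n \<mu>) r) = (\<Sum>r\<in>{1..n}. lookup (pi_exp n \<mu>) (cyc n r))"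
    by (rule sum.reindex_bij_betw[OF bij_cyc, symmetric])
  also have "\<dots> = (\<Sum>r\<in>{1..n}. lookup \<mu> r + (if r = n then 1 else 0))"
    by (intro sum.cong) (simp_all add: lookup_pi_exp)
  finally show ?thesis using n by (simp add: sum.distrib)
qed

text \<open>If the first entry is positive, the vector is a raising of one with smaller sum.
  Otherwise the first positive entry can be moved one place to the left, past a zero; this keeps the
  sum \<open>S\<close> and lowers the weighted sum \<open>M\<close>.\<close>

lemma nonneg_expos_induct [consumes 2, case_names zero pi swap]:
  assumes n: "1 \<le> n" and \<mu>: "\<mu> \<in> nonneg_expos n"
    and P0: "P 0"
    and Ppi: "\<And>\<nu>. \<nu> \<in> nonneg_expos n \<Longrightarrow> P \<nu> \<Longrightarrow> P (pi_exp n \<nu>)"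
    and Ps: "\<And>\<nu> i. \<nu> \<in> nonneg_expos n \<Longrightarrow> P \<nu> \<Longrightarrow> 1 \<le> i \<Longrightarrow> i < n \<Longrightarrow>
        lookup \<nu> (Suc i) < lookup \<nu> i \<Longrightarrow> P (swap_exp n i \<nu>)"
  shows "P \<mu>"
proof -
  define S where "S \<mu> = nat (\<Sum>r\<in>{1..n}. lookup \<mu> r)" for \<mu> :: expo
  define M where "M \<mu> = nat (\<Sum>r\<in>{1..n}. int r * lookup \<mu> r)" for \<mu> :: expo
  show ?thesis using \<mu>
  proof (induction \<mu> rule: wf_induct_rule[OF wf_measures[of "[S, M]"]])
    case (1 \<mu>)
    then have \<mu>: "\<mu> \<in> expos n" and pos: "\<And>r. r \<in> {1..n} \<Longrightarrow> 0 \<le> lookup \<mu> r"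
      by (auto simp: nonneg_expos_def)
    consider "\<mu> = 0" | "0 < lookup \<mu> 1" | "\<mu> \<noteq> 0" "lookup \<mu> 1 = 0"
      using pos[of 1] n by force
    then show ?case
    proof cases
      case 1
      then show ?thesis using P0 by simp
    next
      case 2
      define \<nu> where "\<nu> = tuple n (\<lambda>r. if r = n then lookup \<mu> 1 - 1 else lookup \<mu> (r + 1))"
      have \<nu>: "\<nu> \<in> nonneg_expos n"
        using 2 pos by (auto simp: \<nu>_def nonneg_expos_def tuple_in_expos lookup_tuple)
      have e: "pi_exp n \<nu> = \<mu>"
        by (rule expos_eqI[OF _ \<mu>]) (use n in \<open>auto simp: pi_exp_def tuple_in_expos lookup_tuple \<nu>_def\<close>)
      have "0 \<le> (\<Sum>r\<in>{1..n}. lookup \<nu> r)" using \<nu> by (auto simp: nonneg_expos_def intro: sum_nonneg)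
      then have "S \<nu> < S \<mu>" using sum_pi_exp[OF n, of \<nu>] by (simp add: S_def e)
      then have "P \<nu>" using 1 \<nu> by simp
      then show ?thesis using Ppi[OF \<nu>] e by simp
    next
      case 3
      have ex: "\<exists>r. r \<in> {1..n} \<and> 0 < lookup \<mu> r"
      proof (rule ccontr)
        assume "\<not> ?thesis"
        then have "lookup \<mu> r = 0" if "r \<in> {1..n}" for r using pos[OF that] that by force
        then have "\<mu> = 0" by (intro expos_eqI[OF \<mu>]) (auto simp: expos_def)
        then show False using 3 by simp
      qed
      \<comment> \<open>By minimality the entry just before position \<open>m\<close> is 0, so after
        the swap the larger entry stands first, as (E2) demands.\<close>
      define m where "m = (LEAST r. r \<in> {1..n} \<and> 0 < lookup \<mu> r)"
      have m: "m \<in> {1..n}" "0 < lookup \<mu> m" using LeastI_ex[OF ex] by (auto simp: m_def)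
      have "m \<noteq> 1" using m 3 by auto
      define i where "i = m - 1"
      have i: "1 \<le> i" "i < n" "m = Suc i" using m \<open>m \<noteq> 1\<close> by (auto simp: i_def)
      have i0: "lookup \<mu> i = 0"
      proof -
        have "\<not> (i \<in> {1..n} \<and> 0 < lookup \<mu> i)" using not_less_Least[of i "\<lambda>r. r \<in> {1..n} \<and> 0 < lookup \<mu> r"] i by (simp add: m_def)
        then show ?thesis using i pos[of i] by auto
      qed
      define \<nu> where "\<nu> = swap_exp n i \<mu>"
      have \<nu>: "\<nu> \<in> nonneg_expos n" using 1 i by (simp add: \<nu>_def swap_exp_in_nonneg)
      have L: "lookup \<nu> (transpose i (Suc i) r) = lookup \<mu> r" if "r \<in> {1..n}" for r
        using lookup_swap_exp[OF i(1,2) that] by (simp add: \<nu>_def)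
      have "(\<Sum>r\<in>{1..n}. lookup \<nu> r) = (\<Sum>r\<in>{1..n}. lookup \<nu> (transpose i (Suc i) r))"
        by (rule sum.reindex_bij_betw[OF bij_transpose_interval[OF i(1,2)], symmetric])
      then have S: "S \<nu> = S \<mu>" by (simp add: S_def L)
      have "(\<Sum>r\<in>{1..n}. int r * lookup \<nu> r)
          = (\<Sum>r\<in>{1..n}. int (transpose i (Suc i) r) * lookup \<nu> (transpose i (Suc i) r))"
        by (rule sum.reindex_bij_betw[OF bij_transpose_interval[OF i(1,2)], symmetric])
      also have "\<dots> = (\<Sum>r\<in>{1..n}. int (transpose i (Suc i) r) * lookup \<mu> r)" by (simp add: L)
      also have "\<dots> < (\<Sum>r\<in>{1..n}. int r * lookup \<mu> r)"
      proof (rule sum_strict_mono_ex1)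
        show "\<forall>r\<in>{1..n}. int (transpose i (Suc i) r) * lookup \<mu> r \<le> int r * lookup \<mu> r"
          using i0 pos by (auto simp: transpose_def intro: mult_right_mono)
        show "\<exists>r\<in>{1..n}. int (transpose i (Suc i) r) * lookup \<mu> r < int r * lookup \<mu> r"
          using m i by (intro bexI[of _ m]) auto
      qed simp
      finally have "(\<Sum>r\<in>{1..n}. int r * lookup \<nu> r) < (\<Sum>r\<in>{1..n}. int r * lookup \<mu> r)" .
      moreover have "0 \<le> (\<Sum>r\<in>{1..n}. int r * lookup \<nu> r)"
        using \<nu> by (auto simp: nonneg_expos_def intro: sum_nonneg)
      ultimately have "M \<nu> < M \<mu>" by (simp add: M_def)
      then have "P \<nu>" using 1 \<nu> S by simp
      moreover have "lookup \<nu> (Suc i) < lookup \<nu> i" using L[of i] L[of "Suc i"] i i0 m by simp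
      ultimately have "P (swap_exp n i \<nu>)" using Ps \<nu> i by blast
      then show ?thesis using swap_swap_exp[OF i(1,2) \<mu>] by (simp add: \<nu>_def)
    qed
  qed
qed

text \<open>\<open>v_perm\<close> counts the predecessors of an entry for the order by value, then by position.\<close>

definition precedes :: "expo \<Rightarrow> nat \<Rightarrow> nat \<Rightarrow> bool" where
  "precedes \<mu> i j \<longleftrightarrow> lookup \<mu> i < lookup \<mu> j \<or> lookup \<mu> i = lookup \<mu> j \<and> i < j"

lemma v_perm_precedes: "v_perm n \<mu> r = 1 + card {i \<in> {1..n}. precedes \<mu> i r}"
proof -
  have "{i \<in> {1..n}. precedes \<mu> i r} = {i \<in> {1..n}. i < r \<and> lookup \<mu> i \<le> lookup \<mu> r}
      \<union> {i \<in> {1..n}. r < i \<and> lookup \<mu> i < lookup \<mu> r}"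
    by (auto simp: precedes_def not_less) (metis le_neq_implies_less less_irrefl)
  moreover have "card ({i \<in> {1..n}. i < r \<and> lookup \<mu> i \<le> lookup \<mu> r} \<union> {i \<in> {1..n}. r < i \<and> lookup \<mu> i < lookup \<mu> r})
     = card {i \<in> {1..n}. i < r \<and> lookup \<mu> i \<le> lookup \<mu> r} + card {i \<in> {1..n}. r < i \<and> lookup \<mu> i < lookup \<mu> r}"
    by (rule card_Un_disjoint) auto
  ultimately show ?thesis by (simp add: v_perm_def)
qed

lemma v_perm_reindex:
  assumes \<sigma>: "bij_betw \<sigma> {1..n} {1..n}" and r: "r \<in> {1..n}"
    and p: "\<And>i. i \<in> {1..n} \<Longrightarrow> precedes \<nu> (\<sigma> i) (\<sigma> r) \<longleftrightarrow> precedes \<mu> i r"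
  shows "v_perm n \<nu> (\<sigma> r) = v_perm n \<mu> r"
proof -
  have "{i \<in> {1..n}. precedes \<nu> i (\<sigma> r)} = \<sigma> ` {i \<in> {1..n}. precedes \<mu> i r}"
    using \<sigma> p unfolding bij_betw_def by (auto 0 3)
  moreover have "inj_on \<sigma> {i \<in> {1..n}. precedes \<mu> i r}"
    using \<sigma> unfolding bij_betw_def by (auto intro: inj_on_subset)
  ultimately show ?thesis by (simp add: v_perm_precedes card_image)
qed

text \<open>The last entry loses every tie on position and the first entry wins every one; the
  increase by one compensates for this, as a + 1 <= b means a < b.\<close>

lemma v_perm_pi: "r \<in> {1..n} \<Longrightarrow> v_perm n (pi_exp n \<mu>) (cyc n r) = v_perm n \<mu> r"
  by (rule v_perm_reindex[OF bij_cyc]) (auto simp: precedes_def lookup_pi_exp cyc_def lookup_pi_exp[unfolded cyc_def])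

text \<open>The two exchanged entries differ, so the relative positions of equal entries do not
  change.\<close>

lemma v_perm_swap:
  assumes "1 \<le> i" "i < n" "lookup \<mu> (Suc i) < lookup \<mu> i" "r \<in> {1..n}"
  shows "v_perm n (swap_exp n i \<mu>) (transpose i (Suc i) r) = v_perm n \<mu> r"
proof (rule v_perm_reindex[OF bij_transpose_interval[OF assms(1,2)] assms(4)])
  fix j assume j: "j \<in> {1..n}"
  have "lookup \<mu> j = lookup \<mu> r \<Longrightarrow> transpose i (Suc i) j < transpose i (Suc i) r \<longleftrightarrow> j < r"
    using assms(3) by (auto simp: transpose_def)
  then show "precedes (swap_exp n i \<mu>) (transpose i (Suc i) j) (transpose i (Suc i) r) \<longleftrightarrow> precedes \<mu> j r"
    using assms j by (auto simp: precedes_def lookup_swap_exp)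
qed

lemma precedes_linear: "i \<noteq> j \<Longrightarrow> precedes \<mu> i j \<longleftrightarrow> \<not> precedes \<mu> j i"
  by (auto simp: precedes_def)

lemma precedes_trans: "precedes \<mu> i j \<Longrightarrow> precedes \<mu> j k \<Longrightarrow> precedes \<mu> i k"
  by (auto simp: precedes_def)

lemma v_perm_less:
  assumes "i \<in> {1..n}" "j \<in> {1..n}" "precedes \<mu> i j"
  shows "v_perm n \<mu> i < v_perm n \<mu> j"
proof -
  have "{k \<in> {1..n}. precedes \<mu> k i} \<subset> {k \<in> {1..n}. precedes \<mu> k j}"
    using assms precedes_trans[of \<mu> _ i j] by (auto simp: precedes_def)
  then have "card {k \<in> {1..n}. precedes \<mu> k i} < card {k \<in> {1..n}. precedes \<mu> k j}"
    by (intro psubset_card_mono) auto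
  then show ?thesis by (simp add: v_perm_precedes)
qed

lemma v_perm_less_iff:
  assumes "i \<in> {1..n}" "j \<in> {1..n}"
  shows "v_perm n \<mu> i < v_perm n \<mu> j \<longleftrightarrow> precedes \<mu> i j"
proof (cases "i = j")
  case True
  then show ?thesis by (simp add: precedes_def)
next
  case False
  then show ?thesis using v_perm_less[OF assms, of \<mu>] v_perm_less[OF assms(2,1), of \<mu>]
    precedes_linear[OF False, of \<mu>] by (meson less_asym)
qed

lemma v_perm_bij: "bij_betw (v_perm n \<mu>) {1..n} {1..n}"
proof -
  have inj: "inj_on (v_perm n \<mu>) {1..n}"
    using v_perm_less precedes_linear by (intro inj_onI) (metis less_irrefl)
  have "v_perm n \<mu> r \<in> {1..n}" if "r \<in> {1..n}" for r
  proof -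
    have "card {i \<in> {1..n}. precedes \<mu> i r} \<le> card ({1..n} - {r})"
      by (intro card_mono) (auto simp: precedes_def)
    then show ?thesis using that by (simp add: v_perm_precedes) arith
  qed
  then have "v_perm n \<mu> ` {1..n} \<subseteq> {1..n}" by blast
  then show ?thesis using inj by (simp add: bij_betw_def endo_inj_surj)
qed

section \<open>Evaluation of the electronic polynomials\<close>

locale electronic =
  fixes n :: nat and E :: "expo \<Rightarrow> laurent"
  assumes n_ge_1: "n \<ge> 1" and macdonald: "electronic_macdonald n E"
begin

sublocale dl_operators n qq tt
  by unfold_locales (use n_ge_1 in simp_all)

lemma E_in_laurents: "\<mu> \<in> expos n \<Longrightarrow> E \<mu> \<in> laurents n"
  using macdonald by (simp add: electronic_macdonald_def)

lemma E_0: "E 0 = 1"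
  using macdonald by (simp add: electronic_macdonald_def)

definition raise_subst :: "laurent \<Rightarrow> laurent" where
  "raise_subst = msubst (cyc n) (\<lambda>r. if r = n then inverse qq else 1)"

lemma E_pi:
  assumes "\<mu> \<in> expos n"
  shows "E (pi_exp n \<mu>) = single 0 (qq powi lookup \<mu> n) * xvar 1 * raise_subst (E \<mu>)"
proof -
  have e: "(\<lambda>r. if r = n then const (inverse qq) * rvar 1 else rvar (r + 1))
      = (\<lambda>r. const (if r = n then inverse qq else 1) * rvar (cyc n r))"
    by (auto simp: cyc_def)
  have "to_fract (E (pi_exp n \<mu>)) = const (qq powi lookup \<mu> n) * rvar 1 * to_fract (raise_subst (E \<mu>))"
    using macdonald assms unfolding electronic_macdonald_def pi_exp_def raise_subst_def to_fract_msubst e by blast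
  also have "\<dots> = to_fract (single 0 (qq powi lookup \<mu> n) * xvar 1 * raise_subst (E \<mu>))"
    by (simp add: const_def rvar_def)
  finally show ?thesis by (simp only: to_fract_eq_iff)
qed

text \<open>(E2) multiplied by x_i - x_(i+1). This clears the denominators of the divided
  differences and leaves an identity of Laurent polynomials, which can be evaluated at points and
  compared coefficientwise.\<close>

lemma E_swap:
  assumes \<mu>: "\<mu> \<in> nonneg_expos n" and i: "1 \<le> i" "i < n" and less: "lookup \<mu> (Suc i) < lookup \<mu> i"
  defines "a \<equiv> qq powi (lookup \<mu> i - lookup \<mu> (Suc i)) * tt powi (int (v_perm n \<mu> i) - int (v_perm n \<mu> (Suc i)))"
  defines "s \<equiv> msubst (transpose i (Suc i)) (\<lambda>_. 1) (E \<mu>)"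
  shows "(xvar i - xvar (Suc i)) * E (swap_exp n i \<mu>) =
     xvar i * E \<mu> - xvar (Suc i) * s - single 0 tt * xvar i * (E \<mu> - s)
     + single 0 ((1 - tt) * a / (1 - a)) * ((xvar i - xvar (Suc i)) * E \<mu>)"
proof -
  have p: "perm_act w f = to_fract (msubst w (\<lambda>_. 1) f)" for w f
    by (simp add: perm_act_def to_fract_msubst)
  have d: "rvar i - rvar (Suc i) \<noteq> 0"
    by (simp add: rvar_def flip: to_fract_diff)
  have dd: "(rvar i - rvar (Suc i)) * div_diff i f = to_fract (f - msubst (transpose i (Suc i)) (\<lambda>_. 1) f)" for f
    using d by (simp add: div_diff_def p)
  have sx: "msubst (transpose i (Suc i)) (\<lambda>_. 1) (xvar i * E \<mu>) = xvar (Suc i) * s"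
    by (simp add: msubst_mult s_def) (simp add: xvar_def monomial_eval_def)
  have "to_fract (E (swap_exp n i \<mu>)) = div_diff i (xvar i * E \<mu>) - const tt * rvar i * div_diff i (E \<mu>)
     + const ((1 - tt) * a / (1 - a)) * to_fract (E \<mu>)"
    using macdonald \<mu> i less unfolding electronic_macdonald_def swap_exp_def nonneg_expos_def a_def Let_def
    by simp
  moreover have "D * (A - c * r * B + d * F) = D * A - c * r * (D * B) + d * (D * F)"
    for A c r B d F D :: ratfun by (simp add: algebra_simps)
  ultimately have "(rvar i - rvar (Suc i)) * to_fract (E (swap_exp n i \<mu>)) =
      (rvar i - rvar (Suc i)) * div_diff i (xvar i * E \<mu>)
      - const tt * rvar i * ((rvar i - rvar (Suc i)) * div_diff i (E \<mu>))
      + const ((1 - tt) * a / (1 - a)) * ((rvar i - rvar (Suc i)) * to_fract (E \<mu>))"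
    by simp
  also have "\<dots> = to_fract (xvar i * E \<mu> - xvar (Suc i) * s - single 0 tt * xvar i * (E \<mu> - s)
     + single 0 ((1 - tt) * a / (1 - a)) * ((xvar i - xvar (Suc i)) * E \<mu>))"
    unfolding dd sx s_def[symmetric] by (simp add: rvar_def const_def)
  finally have "to_fract ((xvar i - xvar (Suc i)) * E (swap_exp n i \<mu>)) =
    to_fract (xvar i * E \<mu> - xvar (Suc i) * s - single 0 tt * xvar i * (E \<mu> - s)
     + single 0 ((1 - tt) * a / (1 - a)) * ((xvar i - xvar (Suc i)) * E \<mu>))"
    by (simp add: rvar_def)
  then show ?thesis by (simp only: to_fract_eq_iff)
qed

text \<open>The value 0 at non-generic points agrees with the conventions of \<open>xop\<close> and
  \<open>generic_one\<close>, so that (E1) and (E2) become equalities of functions on all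
  points.\<close>

definition E_fun :: "expo \<Rightarrow> (nat \<Rightarrow> coeff_field) \<Rightarrow> coeff_field" where
  "E_fun \<mu> y = (if generic y then ev y (E \<mu>) else 0)"

lemma E_fun_0: "E_fun 0 = generic_one"
  by (simp add: fun_eq_iff E_fun_def generic_one_def E_0)

lemma E_fun_pi:
  assumes "\<mu> \<in> expos n"
  shows "E_fun (pi_exp n \<mu>) = smul (qq powi lookup \<mu> n) (phi (E_fun \<mu>))"
proof
  fix y
  show "E_fun (pi_exp n \<mu>) y = smul (qq powi lookup \<mu> n) (phi (E_fun \<mu>)) y"
  proof (cases "generic y")
    case True
    then have nz: "\<And>i. y i \<noteq> 0" by (simp add: generic_def)
    have "ev y (raise_subst (E \<mu>)) = ev (\<lambda>r. (if r = n then inverse qq else 1) * y (cyc n r)) (E \<mu>)"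
      by (simp add: raise_subst_def ev_msubst nz)
    also have "\<dots> = ev (shift_pt y) (E \<mu>)"
      by (rule ev_cong[OF E_in_laurents[OF assms]]) (auto simp: shift_pt_def cyc_def)
    finally show ?thesis using True
      by (simp add: E_fun_def E_pi[OF assms] ev_mult nz smul_def phi_def xop_def gop_def generic_shift)
  qed (simp add: E_fun_def smul_def phi_def xop_def)
qed

lemma E_fun_swap:
  assumes \<mu>: "\<mu> \<in> nonneg_expos n" and i: "1 \<le> i" "i < n" and less: "lookup \<mu> (Suc i) < lookup \<mu> i"
  defines "a \<equiv> qq powi (lookup \<mu> i - lookup \<mu> (Suc i)) * tt powi (int (v_perm n \<mu> i) - int (v_perm n \<mu> (Suc i)))"
  shows "E_fun (swap_exp n i \<mu>) = (\<lambda>y. dop i (E_fun \<mu>) y + smul ((1 - tt) * a / (1 - a)) (E_fun \<mu>) y)"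
proof
  fix y
  define c where "c = (1 - tt) * a / (1 - a)"
  show "E_fun (swap_exp n i \<mu>) y = dop i (E_fun \<mu>) y + smul ((1 - tt) * a / (1 - a)) (E_fun \<mu>) y"
  proof (cases "generic y")
    case True
    then have nz: "\<And>i. y i \<noteq> 0" by (simp add: generic_def)
    have ne: "y i - y (Suc i) \<noteq> 0" using generic_distinct[OF True, of i "Suc i"] i by simp
    have g: "generic (swap_pt i y)" using True i by (simp add: generic_swap)
    define f0 f1 where "f0 = ev y (E \<mu>)" and "f1 = ev (swap_pt i y) (E \<mu>)"
    have s: "ev y (msubst (transpose i (Suc i)) (\<lambda>_. 1) (E \<mu>)) = f1"
      by (simp add: ev_msubst nz f1_def swap_pt_def)
    have "(y i - y (Suc i)) * ev y (E (swap_exp n i \<mu>))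
       = y i * f0 - y (Suc i) * f1 - tt * y i * (f0 - f1) + c * ((y i - y (Suc i)) * f0)"
      using arg_cong[OF E_swap[OF \<mu> i less, folded a_def], of "ev y"]
      by (simp add: ev_mult nz ev_diff ev_add s f0_def c_def)
    also have "\<dots> = (y i - y (Suc i)) * (f0 + c * f0) + (tt * y i - y (Suc i)) * (f1 - f0)"
      by (simp add: algebra_simps)
    also have "\<dots> = (y i - y (Suc i)) * (f0 + c * f0 + hc (y i) (y (Suc i)) * (f1 - f0))"
      using ne by (simp add: hc_def distrib_left)
    finally have "ev y (E (swap_exp n i \<mu>)) = f0 + c * f0 + hc (y i) (y (Suc i)) * (f1 - f0)"
      using ne mult_left_cancel by blast
    then show ?thesis using True g
      by (simp add: E_fun_def dop_def smul_def c_def f0_def f1_def)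
  qed (simp add: E_fun_def smul_def dop_def)
qed

text \<open>The eigenvalue of Y_i on E_mu. The quotient of two neighbouring eigenvalues is the
  parameter \<open>a\<close> of (E2).\<close>

definition spec :: "expo \<Rightarrow> nat \<Rightarrow> coeff_field" where
  "spec \<mu> i = qq powi (- lookup \<mu> i) * tt powi (int n - int (v_perm n \<mu> i))"

lemma spec_ratio:
  defines "a \<mu> i \<equiv> qq powi (lookup \<mu> i - lookup \<mu> (Suc i)) * tt powi (int (v_perm n \<mu> i) - int (v_perm n \<mu> (Suc i)))"
  shows "spec \<mu> (Suc i) = a \<mu> i * spec \<mu> i"
  by (simp add: spec_def a_def power_int_diff power_int_minus field_simps)

lemma swap_param_neq_1:
  assumes "lookup \<mu> (Suc i) < lookup \<mu> i"
  shows "qq powi (lookup \<mu> i - lookup \<mu> (Suc i)) * tt powi (int (v_perm n \<mu> i) - int (v_perm n \<mu> (Suc i))) \<noteq> 1"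
  using qq_tt_powi_eq assms by fastforce

text \<open>Raising replaces Y_i by Y_(i-1) for i > 1 and Y_1 by q^-1 Y_n, which is how the
  exponents and \<open>v_perm\<close> move under the cyclic rotation. The step (E2) is an instance
  of the intertwiner, so it exchanges two eigenvalues.\<close>

theorem E_eigenfunction:
  assumes "\<mu> \<in> nonneg_expos n" "i \<in> {1..n}"
  shows "cop (n - i) (E_fun \<mu>) = smul (spec \<mu> i) (E_fun \<mu>)"
  using n_ge_1 assms
proof (induction \<mu> arbitrary: i rule: nonneg_expos_induct)
  case zero
  have p: "precedes 0 k i \<longleftrightarrow> k < i" for k by (simp add: precedes_def)
  have "{k \<in> {1..n}. precedes 0 k i} = {1..<i}" unfolding p using zero.prems by auto
  then have v: "v_perm n 0 i = i" using zero.prems by (simp only: v_perm_precedes) simp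
  have d: "int n - int i = int (n - i)" using zero.prems by (simp only: of_nat_diff atLeastAtMost_iff)
  have s: "spec 0 i = tt ^ (n - i)" unfolding spec_def v d power_int_of_nat by simp
  have "n - i < n" using zero.prems by auto
  then show ?case unfolding E_fun_0 s by (rule cop_generic_one)
next
  case (pi \<nu>)
  then have \<nu>: "\<nu> \<in> expos n" by (simp add: nonneg_expos_def)
  show ?case
  proof (cases "i = 1")
    case True
    have v: "v_perm n (pi_exp n \<nu>) 1 = v_perm n \<nu> n" "lookup (pi_exp n \<nu>) 1 = lookup \<nu> n + 1"
      using v_perm_pi[of n n \<nu>] lookup_pi_exp[of n n \<nu>] n_ge_1 by (simp_all add: cyc_def)
    have "spec (pi_exp n \<nu>) 1 = inverse qq * spec \<nu> n"
      unfolding spec_def v by (simp add: power_int_minus power_int_diff divide_inverse mult_ac)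
    moreover have "cop 0 (E_fun \<nu>) = smul (spec \<nu> n) (E_fun \<nu>)" using pi.IH[of n] n_ge_1 by simp
    moreover have "cop (n - 1) (E_fun (pi_exp n \<nu>))
        = smul (qq powi lookup \<nu> n * inverse qq) (phi (cop 0 (E_fun \<nu>)))"
      by (simp only: E_fun_pi[OF \<nu>] cop_smul cop_last_phi smul_smul)
    ultimately show ?thesis
      unfolding True by (simp only: E_fun_pi[OF \<nu>] phi_smul smul_smul mult_ac)
  next
    case False
    define j where "j = i - 1"
    have j: "j \<in> {1..n}" "i = cyc n j" "j \<noteq> n" "n - i + 1 < n" "Suc (n - i) = n - j"
      using pi.prems False by (auto simp: j_def cyc_def)
    have sp: "spec (pi_exp n \<nu>) i = spec \<nu> j"
      unfolding spec_def j(2) v_perm_pi[OF j(1)] lookup_pi_exp[OF j(1)] using j(3) by simp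
    have "cop (n - i) (E_fun (pi_exp n \<nu>)) = smul (qq powi lookup \<nu> n) (phi (cop (n - j) (E_fun \<nu>)))"
      by (simp only: E_fun_pi[OF \<nu>] cop_smul cop_phi[OF j(4)] j(5))
    then show ?thesis
      unfolding sp pi.IH[OF j(1)] by (simp only: E_fun_pi[OF \<nu>] phi_smul smul_smul mult_ac)
  qed
next
  case (swap \<nu> j)
  define a where "a = qq powi (lookup \<nu> j - lookup \<nu> (Suc j)) * tt powi (int (v_perm n \<nu> j) - int (v_perm n \<nu> (Suc j)))"
  define c where "c = (1 - tt) * a / (1 - a)"
  note f = E_fun_swap[OF swap.hyps(1) swap.hyps(2-4), folded a_def, folded c_def]
  have a1: "a \<noteq> 1" unfolding a_def by (rule swap_param_neq_1[OF swap.hyps(4)])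
  have sp: "spec \<nu> (Suc j) = a * spec \<nu> j" unfolding a_def by (rule spec_ratio)
  \<comment> \<open>The scalar in (E2) is the one the intertwiner needs: with beta = a alpha the
    condition c (alpha - beta) = (1 - t) beta reads c (1 - a) = (1 - t) a.\<close>
  have c: "c * (spec \<nu> j - spec \<nu> (Suc j)) = (1 - tt) * spec \<nu> (Suc j)"
    using a1 unfolding sp c_def by (simp add: field_simps)
  have sw: "spec (swap_exp n j \<nu>) (transpose j (Suc j) r) = spec \<nu> r" if "r \<in> {1..n}" for r
    using swap.hyps that by (simp add: spec_def v_perm_swap lookup_swap_exp)
  have IHj: "cop (n - j) (E_fun \<nu>) = smul (spec \<nu> j) (E_fun \<nu>)"
    and IHs: "cop (n - Suc j) (E_fun \<nu>) = smul (spec \<nu> (Suc j)) (E_fun \<nu>)"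
    using swap.IH[of j] swap.IH[of "Suc j"] swap.hyps by simp_all
  note int = cop_intertwiner[OF swap.hyps(2,3) IHj IHs c, folded f]
  consider "i = j" | "i = Suc j" | "i \<noteq> j" "i \<noteq> Suc j" by blast
  then show ?case
  proof cases
    case 1
    then show ?thesis using int(1) sw[of "Suc j"] swap.hyps by simp
  next
    case 2
    then show ?thesis using int(2) sw[of j] swap.hyps by simp
  next
    case 3
    have "cop (n - i) (E_fun (swap_exp n j \<nu>)) = smul (spec \<nu> i) (E_fun (swap_exp n j \<nu>))"
      unfolding f using swap 3 by (intro cop_intertwiner_other) auto
    then show ?thesis using sw[of i] swap.prems 3 by (simp add: transpose_def)
  qed
qed

definition E_val :: "expo \<Rightarrow> coeff_field" where
  "E_val \<mu> = ev base_pt (E \<mu>)"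

lemma generic_base_pt: "generic base_pt"
proof -
  have "tt ^ (i - 1) \<noteq> qq powi k * tt ^ (j - 1)" if "i \<in> {1..n}" "j \<in> {1..n}" "i \<noteq> j" for i j :: nat and k
  proof
    assume "tt ^ (i - 1) = qq powi k * tt ^ (j - 1)"
    moreover have p: "tt ^ (r - 1) = tt powi (int r - 1)" if "r \<in> {1..n}" for r
      using that by (simp add: power_int_def nat_diff_distrib)
    ultimately have "tt powi (int i - 1) = qq powi k * tt powi (int j - 1)" using that by metis
    moreover have "tt powi (int j - int i) = tt powi (int j - 1) / tt powi (int i - 1)"
      using power_int_diff[of tt "int j - 1" "int i - 1"] by simp
    ultimately have "qq powi k * tt powi (int j - int i) = 1" by simp
    from qq_tt_powi_eq[OF this] that show False by simp
  qed
  then show ?thesis by (simp add: generic_def base_pt_def)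
qed

lemma E_val_E_fun: "E_fun \<mu> base_pt = E_val \<mu>"
  by (simp add: E_fun_def E_val_def generic_base_pt)

lemma E_val_0: "E_val 0 = 1"
  by (simp add: E_val_def E_0)

text \<open>At the base point x_1 = 1, so (E1) leaves q^(mu_n) times the value of E_mu at the
  shifted point, and that value is the one of Y_n E_mu at the base point. The powers of q cancel
  against the eigenvalue.\<close>

lemma E_val_pi:
  assumes "\<mu> \<in> nonneg_expos n"
  shows "E_val (pi_exp n \<mu>) = tt powi (int n - int (v_perm n \<mu> n)) * E_val \<mu>"
proof -
  have \<mu>: "\<mu> \<in> expos n" using assms by (simp add: nonneg_expos_def)
  have "E_val (pi_exp n \<mu>) = qq powi lookup \<mu> n * E_fun \<mu> (shift_pt base_pt)"
    unfolding E_val_E_fun[symmetric] E_fun_pi[OF \<mu>]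
    by (simp add: smul_def phi_def xop_def gop_def generic_base_pt) (simp add: base_pt_def)
  also have "E_fun \<mu> (shift_pt base_pt) = spec \<mu> n * E_val \<mu>"
    using E_eigenfunction[OF assms, of n] n_ge_1
    by (simp add: E_val_E_fun smul_def flip: cop_0_base_pt del: cop.simps)
  finally show ?thesis by (simp add: spec_def power_int_minus)
qed

lemma E_val_swap:
  assumes \<mu>: "\<mu> \<in> nonneg_expos n" and i: "1 \<le> i" "i < n" and less: "lookup \<mu> (Suc i) < lookup \<mu> i"
  defines "a \<equiv> qq powi (lookup \<mu> i - lookup \<mu> (Suc i)) * tt powi (int (v_perm n \<mu> i) - int (v_perm n \<mu> (Suc i)))"
  shows "E_val (swap_exp n i \<mu>) = (1 - tt * a) / (1 - a) * E_val \<mu>"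
proof -
  have a1: "1 - a \<noteq> 0" using swap_param_neq_1[OF less] by (simp add: a_def)
  have "E_val (swap_exp n i \<mu>) = (1 + (1 - tt) * a / (1 - a)) * E_val \<mu>"
    unfolding E_val_E_fun[symmetric] E_fun_swap[OF \<mu> i less, folded a_def] dop_base_pt[OF i(1)]
    by (simp add: smul_def algebra_simps)
  also have "1 + (1 - tt) * a / (1 - a) = (1 - tt * a) / (1 - a)"
    using a1 by (simp add: field_simps)
  finally show ?thesis .
qed

end

section \<open>Product formula for the values at the base point\<close>

definition q_ratio :: "nat \<Rightarrow> nat \<Rightarrow> coeff_field" where
  "q_ratio h N = (\<Prod>k\<in>{1..N}. (1 - qq ^ k * tt ^ (h + 1)) / (1 - qq ^ k * tt ^ h))"

text \<open>Only pairs in which j precedes i in the sorting order contribute, so the argument of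
  \<open>nat\<close> is never negative. The correction for i < j makes the term invariant under
  raising, where the last entry gains 1 and becomes first. Under a swap of a descent it disappears
  for one pair, which then gains the factor (1 - t a)/(1 - a).\<close>

definition pair_term :: "nat \<Rightarrow> expo \<Rightarrow> nat \<Rightarrow> nat \<Rightarrow> coeff_field" where
  "pair_term n \<mu> i j = (if v_perm n \<mu> j < v_perm n \<mu> i
     then q_ratio (v_perm n \<mu> i - v_perm n \<mu> j) (nat (lookup \<mu> i - lookup \<mu> j - (if i < j then 1 else 0)))
     else 1)"

definition val_formula :: "nat \<Rightarrow> expo \<Rightarrow> coeff_field" where
  "val_formula n \<mu> = tt powi (\<Sum>i\<in>{1..n}. (int n - int (v_perm n \<mu> i)) * lookup \<mu> i)
     * (\<Prod>i\<in>{1..n}. \<Prod>j\<in>{1..n}. pair_term n \<mu> i j)"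

lemma prod_pairs_reindex:
  assumes "bij_betw \<sigma> A A"
  shows "(\<Prod>i\<in>A. \<Prod>j\<in>A. f i j) = (\<Prod>i\<in>A. \<Prod>j\<in>A. f (\<sigma> i) (\<sigma> j))"
proof -
  have "(\<Prod>i\<in>A. \<Prod>j\<in>A. f i j) = (\<Prod>i\<in>A. \<Prod>j\<in>A. f (\<sigma> i) j)"
    by (rule prod.reindex_bij_betw[OF assms, symmetric])
  also have "\<dots> = (\<Prod>i\<in>A. \<Prod>j\<in>A. f (\<sigma> i) (\<sigma> j))"
    by (intro prod.cong refl prod.reindex_bij_betw[OF assms, symmetric])
  finally show ?thesis .
qed

lemma pair_term_pi:
  assumes "i \<in> {1..n}" "j \<in> {1..n}"
  shows "pair_term n (pi_exp n \<mu>) (cyc n i) (cyc n j) = pair_term n \<mu> i j"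
proof (cases "i = j")
  case True
  then show ?thesis by (simp add: pair_term_def)
next
  case False
  have e: "lookup \<mu> i + (if i = n then 1 else 0) - (lookup \<mu> j + (if j = n then 1 else 0))
      - (if cyc n i < cyc n j then 1 else 0) = lookup \<mu> i - lookup \<mu> j - (if i < j then 1 else 0)"
    using False assms by (auto simp: cyc_def)
  then show ?thesis
    unfolding pair_term_def v_perm_pi[OF assms(1)] v_perm_pi[OF assms(2)]
      lookup_pi_exp[OF assms(1)] lookup_pi_exp[OF assms(2)] by (simp only: e)
qed

lemma val_formula_pi:
  assumes "1 \<le> n"
  shows "val_formula n (pi_exp n \<mu>) = tt powi (int n - int (v_perm n \<mu> n)) * val_formula n \<mu>"
proof -
  have "(\<Sum>i\<in>{1..n}. (int n - int (v_perm n (pi_exp n \<mu>) i)) * lookup (pi_exp n \<mu>) i)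
      = (\<Sum>i\<in>{1..n}. (int n - int (v_perm n (pi_exp n \<mu>) (cyc n i))) * lookup (pi_exp n \<mu>) (cyc n i))"
    by (rule sum.reindex_bij_betw[OF bij_cyc, symmetric])
  also have "\<dots> = (\<Sum>i\<in>{1..n}. (int n - int (v_perm n \<mu> i)) * lookup \<mu> i + (if i = n then int n - int (v_perm n \<mu> n) else 0))"
    by (intro sum.cong refl) (simp add: v_perm_pi lookup_pi_exp algebra_simps)
  also have "\<dots> = (\<Sum>i\<in>{1..n}. (int n - int (v_perm n \<mu> i)) * lookup \<mu> i) + (int n - int (v_perm n \<mu> n))"
    using assms by (simp add: sum.distrib)
  finally have s: "(\<Sum>i\<in>{1..n}. (int n - int (v_perm n (pi_exp n \<mu>) i)) * lookup (pi_exp n \<mu>) i)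
      = (\<Sum>i\<in>{1..n}. (int n - int (v_perm n \<mu> i)) * lookup \<mu> i) + (int n - int (v_perm n \<mu> n))" .
  have "(\<Prod>i\<in>{1..n}. \<Prod>j\<in>{1..n}. pair_term n (pi_exp n \<mu>) i j) = (\<Prod>i\<in>{1..n}. \<Prod>j\<in>{1..n}. pair_term n \<mu> i j)"
    unfolding prod_pairs_reindex[OF bij_cyc, of "pair_term n (pi_exp n \<mu>)"]
    by (intro prod.cong refl pair_term_pi)
  then show ?thesis unfolding val_formula_def s by (simp add: power_int_add mult_ac)
qed

lemma q_ratio_Suc:
  "q_ratio h (Suc N) = q_ratio h N * ((1 - qq ^ Suc N * tt ^ (h + 1)) / (1 - qq ^ Suc N * tt ^ h))"
  by (simp add: q_ratio_def)

lemma val_formula_swap: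
  assumes i: "1 \<le> i" "i < n" and less: "lookup \<mu> (Suc i) < lookup \<mu> i"
  defines "a \<equiv> qq powi (lookup \<mu> i - lookup \<mu> (Suc i)) * tt powi (int (v_perm n \<mu> i) - int (v_perm n \<mu> (Suc i)))"
  shows "val_formula n (swap_exp n i \<mu>) = (1 - tt * a) / (1 - a) * val_formula n \<mu>"
proof -
  let ?s = "transpose i (Suc i)" and ?\<nu> = "swap_exp n i \<mu>"
  note b = bij_transpose_interval[OF i]
  have v: "v_perm n ?\<nu> (?s r) = v_perm n \<mu> r" "lookup ?\<nu> (?s r) = lookup \<mu> r" if "r \<in> {1..n}" for r
    using that i less by (simp_all add: v_perm_swap lookup_swap_exp)
  have "(\<Sum>r\<in>{1..n}. (int n - int (v_perm n ?\<nu> r)) * lookup ?\<nu> r)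
      = (\<Sum>r\<in>{1..n}. (int n - int (v_perm n ?\<nu> (?s r))) * lookup ?\<nu> (?s r))"
    by (rule sum.reindex_bij_betw[OF b, symmetric])
  also have "\<dots> = (\<Sum>r\<in>{1..n}. (int n - int (v_perm n \<mu> r)) * lookup \<mu> r)"
    by (intro sum.cong refl) (simp add: v)
  finally have s: "(\<Sum>r\<in>{1..n}. (int n - int (v_perm n ?\<nu> r)) * lookup ?\<nu> r)
      = (\<Sum>r\<in>{1..n}. (int n - int (v_perm n \<mu> r)) * lookup \<mu> r)" .
  have vless: "v_perm n \<mu> (Suc i) < v_perm n \<mu> i"
    using i less by (intro v_perm_less) (auto simp: precedes_def)
  define F where "F = (1 - tt * a) / (1 - a)"
  have main: "pair_term n ?\<nu> (?s j) (?s k) = pair_term n \<mu> j k * (if j = i then if k = Suc i then F else 1 else 1)"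
    if j: "j \<in> {1..n}" and k: "k \<in> {1..n}" for j k
  proof -
    consider "j = i" "k = Suc i" | "j = Suc i" "k = i" | "j = k" | "j \<noteq> k" "\<not> (j = i \<and> k = Suc i)" "\<not> (j = Suc i \<and> k = i)"
      by blast
    then show ?thesis
    proof cases
      \<comment> \<open>Before the swap the pair has \<open>d\<close> factors and afterwards
        \<open>Suc d\<close>; the new one has k = \<open>Suc d\<close>, the difference of the two
        entries, so that q^k t^h is the parameter \<open>a\<close>.\<close>
      case 1
      define d where "d = nat (lookup \<mu> i - lookup \<mu> (Suc i) - 1)"
      define h where "h = v_perm n \<mu> i - v_perm n \<mu> (Suc i)"
      have d: "lookup \<mu> i - lookup \<mu> (Suc i) = int (Suc d)" using less by (simp add: d_def)
      have h: "int (v_perm n \<mu> i) - int (v_perm n \<mu> (Suc i)) = int h" using vless by (simp add: h_def of_nat_diff)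
      have a: "a = qq ^ Suc d * tt ^ h" unfolding a_def d h power_int_of_nat ..
      have vi: "v_perm n ?\<nu> (Suc i) = v_perm n \<mu> i" "v_perm n ?\<nu> i = v_perm n \<mu> (Suc i)"
        "lookup ?\<nu> (Suc i) = lookup \<mu> i" "lookup ?\<nu> i = lookup \<mu> (Suc i)"
        using v[of i] v[of "Suc i"] i by simp_all
      have "pair_term n ?\<nu> (Suc i) i = q_ratio h (Suc d)"
        using vless by (simp add: pair_term_def vi h_def d del: of_nat_Suc)
      moreover have "pair_term n \<mu> i (Suc i) = q_ratio h d"
        using vless by (simp add: pair_term_def h_def d_def)
      moreover have "F = (1 - qq ^ Suc d * tt ^ (h + 1)) / (1 - qq ^ Suc d * tt ^ h)"
        by (simp add: F_def a mult_ac)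
      ultimately show ?thesis using 1 by (simp add: q_ratio_Suc)
    next
      case 2
      have v1: "v_perm n ?\<nu> (?s j) = v_perm n \<mu> j" "v_perm n ?\<nu> (?s k) = v_perm n \<mu> k"
        using v(1)[OF j] v(1)[OF k] by blast+
      have "\<not> v_perm n \<mu> k < v_perm n \<mu> j" using vless 2 by simp
      then have "pair_term n ?\<nu> (?s j) (?s k) = 1" "pair_term n \<mu> j k = 1"
        unfolding pair_term_def v1 by (simp_all only: if_False)
      then show ?thesis using 2 by simp
    next
      case 3
      then show ?thesis by (simp add: pair_term_def)
    next
      case 4
      then have "?s j < ?s k \<longleftrightarrow> j < k" by (auto simp: transpose_def)
      then have "pair_term n ?\<nu> (?s j) (?s k) = pair_term n \<mu> j k"
        unfolding pair_term_def v(1)[OF j] v(1)[OF k] v(2)[OF j] v(2)[OF k] by simp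
      then show ?thesis using 4 by auto
    qed
  qed
  have "(\<Prod>j\<in>{1..n}. \<Prod>k\<in>{1..n}. pair_term n ?\<nu> j k)
      = (\<Prod>j\<in>{1..n}. \<Prod>k\<in>{1..n}. pair_term n \<mu> j k * (if j = i then if k = Suc i then F else 1 else 1))"
    unfolding prod_pairs_reindex[OF b, of "pair_term n ?\<nu>"] by (intro prod.cong refl main)
  also have "\<dots> = (\<Prod>j\<in>{1..n}. (\<Prod>k\<in>{1..n}. pair_term n \<mu> j k) * (if j = i then F else 1))"
    using i by (intro prod.cong refl) (auto simp: prod.distrib)
  also have "\<dots> = (\<Prod>j\<in>{1..n}. \<Prod>k\<in>{1..n}. pair_term n \<mu> j k) * F"
    using i by (simp add: prod.distrib)
  finally show ?thesis unfolding val_formula_def s F_def by simp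
qed

lemma val_formula_0: "val_formula n 0 = 1"
proof -
  have "pair_term n 0 i j = 1" if "i \<in> {1..n}" "j \<in> {1..n}" for i j
    using that v_perm_less_iff[of j n i 0] by (simp add: pair_term_def precedes_def q_ratio_def)
  then show ?thesis by (simp add: val_formula_def)
qed

context electronic
begin

theorem E_val_eq_val_formula:
  assumes "\<mu> \<in> nonneg_expos n"
  shows "E_val \<mu> = val_formula n \<mu>"
  using n_ge_1 assms
proof (induction \<mu> rule: nonneg_expos_induct)
  case zero
  show ?case by (simp add: E_val_0 val_formula_0)
next
  case (pi \<nu>)
  then show ?case using E_val_pi[of \<nu>] val_formula_pi[OF n_ge_1] by simp
next
  case (swap \<nu> i)
  then show ?case using E_val_swap[of \<nu> i] val_formula_swap[of i n \<nu>] by simp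
qed

end

section \<open>Supports\<close>

text \<open>
  The convex functions \<open>hull_fun n k r\<close> are permuted by the raising operator of (E1).
  Their sublevel sets contain the supports of the electronic polynomials.
\<close>

definition hull_fun :: "nat \<Rightarrow> int \<Rightarrow> nat \<Rightarrow> expo \<Rightarrow> int" where
  "hull_fun n k r \<mu> = (\<Sum>j\<in>{1..n}. max 0 (lookup \<mu> j - k - (if j \<le> r then 1 else 0)))"

text \<open>For r = 0 the inequalities are symmetric in the entries and express weak majorization;
  those with r > 0 distinguish rearrangements of the same entries.\<close>

definition below :: "nat \<Rightarrow> expo \<Rightarrow> expo \<Rightarrow> bool" where
  "below n \<nu> \<mu> \<longleftrightarrow> (\<forall>k. \<forall>r\<le>n. hull_fun n k r \<nu> \<le> hull_fun n k r \<mu>)"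

lemma hull_fun_pi:
  assumes "1 \<le> n" "r \<le> n"
  shows "hull_fun n k r (pi_exp n \<mu>) = (if r = 0 then hull_fun n (k - 1) (n - 1) \<mu> else hull_fun n k (r - 1) \<mu>)"
proof -
  have "hull_fun n k r (pi_exp n \<mu>)
     = (\<Sum>j\<in>{1..n}. max 0 (lookup (pi_exp n \<mu>) (cyc n j) - k - (if cyc n j \<le> r then 1 else 0)))"
    unfolding hull_fun_def by (rule sum.reindex_bij_betw[OF bij_cyc, symmetric])
  also have "\<dots> = (\<Sum>j\<in>{1..n}. max 0 (lookup \<mu> j + (if j = n then 1 else 0) - k - (if cyc n j \<le> r then 1 else 0)))"
    by (intro sum.cong refl) (simp only: lookup_pi_exp)
  also have "\<dots> = (if r = 0 then hull_fun n (k - 1) (n - 1) \<mu> else hull_fun n k (r - 1) \<mu>)"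
  proof (cases "r = 0")
    case True
    have "(\<Sum>j\<in>{1..n}. max 0 (lookup \<mu> j + (if j = n then 1 else 0) - k - (if cyc n j \<le> r then 1 else 0)))
       = hull_fun n (k - 1) (n - 1) \<mu>"
      unfolding hull_fun_def by (intro sum.cong refl) (auto simp: cyc_def True)
    then show ?thesis using True by simp
  next
    case False
    have "(\<Sum>j\<in>{1..n}. max 0 (lookup \<mu> j + (if j = n then 1 else 0) - k - (if cyc n j \<le> r then 1 else 0)))
       = hull_fun n k (r - 1) \<mu>"
      unfolding hull_fun_def by (intro sum.cong refl) (use False assms in \<open>auto simp: cyc_def\<close>)
    then show ?thesis using False by simp
  qed
  finally show ?thesis .
qed

lemma below_pi: "1 \<le> n \<Longrightarrow> below n \<nu> \<mu> \<Longrightarrow> below n (pi_exp n \<nu>) (pi_exp n \<mu>)"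
  by (auto simp: below_def hull_fun_pi)

lemma hull_fun_step:
  assumes "1 \<le> i" "i \<le> n"
  shows "hull_fun n k i \<mu> = hull_fun n k (i - 1) \<mu> - (if k < lookup \<mu> i then 1 else 0)"
proof -
  have "hull_fun n k (i - 1) \<mu> - hull_fun n k i \<mu> = (\<Sum>j\<in>{1..n}. if j = i then (if k < lookup \<mu> i then 1 else 0) else 0)"
    unfolding hull_fun_def sum_subtractf[symmetric]
    by (intro sum.cong refl) (use assms in \<open>auto simp: max_def\<close>)
  also have "\<dots> = (if k < lookup \<mu> i then 1 else 0)" using assms by simp
  finally show ?thesis by simp
qed

lemma hull_fun_split:
  assumes "1 \<le> i" "i < n"
  shows "hull_fun n k r \<mu> = (\<Sum>j\<in>{1..n} - {i, Suc i}. max 0 (lookup \<mu> j - k - (if j \<le> r then 1 else 0)))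
     + max 0 (lookup \<mu> i - k - (if i \<le> r then 1 else 0)) + max 0 (lookup \<mu> (Suc i) - k - (if Suc i \<le> r then 1 else 0))"
proof -
  have d: "{1..n} - {i, Suc i} = {1..n} - {i} - {Suc i}" by auto
  have "hull_fun n k r \<mu> = max 0 (lookup \<mu> i - k - (if i \<le> r then 1 else 0))
     + (\<Sum>j\<in>{1..n} - {i}. max 0 (lookup \<mu> j - k - (if j \<le> r then 1 else 0)))"
    unfolding hull_fun_def by (rule sum.remove) (use assms in auto)
  also have "(\<Sum>j\<in>{1..n} - {i}. max 0 (lookup \<mu> j - k - (if j \<le> r then 1 else 0)))
     = max 0 (lookup \<mu> (Suc i) - k - (if Suc i \<le> r then 1 else 0))
      + (\<Sum>j\<in>{1..n} - {i} - {Suc i}. max 0 (lookup \<mu> j - k - (if j \<le> r then 1 else 0)))"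
    by (rule sum.remove) (use assms in auto)
  finally show ?thesis unfolding d by simp
qed

lemma hull_fun_swap:
  assumes "1 \<le> i" "i < n" "r \<noteq> i"
  shows "hull_fun n k r (swap_exp n i \<mu>) = hull_fun n k r \<mu>"
proof -
  have "hull_fun n k r (swap_exp n i \<mu>) = (\<Sum>j\<in>{1..n}. max 0 (lookup (swap_exp n i \<mu>) (transpose i (Suc i) j)
      - k - (if transpose i (Suc i) j \<le> r then 1 else 0)))"
    unfolding hull_fun_def by (rule sum.reindex_bij_betw[OF bij_transpose_interval[OF assms(1,2)], symmetric])
  also have "\<dots> = hull_fun n k r \<mu>"
    unfolding hull_fun_def
  proof (intro sum.cong refl)
    fix j assume j: "j \<in> {1..n}"
    have "transpose i (Suc i) j \<le> r \<longleftrightarrow> j \<le> r" using assms(3) by (auto simp: transpose_def)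
    then show "max 0 (lookup (swap_exp n i \<mu>) (transpose i (Suc i) j) - k - (if transpose i (Suc i) j \<le> r then 1 else 0))
      = max 0 (lookup \<mu> j - k - (if j \<le> r then 1 else 0))"
      by (simp add: lookup_swap_exp[OF assms(1,2) j])
  qed
  finally show ?thesis .
qed

lemma lookup_swap_exp_at:
  assumes "1 \<le> i" "i < n"
  shows "lookup (swap_exp n i \<mu>) i = lookup \<mu> (Suc i)" "lookup (swap_exp n i \<mu>) (Suc i) = lookup \<mu> i"
  using assms by (simp_all add: swap_exp_def lookup_tuple)

text \<open>For r different from i the function is invariant under the swap. For r = i the value at
  xi is at most that for r = i - 1, and at most that for r = i + 1 plus one; at the swapped vector
  one of these two bounds is attained, according to whether k is less than mu_i.\<close>

lemma below_swapI:
  assumes i: "1 \<le> i" "i < n" and less: "lookup \<mu> (Suc i) < lookup \<mu> i"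
    and \<xi>: "\<And>k r. r \<le> n \<Longrightarrow> r \<noteq> i \<Longrightarrow> hull_fun n k r \<xi> \<le> hull_fun n k r \<mu>"
  shows "below n \<xi> (swap_exp n i \<mu>)"
  unfolding below_def
proof (intro allI impI)
  fix k r assume r: "r \<le> n"
  show "hull_fun n k r \<xi> \<le> hull_fun n k r (swap_exp n i \<mu>)"
  proof (cases "r = i")
    case False
    then show ?thesis using \<xi>[OF r] i by (simp add: hull_fun_swap)
  next
    case True
    have s: "hull_fun n k i \<nu> = hull_fun n k (i - 1) \<nu> - (if k < lookup \<nu> i then 1 else 0)"
      "hull_fun n k i \<nu> = hull_fun n k (Suc i) \<nu> + (if k < lookup \<nu> (Suc i) then 1 else 0)" for \<nu>
      using hull_fun_step[of i n k \<nu>] hull_fun_step[of "Suc i" n k \<nu>] i by simp_all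
    have e: "hull_fun n k (i - 1) (swap_exp n i \<mu>) = hull_fun n k (i - 1) \<mu>"
      "hull_fun n k (Suc i) (swap_exp n i \<mu>) = hull_fun n k (Suc i) \<mu>"
      using i by (auto intro!: hull_fun_swap)
    have l: "hull_fun n k (i - 1) \<xi> \<le> hull_fun n k (i - 1) \<mu>" "hull_fun n k (Suc i) \<xi> \<le> hull_fun n k (Suc i) \<mu>"
      using i by (auto intro!: \<xi>)
    show ?thesis
    proof (cases "k < lookup \<mu> i")
      case True
      then have "hull_fun n k i (swap_exp n i \<mu>) = hull_fun n k (Suc i) \<mu> + 1"
        using s(2)[of "swap_exp n i \<mu>"] e lookup_swap_exp_at[OF i] by simp
      then show ?thesis using s(2)[of \<xi>] l \<open>r = i\<close> by auto
    next
      case False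
      then have "hull_fun n k i (swap_exp n i \<mu>) = hull_fun n k (i - 1) \<mu>"
        using s(1)[of "swap_exp n i \<mu>"] e lookup_swap_exp_at[OF i] less by simp
      then show ?thesis using s(1)[of \<xi>] l \<open>r = i\<close> by auto
    qed
  qed
qed

lemma below_refl: "below n \<mu> \<mu>"
  by (simp add: below_def)

lemma not_below_swap:
  assumes i: "1 \<le> i" "i < n" and less: "lookup \<mu> (Suc i) < lookup \<mu> i"
  shows "\<not> below n (swap_exp n i \<mu>) \<mu>"
proof
  assume b: "below n (swap_exp n i \<mu>) \<mu>"
  \<comment> \<open>For this k the entry mu_i exceeds k and mu_(i+1) does not, so the function with
    r = i grows under the swap.\<close>
  define k where "k = lookup \<mu> (Suc i)"
  have "hull_fun n k i \<mu> = hull_fun n k (i - 1) \<mu> - 1"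
    using hull_fun_step[of i n k \<mu>] i less by (simp add: k_def)
  moreover have "hull_fun n k i (swap_exp n i \<mu>) = hull_fun n k (i - 1) \<mu>"
    using hull_fun_step[of i n k "swap_exp n i \<mu>"] i lookup_swap_exp_at[OF i] hull_fun_swap[of i n "i - 1" k \<mu>]
    by (simp add: k_def)
  moreover have "hull_fun n k i (swap_exp n i \<mu>) \<le> hull_fun n k i \<mu>" using b i by (simp add: below_def)
  ultimately show False by simp
qed

text \<open>The point with coordinate \<open>k\<close> on the line through \<open>\<nu>\<close> in the direction of the \<open>i\<close>-th simple root.\<close>

definition root_line :: "nat \<Rightarrow> expo \<Rightarrow> int \<Rightarrow> expo" where
  "root_line i \<nu> k = \<nu> + (single i (k - lookup \<nu> i) + single (Suc i) (lookup \<nu> i - k))"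

lemma lookup_root_line:
  "lookup (root_line i \<nu> k) j = (if j = i then k else if j = Suc i then lookup \<nu> i + lookup \<nu> (Suc i) - k else lookup \<nu> j)"
  by (auto simp: root_line_def lookup_add lookup_single when_def)

lemma root_line_self: "root_line i \<nu> (lookup \<nu> i) = \<nu>"
  by (rule poly_mapping_eqI) (simp add: lookup_root_line)

text \<open>For r different from i the function is convex along the line and takes equal values at
  nu and at its swap, so it is bounded by this value on the segment between them.\<close>

lemma hull_fun_root_line:
  assumes i: "1 \<le> i" "i < n" and r: "r \<noteq> i"
    and k: "min (lookup \<nu> i) (lookup \<nu> (Suc i)) \<le> c" "c \<le> max (lookup \<nu> i) (lookup \<nu> (Suc i))"
  shows "hull_fun n k r (root_line i \<nu> c) \<le> hull_fun n k r \<nu>"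
proof -
  have "(if i \<le> r then 1 else 0) = (if Suc i \<le> r then 1 else (0::int))" using r by auto
  then show ?thesis
    unfolding hull_fun_split[OF i] using k by (simp add: lookup_root_line)
qed

text \<open>D_i applied to the monomial x^nu, with the division by x_i - x_(i+1) carried out. The
  two cases differ in the direction in which the segment from nu to its swap is traversed.\<close>

definition dl_monomial :: "nat \<Rightarrow> expo \<Rightarrow> laurent" where
  "dl_monomial i \<nu> = single \<nu> 1 +
     (let S = (\<lambda>A. \<Sum>k\<in>A. single (root_line i \<nu> k) 1 - single (root_line i \<nu> (k + 1)) tt)
      in if lookup \<nu> (Suc i) \<le> lookup \<nu> i then S {lookup \<nu> (Suc i)..<lookup \<nu> i}
         else - S {lookup \<nu> i..<lookup \<nu> (Suc i)})"

lemma sum_telescope_int: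
  fixes g :: "int \<Rightarrow> 'a::ab_group_add"
  assumes "a \<le> b"
  shows "(\<Sum>k\<in>{a..<b}. g (k + 1) - g k) = g b - g a"
  using assms
proof (induction b rule: int_ge_induct)
  case (step b)
  have "{a..<b + 1} = insert b {a..<b}" using step by auto
  then show ?case using step by simp
qed simp

lemma push_transpose_line: "push (transpose i (Suc i)) \<nu> = root_line i \<nu> (lookup \<nu> (Suc i))"
proof (rule poly_mapping_eqI)
  fix j
  have "lookup (push (transpose i (Suc i)) \<nu>) (transpose i (Suc i) (transpose i (Suc i) j)) = lookup \<nu> (transpose i (Suc i) j)"
    by (rule lookup_push_inj) (metis injI transpose_involutory)
  then show "lookup (push (transpose i (Suc i)) \<nu>) j = lookup (root_line i \<nu> (lookup \<nu> (Suc i))) j"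
    by (auto simp: lookup_root_line transpose_def)
qed

text \<open>Consecutive monomials on the root line satisfy x_i l(k) = x_(i+1) l(k + 1). Hence
  multiplication by x_i - x_(i+1) turns each summand into (x_(i+1) - t x_i)(l(k + 1) - l(k)), and
  the sum telescopes.\<close>

lemma dl_monomial_eq:
  fixes i \<nu>
  defines "m \<equiv> single \<nu> (1::coeff_field)"
  defines "s \<equiv> msubst (transpose i (Suc i)) (\<lambda>_. 1) m"
  shows "(xvar i - xvar (Suc i)) * dl_monomial i \<nu> =
     xvar i * m - xvar (Suc i) * s - single 0 tt * xvar i * (m - s)"
proof -
  define l :: "int \<Rightarrow> laurent" where "l k = single (root_line i \<nu> k) 1" for k
  define T :: laurent where "T = single 0 tt"
  define X Y where "X = xvar i" and "Y = xvar (Suc i)"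
  have lt: "single (root_line i \<nu> k) tt = T * l k" for k
    by (simp add: T_def l_def mult_single)
  have XY: "X * l k = Y * l (k + 1)" for k
  proof -
    have "single i 1 + root_line i \<nu> k = single (Suc i) 1 + root_line i \<nu> (k + 1)"
      by (rule poly_mapping_eqI) (simp add: lookup_add lookup_root_line lookup_single when_def)
    then show ?thesis by (simp add: X_def Y_def l_def xvar_def mult_single)
  qed
  have m: "m = l (lookup \<nu> i)" by (simp add: m_def l_def root_line_self)
  have s: "s = l (lookup \<nu> (Suc i))"
    by (simp add: s_def m_def l_def push_transpose_line monomial_eval_def)
  have step: "(X - Y) * (l k - T * l (k + 1)) = (Y - T * X) * (l (k + 1) - l k)" for k
  proof -
    have "(X - Y) * (l k - T * l (k + 1)) = X * l k - T * X * l (k + 1) - Y * l k + T * (Y * l (k + 1))"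
      by (simp add: algebra_simps)
    also have "\<dots> = Y * l (k + 1) - T * X * l (k + 1) - Y * l k + T * (X * l k)"
      by (simp only: XY)
    also have "\<dots> = (Y - T * X) * (l (k + 1) - l k)" by (simp add: algebra_simps)
    finally show ?thesis .
  qed
  have tele: "(X - Y) * (\<Sum>k\<in>{a..<b}. l k - T * l (k + 1)) = (Y - T * X) * (l b - l a)" if "a \<le> b" for a b
    by (simp only: sum_distrib_left step flip: sum_telescope_int[OF that])
  have "(X - Y) * dl_monomial i \<nu> = (X - Y) * m + (Y - T * X) * (m - s)"
  proof (cases "lookup \<nu> (Suc i) \<le> lookup \<nu> i")
    case True
    then have "dl_monomial i \<nu> = m + (\<Sum>k\<in>{lookup \<nu> (Suc i)..<lookup \<nu> i}. l k - T * l (k + 1))"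
      by (simp add: dl_monomial_def Let_def lt m_def l_def[symmetric])
    then show ?thesis using tele[OF True] by (simp only: distrib_left m s)
  next
    case False
    then have "dl_monomial i \<nu> = m - (\<Sum>k\<in>{lookup \<nu> i..<lookup \<nu> (Suc i)}. l k - T * l (k + 1))"
      by (simp add: dl_monomial_def Let_def lt m_def l_def[symmetric])
    moreover have "lookup \<nu> i \<le> lookup \<nu> (Suc i)" using False by simp
    ultimately show ?thesis using tele[of "lookup \<nu> i" "lookup \<nu> (Suc i)"]
      by (simp only: right_diff_distrib m s) simp
  qed
  then show ?thesis by (simp add: X_def Y_def T_def algebra_simps)
qed

lemma keys_dl_monomial:
  assumes "\<xi> \<in> keys (dl_monomial i \<nu>)"
  obtains c where "min (lookup \<nu> i) (lookup \<nu> (Suc i)) \<le> c" "c \<le> max (lookup \<nu> i) (lookup \<nu> (Suc i))" "\<xi> = root_line i \<nu> c"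
proof -
  define a b where "a = min (lookup \<nu> i) (lookup \<nu> (Suc i))" and "b = max (lookup \<nu> i) (lookup \<nu> (Suc i))"
  define V where "V = root_line i \<nu> ` {a..b}"
  have K: "keys (f + g) \<subseteq> V" "keys (f - g) \<subseteq> V" if "keys f \<subseteq> V" "keys g \<subseteq> V" for f g :: laurent
  proof -
    have "keys (f - g) \<subseteq> keys f \<union> keys g" by (auto simp: in_keys_iff lookup_minus)
    then show "keys (f + g) \<subseteq> V" "keys (f - g) \<subseteq> V" using that keys_add[of f g] by blast+
  qed
  have S: "keys (\<Sum>k\<in>{a..<b}. single (root_line i \<nu> k) (1::coeff_field) - single (root_line i \<nu> (k + 1)) tt) \<subseteq> V"
  proof -
    have "keys (single (root_line i \<nu> k) (1::coeff_field) - single (root_line i \<nu> (k + 1)) tt) \<subseteq> V"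
      if "k \<in> {a..<b}" for k
      using that by (intro K(2)) (auto simp: V_def)
    then show ?thesis using keys_sum by (smt (verit, best) UN_least subset_trans)
  qed
  have N: "keys (single \<nu> (1::coeff_field)) \<subseteq> V"
    by (auto simp: V_def a_def b_def intro!: image_eqI[of _ _ "lookup \<nu> i"] root_line_self[symmetric])
  have "keys (dl_monomial i \<nu>) \<subseteq> V"
  proof (cases "lookup \<nu> (Suc i) \<le> lookup \<nu> i")
    case True
    then have "a = lookup \<nu> (Suc i)" "b = lookup \<nu> i" by (auto simp: a_def b_def)
    then show ?thesis using True K(1)[OF N S] by (simp add: dl_monomial_def Let_def)
  next
    case False
    then have "a = lookup \<nu> i" "b = lookup \<nu> (Suc i)" by (auto simp: a_def b_def)
    then show ?thesis using False K(2)[OF N S] by (simp add: dl_monomial_def Let_def)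
  qed
  then obtain c where "c \<in> {a..b}" "\<xi> = root_line i \<nu> c" using assms unfolding V_def by blast
  then show thesis using that[of c] by (simp add: a_def b_def)
qed

lemma root_line_inj: "root_line i \<nu> c = root_line i \<nu> d \<longleftrightarrow> c = d"
  by (metis lookup_root_line)

lemma dl_monomial_lead:
  assumes "lookup \<nu> (Suc i) < lookup \<nu> i"
  shows "lookup (dl_monomial i \<nu>) (root_line i \<nu> (lookup \<nu> (Suc i))) = 1"
proof -
  define a b where "a = lookup \<nu> (Suc i)" and "b = lookup \<nu> i"
  have ab: "a < b" using assms by (simp add: a_def b_def)
  have "dl_monomial i \<nu> = single (root_line i \<nu> b) 1 +
     (\<Sum>k\<in>{a..<b}. single (root_line i \<nu> k) 1 - single (root_line i \<nu> (k + 1)) tt)"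
    using assms by (simp add: dl_monomial_def Let_def a_def b_def root_line_self)
  then have "lookup (dl_monomial i \<nu>) (root_line i \<nu> a) = (\<Sum>k\<in>{a..<b}. if k = a then 1 else 0)"
    using ab by (simp add: lookup_add lookup_sum lookup_minus lookup_single when_def root_line_inj)
  then show ?thesis using ab by (simp add: a_def)
qed

lemma lookup_msubst:
  assumes "inj_on (push \<sigma>) A" "keys f \<subseteq> A" "m \<in> A"
  shows "lookup (msubst \<sigma> c f) (push \<sigma> m) = lookup f m * monomial_eval c m"
proof -
  have "lookup (msubst \<sigma> c f) (push \<sigma> m) = (\<Sum>k\<in>keys f. if k = m then lookup f m * monomial_eval c m else 0)"
    unfolding msubst_def lookup_sum using assms
    by (intro sum.cong refl) (auto simp: lookup_single when_def dest: inj_onD)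
  then show ?thesis by (simp add: in_keys_iff)
qed

lemma keys_msubst: "keys (msubst \<sigma> c f) \<subseteq> push \<sigma> ` keys f"
  unfolding msubst_def using keys_sum[of "\<lambda>m. single (push \<sigma> m) (lookup f m * monomial_eval c m)" "keys f"]
  by (auto split: if_splits)

lemma lookup_single_mult:
  fixes a :: expo and f :: laurent
  shows "lookup (single a c * f) (a + m) = c * lookup f m"
proof (induction f rule: laurent_induct)
  case (single k b)
  then show ?case by (simp add: mult_single lookup_single when_def)
qed (simp add: distrib_left lookup_add)

lemma keys_single_mult: "keys (single a c * f) \<subseteq> (+) a ` keys f" for a :: expo and f :: laurent
proof
  fix k assume k: "k \<in> keys (single a c * f)"
  have "k = a + (k - a)" by simp
  then have "lookup (single a c * f) k = c * lookup f (k - a)"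
    using lookup_single_mult[of a c f "k - a"] by simp
  then have "k - a \<in> keys f" using k by (auto simp: in_keys_iff)
  then show "k \<in> (+) a ` keys f" by (intro image_eqI[of _ _ "k - a"]) simp_all
qed

lemma push_cyc:
  assumes "1 \<le> n" "m \<in> expos n"
  shows "single 1 1 + push (cyc n) m = pi_exp n m"
proof -
  have p: "push (cyc n) m = (\<Sum>i\<in>{1..n}. single (cyc n i) (lookup m i))"
    using assms(2) by (intro push_superset) (auto simp: expos_def)
  have l: "lookup (push (cyc n) m) (cyc n r) = lookup m r" if "r \<in> {1..n}" for r
  proof -
    have "lookup (push (cyc n) m) (cyc n r) = (\<Sum>i\<in>{1..n}. if i = r then lookup m r else 0)"
      unfolding p lookup_sum using that bij_cyc[of n]
      by (intro sum.cong refl) (auto simp: lookup_single when_def bij_betw_def dest: inj_onD)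
    then show ?thesis using that by simp
  qed
  have e: "push (cyc n) m \<in> expos n"
    unfolding p expos_def mem_Collect_eq
    by (rule subset_trans[OF keys_sum]) (use cyc_mem in \<open>auto split: if_splits\<close>)
  show ?thesis
  proof (rule expos_eqI)
    show "single 1 1 + push (cyc n) m \<in> expos n"
      using e assms keys_add[of "single 1 (1::int)" "push (cyc n) m"] by (auto simp: expos_def)
    show "pi_exp n m \<in> expos n" by (simp add: pi_exp_def tuple_in_expos)
    fix s assume s: "s \<in> {1..n}"
    then have "s \<in> cyc n ` {1..n}" using bij_cyc[of n] unfolding bij_betw_def by simp
    then obtain r where r: "r \<in> {1..n}" "s = cyc n r" by blast
    have "cyc n r = 1 \<longleftrightarrow> r = n" using r by (auto simp: cyc_def)
    then show "lookup (single 1 1 + push (cyc n) m) s = lookup (pi_exp n m) s"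
      unfolding r(2) lookup_pi_exp[OF r(1)] lookup_add l[OF r(1)] by (auto simp: lookup_single when_def)
  qed
qed

lemma inj_on_pi_exp: "inj_on (pi_exp n) (expos n)"
proof (rule inj_onI)
  fix \<mu> \<nu> assume a: "\<mu> \<in> expos n" "\<nu> \<in> expos n" "pi_exp n \<mu> = pi_exp n \<nu>"
  show "\<mu> = \<nu>"
    by (rule expos_eqI[OF a(1,2)]) (use a(3) lookup_pi_exp in \<open>metis add_right_cancel\<close>)
qed

lemma swap_exp_root_line:
  assumes "1 \<le> i" "i < n" "\<nu> \<in> expos n"
  shows "root_line i \<nu> (lookup \<nu> (Suc i)) = swap_exp n i \<nu>"
proof (rule poly_mapping_eqI)
  fix j
  have "j \<notin> {1..n} \<Longrightarrow> lookup \<nu> j = 0" using assms(3) by (auto simp: expos_def in_keys_iff)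
  then show "lookup (root_line i \<nu> (lookup \<nu> (Suc i))) j = lookup (swap_exp n i \<nu>) j"
    using assms by (auto simp: lookup_root_line swap_exp_def lookup_tuple transpose_def)
qed

text \<open>Among the exponents below mu, only mu itself lets D_i produce the swapped monomial. This
  is what keeps the coefficient of the swapped monomial equal to 1.\<close>

lemma root_line_below_swap:
  assumes i: "1 \<le> i" "i < n" and less: "lookup \<mu> (Suc i) < lookup \<mu> i"
    and ex: "\<mu> \<in> expos n" "\<nu> \<in> expos n" and \<nu>: "below n \<nu> \<mu>"
    and c: "min (lookup \<nu> i) (lookup \<nu> (Suc i)) \<le> c" "c \<le> max (lookup \<nu> i) (lookup \<nu> (Suc i))"
    and e: "root_line i \<nu> c = swap_exp n i \<mu>"
  shows "\<nu> = \<mu>"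
proof -
  have c_eq: "c = lookup \<mu> (Suc i)"
    using e lookup_root_line[of i \<nu> c i] lookup_swap_exp_at[OF i, of \<mu>] by simp
  have s_eq: "lookup \<nu> i + lookup \<nu> (Suc i) = lookup \<mu> i + lookup \<mu> (Suc i)"
    using e lookup_root_line[of i \<nu> c "Suc i"] lookup_swap_exp_at[OF i, of \<mu>] c_eq by simp
  have o_eq: "lookup \<nu> j = lookup \<mu> j" if "j \<in> {1..n} - {i, Suc i}" for j
    using e lookup_root_line[of i \<nu> c j] that by (auto simp: swap_exp_def lookup_tuple transpose_def)
  \<comment> \<open>With r = i + 1 both entries are reduced by k + 1 = mu_i, so the inequality says
    that neither nu_i nor nu_(i+1) exceeds mu_i.\<close>
  define k where "k = lookup \<mu> i - 1"
  have "hull_fun n k (Suc i) \<nu> \<le> hull_fun n k (Suc i) \<mu>" using \<nu> i by (simp add: below_def)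
  moreover have "(\<Sum>j\<in>{1..n} - {i, Suc i}. max 0 (lookup \<nu> j - k - (if j \<le> Suc i then 1 else 0)))
     = (\<Sum>j\<in>{1..n} - {i, Suc i}. max 0 (lookup \<mu> j - k - (if j \<le> Suc i then 1 else 0)))"
    by (intro sum.cong refl) (simp add: o_eq)
  ultimately have m: "max (lookup \<nu> i) (lookup \<nu> (Suc i)) \<le> lookup \<mu> i"
    using less unfolding hull_fun_split[OF i] by (simp add: k_def) arith
  then consider "lookup \<nu> i = lookup \<mu> i" | "lookup \<nu> i = lookup \<mu> (Suc i)"
    using c s_eq c_eq less by linarith
  then show ?thesis
  proof cases
    case 1
    then have "lookup \<nu> (Suc i) = lookup \<mu> (Suc i)" using s_eq by simp
    then show ?thesis using 1 o_eq by (intro expos_eqI[OF ex(2,1)]) auto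
  next
    case 2
    then have "\<nu> = swap_exp n i \<mu>" using e c_eq root_line_self[of i \<nu>] by simp
    then show ?thesis using not_below_swap[OF i less] \<nu> by simp
  qed
qed

context electronic
begin

text \<open>Raising permutes the functions that define \<open>below\<close>, and in the leading
  coefficient q^(nu_n) cancels against x_n -> x_1/q. In the step (E2) each monomial spreads only
  along its root line, where these functions are controlled by convexity.\<close>

theorem E_support:
  assumes "\<mu> \<in> nonneg_expos n"
  shows "(\<forall>\<xi>\<in>keys (E \<mu>). below n \<xi> \<mu>) \<and> lookup (E \<mu>) \<mu> = 1"
  using n_ge_1 assms
proof (induction \<mu> rule: nonneg_expos_induct)
  case zero
  show ?case by (simp add: E_0 below_refl lookup_one)
next
  case (pi \<nu>)
  then have \<nu>: "\<nu> \<in> expos n" by (simp add: nonneg_expos_def)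
  define c :: "nat \<Rightarrow> coeff_field" where "c = (\<lambda>r. if r = n then inverse qq else 1)"
  have ex: "keys (E \<nu>) \<subseteq> expos n" using E_in_laurents[OF \<nu>] by (simp add: laurents_def)
  have E: "E (pi_exp n \<nu>) = single (single 1 1) (qq powi lookup \<nu> n) * msubst (cyc n) c (E \<nu>)"
    unfolding E_pi[OF \<nu>] raise_subst_def c_def xvar_def by (simp add: mult_single)
  have "below n \<xi> (pi_exp n \<nu>)" if "\<xi> \<in> keys (E (pi_exp n \<nu>))" for \<xi>
  proof -
    have "\<xi> \<in> (+) (single 1 1) ` push (cyc n) ` keys (E \<nu>)"
      using that unfolding E using keys_single_mult keys_msubst by fast
    then obtain m where m: "m \<in> keys (E \<nu>)" "\<xi> = single 1 1 + push (cyc n) m" by auto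
    then have "\<xi> = pi_exp n m" using ex push_cyc[OF n_ge_1] by auto
    then show ?thesis using below_pi[OF n_ge_1] m pi.IH by blast
  qed
  moreover have "lookup (E (pi_exp n \<nu>)) (pi_exp n \<nu>) = 1"
  proof -
    have "inj_on (push (cyc n)) (expos n)"
      using inj_on_pi_exp push_cyc[OF n_ge_1] by (metis inj_on_def)
    from lookup_msubst[OF this ex \<nu>]
    have "lookup (E (pi_exp n \<nu>)) (single 1 1 + push (cyc n) \<nu>) = qq powi lookup \<nu> n * monomial_eval c \<nu>"
      unfolding E lookup_single_mult using pi.IH by simp
    moreover have "monomial_eval c \<nu> = inverse qq powi lookup \<nu> n"
    proof -
      have "monomial_eval c \<nu> = (\<Prod>i\<in>{1..n}. c i powi lookup \<nu> i)"
        using \<nu> by (intro monomial_eval_superset) (auto simp: expos_def)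
      also have "\<dots> = (\<Prod>i\<in>{1..n}. if i = n then inverse qq powi lookup \<nu> n else 1)"
        by (intro prod.cong) (auto simp: c_def)
      finally show ?thesis using n_ge_1 by simp
    qed
    ultimately show ?thesis unfolding push_cyc[OF n_ge_1 \<nu>] by (simp add: power_int_inverse)
  qed
  ultimately show ?case by blast
next
  case (swap \<nu> i)
  note i = swap.hyps(2,3) and less = swap.hyps(4)
  have \<nu>: "\<nu> \<in> expos n" using swap.hyps by (simp add: nonneg_expos_def)
  define f where "f = E \<nu>"
  \<comment> \<open>\<open>g\<close> is D_i f, assembled from the monomials; cancelling x_i -
    x_(i+1) then shows that the swapped polynomial is \<open>g\<close> plus a scalar multiple of
    \<open>f\<close>.\<close>
  define g where "g = (\<Sum>m\<in>keys f. single 0 (lookup f m) * dl_monomial i m)"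
  obtain C where C: "(xvar i - xvar (Suc i)) * E (swap_exp n i \<nu>) =
     xvar i * f - xvar (Suc i) * msubst (transpose i (Suc i)) (\<lambda>_. 1) f
     - single 0 tt * xvar i * (f - msubst (transpose i (Suc i)) (\<lambda>_. 1) f)
     + single 0 C * ((xvar i - xvar (Suc i)) * f)"
    using E_swap[OF swap.hyps] by (auto simp: f_def)
  have f: "f = (\<Sum>m\<in>keys f. single 0 (lookup f m) * single m 1)"
    using poly_mapping_sum_single[of f] by (simp add: mult_single)
  have sf: "msubst (transpose i (Suc i)) (\<lambda>_. 1) f
      = (\<Sum>m\<in>keys f. single 0 (lookup f m) * msubst (transpose i (Suc i)) (\<lambda>_. 1) (single m 1))"
    by (simp add: msubst_def monomial_eval_def mult_single)
  have lin: "(\<Sum>m\<in>A. c m * (X * M m - Y * S m - T * (M m - S m)))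
      = X * (\<Sum>m\<in>A. c m * M m) - Y * (\<Sum>m\<in>A. c m * S m) - T * ((\<Sum>m\<in>A. c m * M m) - (\<Sum>m\<in>A. c m * S m))"
    for A :: "expo set" and c M S and X Y T :: laurent
    by (simp add: sum_distrib_left sum_subtractf right_diff_distrib mult_ac)
  have "(xvar i - xvar (Suc i)) * g = (\<Sum>m\<in>keys f. single 0 (lookup f m) * ((xvar i - xvar (Suc i)) * dl_monomial i m))"
    by (simp add: g_def sum_distrib_left mult.left_commute)
  also have "\<dots> = xvar i * f - xvar (Suc i) * msubst (transpose i (Suc i)) (\<lambda>_. 1) f
     - single 0 tt * xvar i * (f - msubst (transpose i (Suc i)) (\<lambda>_. 1) f)"
    unfolding dl_monomial_eq lin f[symmetric] sf[symmetric] ..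
  finally have "(xvar i - xvar (Suc i)) * E (swap_exp n i \<nu>) = (xvar i - xvar (Suc i)) * (g + single 0 C * f)"
    unfolding C by (simp add: distrib_left mult.left_commute)
  then have E: "E (swap_exp n i \<nu>) = g + single 0 C * f" by simp
  have ex: "m \<in> expos n" "below n m \<nu>" if "m \<in> keys f" for m
    using E_in_laurents[OF \<nu>] swap.IH that by (auto simp: laurents_def f_def)
  have kf: "keys (single 0 C * f) \<subseteq> keys f" using keys_single_mult[of 0 C f] by simp
  have "below n \<xi> (swap_exp n i \<nu>)" if "\<xi> \<in> keys (E (swap_exp n i \<nu>))" for \<xi>
  proof (rule below_swapI[OF i less])
    fix k r assume r: "r \<le> n" "r \<noteq> i"
    have "\<xi> \<in> keys f \<or> (\<exists>m\<in>keys f. \<xi> \<in> keys (dl_monomial i m))"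
      using that keys_add[of g "single 0 C * f"] kf
        keys_sum[of "\<lambda>m. single 0 (lookup f m) * dl_monomial i m" "keys f"]
        keys_single_mult[of 0 _ "dl_monomial i _"]
      unfolding E g_def by fastforce
    then show "hull_fun n k r \<xi> \<le> hull_fun n k r \<nu>"
    proof (elim disjE bexE)
      assume "\<xi> \<in> keys f"
      then show ?thesis using ex r by (simp add: below_def)
    next
      fix m assume m: "m \<in> keys f" "\<xi> \<in> keys (dl_monomial i m)"
      then obtain c where c: "min (lookup m i) (lookup m (Suc i)) \<le> c" "c \<le> max (lookup m i) (lookup m (Suc i))"
        "\<xi> = root_line i m c" using keys_dl_monomial by blast
      have "hull_fun n k r \<xi> \<le> hull_fun n k r m"
        unfolding c(3) by (rule hull_fun_root_line[OF i r(2) c(1,2)])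
      also have "\<dots> \<le> hull_fun n k r \<nu>" using ex[OF m(1)] r by (simp add: below_def)
      finally show ?thesis .
    qed
  qed
  moreover have "lookup (E (swap_exp n i \<nu>)) (swap_exp n i \<nu>) = 1"
  proof -
    let ?s = "swap_exp n i \<nu>"
    have "?s \<notin> keys f" using ex not_below_swap[OF i less] by blast
    then have "lookup (single 0 C * f) ?s = 0" using kf by (auto simp: in_keys_iff)
    moreover have "lookup g ?s = (\<Sum>m\<in>keys f. if m = \<nu> then 1 else 0)"
      unfolding g_def lookup_sum
    proof (intro sum.cong refl)
      fix m assume m: "m \<in> keys f"
      have l: "lookup (single 0 (lookup f m) * dl_monomial i m) ?s = lookup f m * lookup (dl_monomial i m) ?s"
        using lookup_single_mult[of 0 "lookup f m" "dl_monomial i m" ?s] by simp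
      show "lookup (single 0 (lookup f m) * dl_monomial i m) ?s = (if m = \<nu> then 1 else 0)"
      proof (cases "m = \<nu>")
        case True
        then show ?thesis unfolding l
          using dl_monomial_lead[OF less] swap_exp_root_line[OF i \<nu>] swap.IH by (simp add: f_def)
      next
        case False
        have "?s \<notin> keys (dl_monomial i m)"
        proof
          assume "?s \<in> keys (dl_monomial i m)"
          then obtain c where c: "min (lookup m i) (lookup m (Suc i)) \<le> c" "c \<le> max (lookup m i) (lookup m (Suc i))"
            "root_line i m c = ?s" using keys_dl_monomial by metis
          then show False using root_line_below_swap[OF i less \<nu> _ _ c] ex[OF m] False by blast
        qed
        then show ?thesis unfolding l using False by (simp add: in_keys_iff)
      qed
    qed
    moreover have "\<nu> \<in> keys f" using swap.IH by (simp add: f_def in_keys_iff)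
    ultimately show ?thesis unfolding E by (simp add: lookup_add)
  qed
  ultimately show ?case by blast
qed

end

section \<open>Antisymmetric Laurent polynomials\<close>

abbreviation act :: "(nat \<Rightarrow> nat) \<Rightarrow> laurent \<Rightarrow> laurent" where
  "act w \<equiv> msubst w (\<lambda>_. 1)"

lemma monomial_eval_one [simp]: "monomial_eval (\<lambda>_. 1) m = 1"
  by (simp add: monomial_eval_def)

lemma push_push: "push \<sigma> (push \<tau> m) = push (\<sigma> \<circ> \<tau>) m"
  by (induction m rule: laurent_induct) (simp_all add: push_add)

lemma act_act: "act \<sigma> (act \<tau> f) = act (\<sigma> \<circ> \<tau>) f"
  by (induction f rule: laurent_induct) (simp_all add: msubst_add push_push o_def)

lemma act_mult: "act \<sigma> (f * g) = act \<sigma> f * act \<sigma> g"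
  by (simp add: msubst_mult)

lemma act_const [simp]: "act \<sigma> (single 0 c) = single 0 c"
  by simp

lemma act_1 [simp]: "act \<sigma> 1 = 1"
  using act_const[of \<sigma> 1] by simp

lemma act_xvar [simp]: "act \<sigma> (xvar i) = xvar (\<sigma> i)"
  by (simp add: xvar_def)

lemma act_sum: "act \<sigma> (\<Sum>i\<in>A. f i) = (\<Sum>i\<in>A. act \<sigma> (f i))"
  by (induction A rule: infinite_finite_induct) (simp_all add: msubst_add)

lemma act_prod: "act \<sigma> (\<Prod>i\<in>A. f i) = (\<Prod>i\<in>A. act \<sigma> (f i))"
  by (induction A rule: infinite_finite_induct) (simp_all add: act_mult)

lemma act_id: "act id f = f"
proof -
  have "push id m = m" for m by (induction m rule: laurent_induct) (simp_all add: push_add)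
  then show ?thesis by (simp add: msubst_def poly_mapping_sum_single)
qed

text \<open>As an index map for \<open>act\<close> this is the substitution x_j := x_i, which
  detects divisibility by x_i - x_j.\<close>

definition collapse :: "nat \<times> nat \<Rightarrow> nat \<Rightarrow> nat" where
  "collapse p k = (if k = snd p then fst p else k)"

lemma xvar_diff_dvd_monomial:
  "(xvar i - xvar j) dvd (single (single j k) 1 - single (single i k) (1::coeff_field))"
proof -
  define X Y :: "int \<Rightarrow> laurent" where "X k = single (single i k) 1"
    and "Y k = single (single j k) 1" for k
  have X: "X (a + b) = X a * X b" and Y: "Y (a + b) = Y a * Y b" for a b
    by (simp_all add: X_def Y_def mult_single single_add)
  have 0: "X 0 = 1" "Y 0 = 1" by (simp_all add: X_def Y_def)
  have "(X 1 - Y 1) dvd (Y k - X k)"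
  proof (induction k rule: int_induct[where k = 0])
    case base
    show ?case by (simp add: 0)
  next
    case (step1 k)
    have "Y (k + 1) - X (k + 1) = Y 1 * (Y k - X k) - (X 1 - Y 1) * X k"
      by (simp add: X Y algebra_simps)
    then show ?case using step1(2) by (metis dvd_diff dvd_mult dvd_triv_left)
  next
    case (step2 k)
    have "X 1 * X (-1) = 1" "Y 1 * Y (-1) = 1" using X[of 1 "-1"] Y[of 1 "-1"] 0 by simp_all
    moreover have "(X 1 - Y 1) * (Y (-1) * X (-1)) = (X 1 * X (-1)) * Y (-1) - (Y 1 * Y (-1)) * X (-1)"
      by (simp add: algebra_simps)
    ultimately have "(X 1 - Y 1) * (Y (-1) * X (-1)) = Y (-1) - X (-1)" by simp
    moreover have "Y (k - 1) - X (k - 1) = Y (-1) * (Y k - X k) + (Y (-1) - X (-1)) * X k"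
      using X[of k "-1"] Y[of k "-1"] by (simp add: algebra_simps)
    ultimately have "Y (k - 1) - X (k - 1) = Y (-1) * (Y k - X k) + (X 1 - Y 1) * (Y (-1) * X (-1) * X k)"
      by (simp add: mult.assoc)
    then show ?case using step2(2) by (metis dvd_add dvd_mult dvd_triv_left)
  qed
  then show ?thesis by (simp add: X_def Y_def xvar_def)
qed

text \<open>The factor theorem for Laurent polynomials: if f vanishes for x_j := x_i, then x_i - x_j
  divides f.\<close>

lemma xvar_diff_dvd_collapse: "(xvar i - xvar j) dvd (f - act (collapse (i, j)) f)"
proof -
  have m: "(xvar i - xvar j) dvd (single m 1 - single (push (collapse (i, j)) m) (1::coeff_field))" for m
  proof (induction m rule: laurent_induct)
    case (single r a)
    then show ?case using xvar_diff_dvd_monomial[of i j a] by (simp add: collapse_def)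
  next
    case (add u v)
    define U V U' V' :: laurent where "U = single u 1" and "V = single v 1"
      and "U' = single (push (collapse (i, j)) u) 1" and "V' = single (push (collapse (i, j)) v) 1"
    have "single (u + v) 1 - single (push (collapse (i, j)) (u + v)) (1::coeff_field)
        = U * V - U' * V'"
      by (simp add: U_def V_def U'_def V'_def push_add mult_single)
    also have "\<dots> = U * (V - V') + (U - U') * V'" by (simp add: algebra_simps)
    finally show ?case using add unfolding U_def V_def U'_def V'_def by (metis dvd_add dvd_mult dvd_mult2)
  qed
  show ?thesis
  proof (induction f rule: laurent_induct)
    case (single m c)
    have "single m c - act (collapse (i, j)) (single m c)
      = single 0 c * (single m 1 - single (push (collapse (i, j)) m) 1)"
      by (simp add: right_diff_distrib mult_single)
    then show ?case using m by simp
  next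
    case (add f g)
    have "f + g - act (collapse (i, j)) (f + g) = (f - act (collapse (i, j)) f) + (g - act (collapse (i, j)) g)"
      by (simp add: msubst_add)
    then show ?case using add by (metis dvd_add)
  qed
qed

section \<open>The Vandermonde product and the sign\<close>

definition pairs :: "nat \<Rightarrow> (nat \<times> nat) set" where
  "pairs n = {(i, j). 1 \<le> i \<and> i < j \<and> j \<le> n}"

lemma finite_pairs [simp]: "finite (pairs n)"
  by (rule finite_subset[of _ "{1..n} \<times> {1..n}"]) (auto simp: pairs_def)

definition vdm :: "nat \<Rightarrow> laurent" where
  "vdm n = (\<Prod>(i, j)\<in>pairs n. xvar i - xvar j)"

lemma collapse_xvar_diff_nz:
  assumes "p \<in> pairs n" "(i, j) \<in> pairs n" "(i, j) \<noteq> p"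
  shows "act (collapse p) (xvar i - xvar j) \<noteq> 0"
  using assms by (auto simp: msubst_diff collapse_def pairs_def)

text \<open>The factors are split off one at a time. The substitution belonging to a new pair kills
  none of the earlier factors, so in an integral domain it kills the cofactor.\<close>

lemma pairs_dvd:
  assumes "S \<subseteq> pairs n" "\<And>p. p \<in> S \<Longrightarrow> act (collapse p) f = 0"
  shows "(\<Prod>(i, j)\<in>S. xvar i - xvar j) dvd f"
proof -
  have "finite S" using assms(1) finite_pairs finite_subset by blast
  then show ?thesis using assms
  proof (induction S rule: finite_induct)
    case (insert p S)
    define Q :: laurent where "Q = (\<Prod>(i, j)\<in>S. xvar i - xvar j)"
    obtain g where g: "f = Q * g" using insert by (auto simp: Q_def dvd_def)
    have "act (collapse p) Q \<noteq> 0"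
      unfolding Q_def act_prod using insert.hyps insert.prems
      by (subst prod_zero_iff) (auto simp: split_def dest!: collapse_xvar_diff_nz[of p n])
    moreover have "act (collapse p) Q * act (collapse p) g = 0"
      using insert.prems(2)[of p] g by (simp add: act_mult)
    ultimately have "act (collapse p) g = 0" by simp
    then have "(xvar (fst p) - xvar (snd p)) dvd g"
      using xvar_diff_dvd_collapse[of "fst p" "snd p" g] by simp
    then have "(xvar (fst p) - xvar (snd p)) * Q dvd g * Q" by (rule mult_dvd_mono) simp
    moreover have "(\<Prod>(i, j)\<in>insert p S. xvar i - xvar j) = (xvar (fst p) - xvar (snd p)) * Q"
      using insert.hyps by (simp add: Q_def split_def)
    ultimately show ?case using g by (simp only: mult.commute)
  qed simp
qed

lemma two_nz: "(2::coeff_field) \<noteq> 0" "(2::laurent) \<noteq> 0"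
proof -
  have "to_fract (2 :: complex poly poly) = 2" by (metis one_add_one to_fract_1 to_fract_add)
  then show c: "(2::coeff_field) \<noteq> 0" by (metis to_fract_eq_0_iff zero_neq_numeral)
  show "(2::laurent) \<noteq> 0" using c by (metis single_numeral lookup_single_eq lookup_zero)
qed

text \<open>Once x_i and x_j are identified the transposition has no effect, so the image of f
  equals its own negative.\<close>

lemma antisym_collapse:
  assumes "act (transpose i j) f = - f"
  shows "act (collapse (i, j)) f = 0"
proof -
  have "collapse (i, j) \<circ> transpose i j = collapse (i, j)"
    by (auto simp: fun_eq_iff collapse_def transpose_def)
  then have "act (collapse (i, j)) f = - act (collapse (i, j)) f"
    using act_act[of "collapse (i, j)" "transpose i j" f] unfolding assms msubst_uminus by simp
  then have "act (collapse (i, j)) f + act (collapse (i, j)) f = 0" by (metis add.right_inverse)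
  then have "2 * act (collapse (i, j)) f = 0" by (simp only: mult_2)
  then show ?thesis using two_nz(2) mult_eq_0_iff by blast
qed

text \<open>A permutation acts on the unordered pairs; \<open>sort_pair w\<close> is this action on ordered representatives.\<close>

definition sort_pair :: "(nat \<Rightarrow> nat) \<Rightarrow> nat \<times> nat \<Rightarrow> nat \<times> nat" where
  "sort_pair w p = (min (w (fst p)) (w (snd p)), max (w (fst p)) (w (snd p)))"

lemma sort_pair_bij:
  assumes "w permutes {1..n}"
  shows "bij_betw (sort_pair w) (pairs n) (pairs n)"
proof -
  have inj: "inj w" using assms permutes_inj by blast
  have mem: "w i \<in> {1..n} \<longleftrightarrow> i \<in> {1..n}" for i using permutes_in_image[OF assms] .
  have "sort_pair w p \<in> pairs n" if "p \<in> pairs n" for p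
  proof -
    have "fst p \<in> {1..n}" "snd p \<in> {1..n}" "fst p \<noteq> snd p" using that by (auto simp: pairs_def)
    then have "w (fst p) \<in> {1..n}" "w (snd p) \<in> {1..n}" "w (fst p) \<noteq> w (snd p)"
      using mem inj by (auto simp: inj_eq)
    then show ?thesis by (auto simp: pairs_def sort_pair_def)
  qed
  moreover have "inj_on (sort_pair w) (pairs n)"
  proof (rule inj_onI)
    fix p r assume pr: "p \<in> pairs n" "r \<in> pairs n" "sort_pair w p = sort_pair w r"
    have "{w (fst p), w (snd p)} = {w (fst r), w (snd r)}"
      using pr(3) by (auto simp: sort_pair_def min_def max_def split: if_splits)
    then have "{fst p, snd p} = {fst r, snd r}"
      using inj by (auto simp: doubleton_eq_iff inj_eq)
    then show "p = r" using pr(1,2) by (auto simp: doubleton_eq_iff pairs_def)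
  qed
  ultimately show ?thesis
    by (simp add: bij_betw_def endo_inj_surj image_subset_iff)
qed

text \<open>The sign as a product over pairs, aligned with the factors of the Vandermonde product
  and of \<open>t_prod\<close>.\<close>

definition inv_sign :: "nat \<Rightarrow> (nat \<Rightarrow> nat) \<Rightarrow> coeff_field" where
  "inv_sign n w = (\<Prod>(i, j)\<in>pairs n. if w i < w j then 1 else -1)"

abbreviation lconst :: "coeff_field \<Rightarrow> laurent" where
  "lconst \<equiv> single 0"

lemma lconst_mult: "lconst (a * b) = lconst a * lconst b"
  by (simp add: mult_single)

lemma lconst_prod: "lconst (\<Prod>i\<in>A. f i) = (\<Prod>i\<in>A. lconst (f i))"
proof (induction A rule: infinite_finite_induct)
  case (insert x F)
  then show ?case by (simp add: lconst_mult)
qed simp_all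

lemma act_vdm:
  assumes "w permutes {1..n}"
  shows "act w (vdm n) = lconst (inv_sign n w) * vdm n"
proof -
  have "vdm n = (\<Prod>p\<in>pairs n. xvar (fst (sort_pair w p)) - xvar (snd (sort_pair w p)))"
    unfolding vdm_def split_def by (rule prod.reindex_bij_betw[OF sort_pair_bij[OF assms], symmetric])
  then have "lconst (inv_sign n w) * vdm n
     = (\<Prod>p\<in>pairs n. lconst (if w (fst p) < w (snd p) then 1 else -1)
          * (xvar (fst (sort_pair w p)) - xvar (snd (sort_pair w p))))"
    by (simp add: inv_sign_def lconst_prod split_def prod.distrib)
  also have "\<dots> = (\<Prod>p\<in>pairs n. xvar (w (fst p)) - xvar (w (snd p)))"
  proof (rule prod.cong[OF refl])
    fix p assume "p \<in> pairs n"
    have "lconst (-1) = -1" using single_uminus[of "0::expo" "1::coeff_field"] by simp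
    then show "lconst (if w (fst p) < w (snd p) then 1 else -1)
        * (xvar (fst (sort_pair w p)) - xvar (snd (sort_pair w p))) = xvar (w (fst p)) - xvar (w (snd p))"
      by (auto simp: sort_pair_def min_def max_def)
  qed
  also have "\<dots> = act w (vdm n)" by (simp add: vdm_def act_prod split_def msubst_diff)
  finally show ?thesis ..
qed

lemma vdm_nz [simp]: "vdm n \<noteq> 0"
  unfolding vdm_def prod_zero_iff[OF finite_pairs] by (auto simp: pairs_def)

text \<open>The sign is the scalar by which a permutation acts on the nonzero Vandermonde product,
  hence it is multiplicative.\<close>

lemma inv_sign_comp:
  assumes "v permutes {1..n}" "w permutes {1..n}"
  shows "inv_sign n (v \<circ> w) = inv_sign n v * inv_sign n w"
proof -
  have "lconst (inv_sign n (v \<circ> w)) * vdm n = act v (act w (vdm n))"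
    using act_vdm[OF permutes_compose[OF assms(2,1)]] by (simp add: act_act)
  also have "\<dots> = lconst (inv_sign n v * inv_sign n w) * vdm n"
    by (simp only: act_vdm assms act_mult act_const lconst_mult mult_ac)
  finally have "lconst (inv_sign n (v \<circ> w)) = lconst (inv_sign n v * inv_sign n w)" by simp
  then show ?thesis by (metis lookup_single_eq)
qed

lemma inv_sign_cases: "inv_sign n w = 1 \<or> inv_sign n w = -1"
proof -
  have "(\<Prod>p\<in>A. if w (fst p) < w (snd p) then 1 else -1) \<in> {1, -1 :: coeff_field}" for A
    by (induction A rule: infinite_finite_induct) auto
  then show ?thesis by (auto simp: inv_sign_def split_def)
qed

text \<open>
  Were the sign \<open>1\<close>, the cofactor of \<open>x\<^sub>i - x\<^sub>j\<close> in the Vandermonde product would be antisymmetric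
  in \<open>i, j\<close>, hence would vanish for \<open>x\<^sub>j = x\<^sub>i\<close>.
\<close>

lemma inv_sign_transpose:
  assumes "(i, j) \<in> pairs n"
  shows "inv_sign n (transpose i j) = -1"
proof (rule ccontr)
  assume "inv_sign n (transpose i j) \<noteq> -1"
  then have 1: "inv_sign n (transpose i j) = 1" using inv_sign_cases by blast
  have p: "transpose i j permutes {1..n}" using assms by (intro permutes_swap_id) (auto simp: pairs_def)
  define R where "R = (\<Prod>(k, l)\<in>pairs n - {(i, j)}. xvar k - xvar l)"
  have v: "vdm n = (xvar i - xvar j) * R"
    unfolding vdm_def R_def by (subst prod.remove[OF finite_pairs assms]) simp
  have "(xvar j - xvar i) * act (transpose i j) R = (xvar i - xvar j) * R"
    using act_vdm[OF p] 1 unfolding v by (simp add: act_mult msubst_diff)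
  moreover have "(xvar j - xvar i) * Z = (xvar i - xvar j) * (- Z)" for Z by (simp add: algebra_simps)
  ultimately have "(xvar i - xvar j) * (- act (transpose i j) R) = (xvar i - xvar j) * R" by metis
  moreover have "xvar i - xvar j \<noteq> 0" using assms by (auto simp: pairs_def)
  ultimately have "- act (transpose i j) R = R" using mult_left_cancel by blast
  then have "act (transpose i j) R = - R" by (metis minus_minus)
  then have "act (collapse (i, j)) R = 0" by (rule antisym_collapse)
  moreover have "act (collapse (i, j)) R \<noteq> 0"
    unfolding R_def act_prod using assms
    by (subst prod_zero_iff) (auto simp: split_def dest!: collapse_xvar_diff_nz[of "(i, j)" n])
  ultimately show False by simp
qed

section \<open>Antisymmetrization\<close>

definition t_prod :: "nat \<Rightarrow> (nat \<Rightarrow> nat) \<Rightarrow> laurent" where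
  "t_prod n w = (\<Prod>(i, j)\<in>pairs n. xvar (w i) - lconst tt * xvar (w j))"

text \<open>The t-symmetrization times the Vandermonde product: the denominator in the summand of w
  is w applied to that product and cancels up to the sign. Divisibility by the Vandermonde product
  then shows that the symmetrization is a Laurent polynomial.\<close>

definition antisymmetrization :: "nat \<Rightarrow> laurent \<Rightarrow> laurent" where
  "antisymmetrization n f = (\<Sum>w | w permutes {1..n}. lconst (inv_sign n w) * (act w f * t_prod n w))"

lemma act_t_prod: "act v (t_prod n w) = t_prod n (v \<circ> w)"
  by (simp add: t_prod_def act_prod split_def msubst_diff act_mult)

lemma antisymmetrization_antisym:
  assumes "(i, j) \<in> pairs n"
  shows "act (transpose i j) (antisymmetrization n f) = - antisymmetrization n f"
proof -
  let ?s = "transpose i j"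
  have p: "?s permutes {1..n}" using assms by (intro permutes_swap_id) (auto simp: pairs_def)
  have "?s \<circ> (?s \<circ> w) = w" for w :: "nat \<Rightarrow> nat" by (simp add: fun_eq_iff)
  moreover have "?s \<circ> w permutes {1..n}" if "w permutes {1..n}" for w
    using that p by (rule permutes_compose)
  ultimately have bij: "bij_betw (\<lambda>w. ?s \<circ> w) {w. w permutes {1..n}} {w. w permutes {1..n}}"
    by (intro bij_betw_byWitness[where f' = "\<lambda>w. ?s \<circ> w"] ballI image_subsetI) (simp_all only: mem_Collect_eq)
  have "act ?s (antisymmetrization n f)
     = (\<Sum>w | w permutes {1..n}. lconst (inv_sign n w) * (act (?s \<circ> w) f * t_prod n (?s \<circ> w)))"
    by (simp add: antisymmetrization_def act_sum act_mult act_act act_t_prod)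
  also have "\<dots> = (\<Sum>w | w permutes {1..n}. - (lconst (inv_sign n (?s \<circ> w)) * (act (?s \<circ> w) f * t_prod n (?s \<circ> w))))"
    by (intro sum.cong refl) (simp add: inv_sign_comp[OF p] inv_sign_transpose[OF assms] single_uminus)
  also have "\<dots> = - (\<Sum>w | w permutes {1..n}. lconst (inv_sign n (?s \<circ> w)) * (act (?s \<circ> w) f * t_prod n (?s \<circ> w)))"
    by (simp add: sum_negf)
  also have "(\<Sum>w | w permutes {1..n}. lconst (inv_sign n (?s \<circ> w)) * (act (?s \<circ> w) f * t_prod n (?s \<circ> w)))
     = antisymmetrization n f"
    unfolding antisymmetrization_def
    by (rule sum.reindex_bij_betw[OF bij])
  finally show ?thesis .
qed

lemma vdm_dvd_antisymmetrization: "vdm n dvd antisymmetrization n f"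
  unfolding vdm_def
  by (rule pairs_dvd[of _ n]) (auto intro: antisym_collapse antisymmetrization_antisym)

lemma t_symmetrization_vdm:
  "t_symmetrization n f * to_fract (vdm n) = to_fract (antisymmetrization n f)"
proof -
  have set_eq: "{(i, j). 1 \<le> i \<and> i < j \<and> j \<le> n} = pairs n" by (simp add: pairs_def)
  have tp: "to_fract (\<Prod>x\<in>A. g x) = (\<Prod>x\<in>A. to_fract (g x))" for A and g :: "'b \<Rightarrow> laurent"
    by (induction A rule: infinite_finite_induct) simp_all
  have summand: "perm_act w f * (\<Prod>(i, j)\<in>pairs n. (rvar (w i) - const tt * rvar (w j)) / (rvar (w i) - rvar (w j))) * to_fract (vdm n)
      = to_fract (lconst (inv_sign n w) * (act w f * t_prod n w))" if w: "w permutes {1..n}" for w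
  proof -
    have 1: "(\<Prod>(i, j)\<in>pairs n. (rvar (w i) - const tt * rvar (w j)) / (rvar (w i) - rvar (w j)))
        = to_fract (t_prod n w) / to_fract (act w (vdm n))"
      by (simp add: t_prod_def vdm_def act_prod msubst_diff tp split_def prod_dividef rvar_def const_def)
    have 2: "perm_act w f = to_fract (act w f)" by (simp add: perm_act_def to_fract_msubst)
    have sq: "lconst (inv_sign n w) * lconst (inv_sign n w) = 1"
      using inv_sign_cases[of n w] by (auto simp: mult_single)
    have "vdm n = lconst (inv_sign n w) * act w (vdm n)"
      unfolding act_vdm[OF w] using sq by (simp flip: mult.assoc)
    then have 3: "to_fract (vdm n) = to_fract (lconst (inv_sign n w)) * to_fract (act w (vdm n))"
      by (metis to_fract_mult)
    have "act w (vdm n) \<noteq> 0" unfolding act_vdm[OF w] using sq by auto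
    then show ?thesis unfolding 1 2 3 by simp
  qed
  show ?thesis
    unfolding t_symmetrization_def antisymmetrization_def set_eq sum_distrib_right to_fract_sum
    by (intro sum.cong refl) (use summand in blast)
qed

section \<open>Leading terms\<close>

text \<open>Exponent vectors are compared lexicographically, by the order of \<open>poly_mapping\<close>.\<close>

definition lead :: "laurent \<Rightarrow> expo \<Rightarrow> coeff_field \<Rightarrow> bool" where
  "lead f m c \<longleftrightarrow> (\<forall>k\<in>keys f. k \<le> m) \<and> lookup f m = c"

lemma lookup_mult_sum: "lookup (f * g) m = (\<Sum>k\<in>keys f. lookup f k * lookup g (m - k))" for f g :: laurent
proof -
  have "f * g = (\<Sum>k\<in>keys f. single k (lookup f k)) * g" by (simp add: poly_mapping_sum_single)
  then have "lookup (f * g) m = (\<Sum>k\<in>keys f. lookup (single k (lookup f k) * g) m)"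
    by (simp add: sum_distrib_right lookup_sum)
  also have "\<dots> = (\<Sum>k\<in>keys f. lookup f k * lookup g (m - k))"
  proof (intro sum.cong refl)
    fix k
    show "lookup (single k (lookup f k) * g) m = lookup f k * lookup g (m - k)"
      using lookup_single_mult[of k "lookup f k" g "m - k"] by simp
  qed
  finally show ?thesis .
qed

lemma lead_mult:
  assumes "lead f m a" "lead g m' b"
  shows "lead (f * g) (m + m') (a * b)"
proof -
  have "k \<le> m + m'" if "k \<in> keys (f * g)" for k
    using that keys_mult[of f g] assms by (auto simp: lead_def intro: add_mono)
  moreover have "lookup (f * g) (m + m') = a * b"
  proof -
    have "lookup f k * lookup g (m + m' - k) = (if k = m then a * b else 0)" if "k \<in> keys f" for k
    proof (cases "k = m")
      case True
      then show ?thesis using assms by (simp add: lead_def)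
    next
      case False
      then have "k < m" using that assms by (auto simp: lead_def)
      then have "m' < m + m' - k" by (simp add: less_diff_eq add.commute)
      then have "m + m' - k \<notin> keys g" using assms by (auto simp: lead_def)
      then show ?thesis using False by (simp add: in_keys_iff)
    qed
    then have "lookup (f * g) (m + m') = (\<Sum>k\<in>keys f. if k = m then a * b else 0)"
      unfolding lookup_mult_sum by (intro sum.cong refl)
    then show ?thesis using assms by (auto simp: lead_def in_keys_iff)
  qed
  ultimately show ?thesis by (simp add: lead_def)
qed

lemma lead_const: "lead (lconst c) 0 c"
  by (simp add: lead_def)

lemma lead_prod:
  assumes "finite A" "\<And>p. p \<in> A \<Longrightarrow> lead (f p) (m p) (c p)"
  shows "lead (\<Prod>p\<in>A. f p) (\<Sum>p\<in>A. m p) (\<Prod>p\<in>A. c p)"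
  using assms
proof (induction A rule: finite_induct)
  case empty
  then show ?case using lead_const[of 1] by simp
qed (simp add: lead_mult)

lemma lead_sum:
  assumes "\<And>w. w \<in> A \<Longrightarrow> lead (f w) m (c w)"
  shows "lead (\<Sum>w\<in>A. f w) m (\<Sum>w\<in>A. c w)"
  using assms keys_sum[of f A] by (fastforce simp: lead_def lookup_sum)

lemma single_less: "a < b \<Longrightarrow> (single b 1 :: expo) < single a 1"
  unfolding less_poly_mapping.rep_eq less_fun_def
  by (rule exI[of _ a]) (auto simp: lookup_single when_def)

lemma lead_binomial:
  assumes "a \<noteq> b"
  shows "lead (xvar a - lconst s * xvar b) (single (min a b) 1) (if a < b then 1 else - s)"
proof -
  have e: "xvar a - lconst s * xvar b
      = single (single a 1) 1 - single (single b 1) s"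
    by (simp add: xvar_def mult_single)
  have inj: "(single i 1 :: expo) = single j 1 \<longleftrightarrow> i = j" for i j
    using xvar_eq_iff[of i j] by (metis xvar_def)
  have "k \<le> single (min a b) 1"
    if "k = single a 1 \<or> k = single b (1::int)" for k
    using that single_less[of a b] single_less[of b a] assms by (auto simp: min_def)
  moreover have "k = single a 1 \<or> k = single b 1"
    if "k \<in> keys (xvar a - lconst s * xvar b)" for k
    using that unfolding e by (auto simp: in_keys_iff lookup_minus lookup_single when_def split: if_splits)
  moreover have "lookup (xvar a - lconst s * xvar b) (single (min a b) 1) = (if a < b then 1 else - s)"
    unfolding e using assms by (auto simp: lookup_minus lookup_single when_def inj min_def)
  ultimately show ?thesis unfolding lead_def by blast
qed

text \<open>The staircase (n - 1, n - 2, ..., 0), the leading exponent of the Vandermonde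
  product.\<close>

definition stair :: "nat \<Rightarrow> expo" where
  "stair n = (\<Sum>p\<in>pairs n. single (fst p) 1)"

text \<open>A permutation only rearranges unordered pairs, so all the products
  \<open>t_prod n w\<close> share one leading exponent and their leading coefficients can be
  added.\<close>

lemma stair_perm:
  assumes "w permutes {1..n}"
  shows "(\<Sum>p\<in>pairs n. single (min (w (fst p)) (w (snd p))) 1) = stair n"
  using sum.reindex_bij_betw[OF sort_pair_bij[OF assms], of "\<lambda>p. single (fst p) (1::int)"]
  by (simp add: sort_pair_def stair_def)

lemma lead_t_prod:
  assumes "w permutes {1..n}"
  shows "lead (t_prod n w) (stair n) (\<Prod>(i, j)\<in>pairs n. if w i < w j then 1 else - tt)"
proof -
  have "w i \<noteq> w j" if "(i, j) \<in> pairs n" for i j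
    using permutes_inj[OF assms] that by (auto simp: inj_eq pairs_def)
  then have "lead (xvar (w (fst p)) - lconst tt * xvar (w (snd p)))
      (single (min (w (fst p)) (w (snd p))) 1) (if w (fst p) < w (snd p) then 1 else - tt)"
    if "p \<in> pairs n" for p
    using that by (cases p) (intro lead_binomial, auto)
  then show ?thesis
    unfolding t_prod_def split_def stair_perm[OF assms, symmetric] by (rule lead_prod[OF finite_pairs])
qed

lemma lead_vdm: "lead (vdm n) (stair n) 1"
proof -
  have "lead (\<Prod>p\<in>pairs n. xvar (fst p) - lconst 1 * xvar (snd p)) (\<Sum>p\<in>pairs n. single (fst p) 1) (\<Prod>p\<in>pairs n. 1)"
  proof (rule lead_prod)
    fix p assume "p \<in> pairs n"
    then have "fst p < snd p" by (auto simp: pairs_def)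
    then show "lead (xvar (fst p) - lconst 1 * xvar (snd p)) (single (fst p) 1) 1"
      using lead_binomial[of "fst p" "snd p" 1] by (simp add: min_def)
  qed simp
  then show ?thesis by (simp add: vdm_def stair_def split_def)
qed

definition stab_poincare :: "nat \<Rightarrow> expo \<Rightarrow> coeff_field" where
  "stab_poincare n \<mu> = (\<Sum>w | w permutes {1..n}. if push w \<mu> = \<mu> then \<Prod>(i, j)\<in>pairs n. if w i < w j then 1 else tt else 0)"

text \<open>Each inversion contributes -1 from the sign and -t from \<open>t_prod\<close>, in total
  t. A summand with w outside the stabilizer has coefficient 0 at the common bound.\<close>

lemma lead_antisymmetrization:
  assumes "\<And>w. w permutes {1..n} \<Longrightarrow> lead (act w f) \<mu> (if push w \<mu> = \<mu> then 1 else 0)"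
  shows "lead (antisymmetrization n f) (\<mu> + stair n) (stab_poincare n \<mu>)"
  unfolding antisymmetrization_def stab_poincare_def
proof (rule lead_sum)
  fix w assume "w \<in> {w. w permutes {1..n}}"
  then have w: "w permutes {1..n}" by simp
  have "inv_sign n w * (\<Prod>(i, j)\<in>pairs n. if w i < w j then 1 else - tt) = (\<Prod>(i, j)\<in>pairs n. if w i < w j then 1 else tt)"
    unfolding inv_sign_def prod.distrib[symmetric] by (intro prod.cong) auto
  moreover have "lead (lconst (inv_sign n w) * (act w f * t_prod n w)) (0 + (\<mu> + stair n))
     (inv_sign n w * ((if push w \<mu> = \<mu> then 1 else 0) * (\<Prod>(i, j)\<in>pairs n. if w i < w j then 1 else - tt)))"
    by (intro lead_mult lead_const assms[OF w] lead_t_prod[OF w])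
  ultimately show "lead (lconst (inv_sign n w) * (act w f * t_prod n w)) (\<mu> + stair n)
     (if push w \<mu> = \<mu> then \<Prod>(i, j)\<in>pairs n. if w i < w j then 1 else tt else 0)"
    by (auto split: if_splits)
qed

text \<open>Leading exponents add under multiplication. As \<open>c\<close> is nonzero, m + d is the
  true leading exponent of the product, which forces m to be that of f.\<close>

lemma lead_quotient:
  assumes A: "lead (g * f) (m + d) c" and g: "lead g d 1" and c: "c \<noteq> 0"
  shows "lookup f m = c"
proof -
  have "f \<noteq> 0" using A c by (auto simp: lead_def)
  then have ne: "keys f \<noteq> {}" by simp
  define M where "M = Max (keys f)"
  have M: "M \<in> keys f" "\<forall>k\<in>keys f. k \<le> M" using ne by (simp_all add: M_def)
  then have l: "lead f M (lookup f M)" by (simp add: lead_def)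
  have gf: "lead (g * f) (d + M) (lookup f M)" using lead_mult[OF g l] by simp
  have "d + M \<le> m + d" using A gf M(1) by (auto simp: lead_def in_keys_iff)
  moreover have "m + d \<le> d + M" using A gf c by (auto simp: lead_def in_keys_iff)
  ultimately have "m = M" by (simp add: add.commute)
  then show ?thesis using A gf by (simp add: lead_def add.commute)
qed

section \<open>Evaluation of the symmetrization\<close>

text \<open>Otherwise the inverse of w is increasing on {1..n} and hence is the identity. The pair
  obtained is an inversion with adjacent values.\<close>

lemma permutes_ascent:
  assumes w: "w permutes {1..n}" and "w \<noteq> id"
  obtains i j where "(i, j) \<in> pairs n" "w i = Suc (w j)"
proof -
  define v where "v = inv w"
  have v: "v permutes {1..n}" using w by (simp add: v_def permutes_inv)
  have wv: "w (v k) = k" for k by (simp add: v_def permutes_inverses[OF w])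
  have "\<exists>k. 1 \<le> k \<and> k < n \<and> v (Suc k) < v k"
  proof (rule ccontr)
    assume no: "\<not> ?thesis"
    have ne: "v k \<noteq> v (Suc k)" for k
    proof
      assume "v k = v (Suc k)"
      then have "w (v k) = w (v (Suc k))" by simp
      then show False unfolding wv by simp
    qed
    have s: "v k < v (Suc k)" if "1 \<le> k" "k < n" for k
    proof -
      have "\<not> v (Suc k) < v k" using no that by blast
      then show ?thesis using ne[of k] by arith
    qed
    have le: "k \<in> {1..n} \<longrightarrow> k \<le> v k" for k
    proof (induction k)
      case (Suc k)
      show ?case
      proof (cases "k = 0")
        case True
        show ?thesis
        proof
          assume "Suc k \<in> {1..n}"
          then have "v (Suc k) \<in> {1..n}" by (simp only: permutes_in_image[OF v])
          then show "Suc k \<le> v (Suc k)" using True by simp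
        qed
      next
        case False
        show ?thesis
        proof
          assume "Suc k \<in> {1..n}"
          then have "k \<le> v k" "v k < v (Suc k)" using Suc.IH s[of k] False by simp_all
          then show "Suc k \<le> v (Suc k)" by linarith
        qed
      qed
    qed simp
    then have "\<forall>i\<in>{1..n}. i \<le> v i" by blast
    then have "v = id" by (rule permutes_natset_ge[OF v])
    then have "w k = k" for k using wv[of k] by simp
    then show False using assms(2) by (simp add: fun_eq_iff)
  qed
  then obtain k where k: "1 \<le> k" "k < n" "v (Suc k) < v k" by blast
  have "k \<in> {1..n}" "Suc k \<in> {1..n}" using k by auto
  then have "v k \<in> {1..n}" "v (Suc k) \<in> {1..n}" by (simp_all only: permutes_in_image[OF v])
  then have "(v (Suc k), v k) \<in> pairs n" using k by (simp add: pairs_def)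
  then show thesis using that[of "v (Suc k)" "v k"] by (simp add: wv)
qed

lemma ev_prod: "(\<And>i. y i \<noteq> 0) \<Longrightarrow> ev y (\<Prod>i\<in>A. f i) = (\<Prod>i\<in>A. ev y (f i))"
  by (induction A rule: infinite_finite_induct) (simp_all add: ev_mult)

lemma ev_sum: "ev y (\<Sum>i\<in>A. f i) = (\<Sum>i\<in>A. ev y (f i))"
  by (induction A rule: infinite_finite_induct) (simp_all add: laurent_eval_add)

text \<open>
  The factor \<open>x\<^bsub>w(i)\<^esub> - t x\<^bsub>w(j)\<^esub>\<close> vanishes at this point if \<open>w(i) = w(j) + 1\<close>, so that only \<open>w = id\<close> survives.
\<close>

lemma ev_antisymmetrization:
  defines "y \<equiv> \<lambda>i. tt ^ (i - 1)"
  shows "ev y (antisymmetrization n f) = ev y f * (\<Prod>(i, j)\<in>pairs n. y i - tt * y j)"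
proof -
  have nz: "y i \<noteq> 0" for i by (simp add: y_def)
  have t: "ev y (t_prod n w) = (\<Prod>(i, j)\<in>pairs n. y (w i) - tt * y (w j))" for w
    by (simp add: t_prod_def ev_prod nz split_def ev_diff ev_mult)
  have "ev y (lconst (inv_sign n w) * (act w f * t_prod n w)) = (if w = id then ev y f * (\<Prod>(i, j)\<in>pairs n. y i - tt * y j) else 0)"
    if w: "w permutes {1..n}" for w
  proof (cases "w = id")
    case True
    have "inv_sign n id = 1" unfolding inv_sign_def by (rule prod.neutral) (auto simp: pairs_def)
    then show ?thesis using True by (simp add: ev_mult nz t act_id)
  next
    case False
    then obtain i j where ij: "(i, j) \<in> pairs n" "w i = Suc (w j)" using permutes_ascent[OF w] by blast
    have "j \<in> {1..n}" using ij(1) by (auto simp: pairs_def)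
    then have "1 \<le> w j" using permutes_in_image[OF w, of j] by simp
    then have "y (w i) - tt * y (w j) = 0" using ij by (cases "w j") (simp_all add: y_def)
    then have "ev y (t_prod n w) = 0"
      unfolding t using ij(1) by (intro prod_zero[OF finite_pairs] bexI[of _ "(i, j)"]) simp_all
    then show ?thesis using False by (simp add: ev_mult nz)
  qed
  then have "ev y (antisymmetrization n f)
      = (\<Sum>w | w permutes {1..n}. if w = id then ev y f * (\<Prod>(i, j)\<in>pairs n. y i - tt * y j) else 0)"
    unfolding antisymmetrization_def ev_sum by (intro sum.cong refl) blast
  then show ?thesis using finite_permutations[of "{1..n}"] by (simp add: permutes_id)
qed

section \<open>Decreasing exponents and the normalizing constant\<close>

definition decreasing_expos :: "nat \<Rightarrow> expo set" where
  "decreasing_expos n = {\<mu> \<in> nonneg_expos n. \<forall>i\<in>{1..n}. \<forall>j\<in>{1..n}. i \<le> j \<longrightarrow> lookup \<mu> j \<le> lookup \<mu> i}"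

lemma decreasing_exposD:
  assumes "lam \<in> decreasing_expos n"
  shows "lam \<in> nonneg_expos n" "lam \<in> expos n"
    and "\<And>i j. 1 \<le> i \<Longrightarrow> i \<le> j \<Longrightarrow> j \<le> n \<Longrightarrow> lookup lam j \<le> lookup lam i"
  using assms by (auto simp: decreasing_expos_def nonneg_expos_def)

lemma expos_less_obtain:
  assumes "\<mu> \<in> expos n" "\<nu> \<in> expos n" "\<mu> < \<nu>"
  obtains j where "j \<in> {1..n}" "lookup \<mu> j < lookup \<nu> j" "\<And>i. i < j \<Longrightarrow> lookup \<mu> i = lookup \<nu> i"
proof -
  obtain j where j: "lookup \<mu> j < lookup \<nu> j" "\<And>i. i < j \<Longrightarrow> lookup \<mu> i = lookup \<nu> i"
    using assms(3) unfolding less_poly_mapping.rep_eq less_fun_def by blast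
  have "j \<in> keys \<mu> \<or> j \<in> keys \<nu>" using j(1) by (auto simp: in_keys_iff)
  then have "j \<in> {1..n}" using assms(1,2) by (auto simp: expos_def)
  then show thesis using that j by blast
qed

text \<open>Suppose xi is lexicographically larger and j is the first position of difference. For k
  = lambda_j the entries before j contribute equally, those of lambda from j on contribute nothing,
  and xi_j contributes a positive amount.\<close>

lemma hull_fun_le_imp_le:
  assumes lam: "lam \<in> decreasing_expos n" and \<xi>: "\<xi> \<in> expos n"
    and le: "\<And>k. hull_fun n k 0 \<xi> \<le> hull_fun n k 0 lam"
  shows "\<xi> \<le> lam"
proof (rule ccontr)
  assume "\<not> \<xi> \<le> lam"
  then have "lam < \<xi>" by simp
  then obtain j where j: "j \<in> {1..n}" "lookup lam j < lookup \<xi> j" "\<And>i. i < j \<Longrightarrow> lookup lam i = lookup \<xi> i"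
    using expos_less_obtain[OF decreasing_exposD(2)[OF lam] \<xi>] by blast
  have "hull_fun n (lookup lam j) 0 lam < hull_fun n (lookup lam j) 0 \<xi>"
    unfolding hull_fun_def
  proof (rule sum_strict_mono_ex1)
    show "\<forall>i\<in>{1..n}. max 0 (lookup lam i - lookup lam j - (if i \<le> 0 then 1 else 0))
        \<le> max 0 (lookup \<xi> i - lookup lam j - (if i \<le> 0 then 1 else 0))"
    proof
      fix i assume i: "i \<in> {1..n}"
      show "max 0 (lookup lam i - lookup lam j - (if i \<le> 0 then 1 else 0))
        \<le> max 0 (lookup \<xi> i - lookup lam j - (if i \<le> 0 then 1 else 0))"
      proof (cases "i < j")
        case False
        then have "lookup lam i \<le> lookup lam j" using decreasing_exposD(3)[OF lam, of j i] i j by simp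
        then have "max 0 (lookup lam i - lookup lam j - (if i \<le> 0 then 1 else 0)) = 0"
          by (intro max_absorb1) auto
        then show ?thesis by simp
      qed (simp add: j(3))
    qed
    show "\<exists>i\<in>{1..n}. max 0 (lookup lam i - lookup lam j - (if i \<le> 0 then 1 else 0))
        < max 0 (lookup \<xi> i - lookup lam j - (if i \<le> 0 then 1 else 0))"
      using j by (intro bexI[of _ j]) auto
  qed simp
  then show False using le[of "lookup lam j"] by simp
qed

lemma hull_fun_count:
  "r \<le> n \<Longrightarrow> hull_fun n k r \<mu> = hull_fun n k 0 \<mu> - (\<Sum>i\<in>{1..r}. if k < lookup \<mu> i then 1 else 0)"
proof (induction r)
  case (Suc r)
  then show ?case using hull_fun_step[of "Suc r" n k \<mu>] by (simp add: atLeastAtMostSuc_conv)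
qed simp

text \<open>When the symmetric functions agree, \<open>below\<close> says that every initial segment
  of nu has at least as many entries above k as that of lambda. At the first difference j, with k =
  nu_j, this fails.\<close>

lemma below_rearrangement_eq:
  assumes lam: "lam \<in> decreasing_expos n" and \<nu>: "\<nu> \<in> expos n"
    and b: "below n \<nu> lam" and e: "\<And>k. hull_fun n k 0 \<nu> = hull_fun n k 0 lam"
  shows "\<nu> = lam"
proof (rule ccontr)
  assume "\<nu> \<noteq> lam"
  moreover have "\<nu> \<le> lam" by (rule hull_fun_le_imp_le[OF lam \<nu>]) (simp add: e)
  ultimately have "\<nu> < lam" by simp
  then obtain j where j: "j \<in> {1..n}" "lookup \<nu> j < lookup lam j" "\<And>i. i < j \<Longrightarrow> lookup \<nu> i = lookup lam i"
    using expos_less_obtain[OF \<nu> decreasing_exposD(2)[OF lam]] by blast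
  define k where "k = lookup \<nu> j"
  have "(\<Sum>i\<in>{1..j}. if k < lookup \<nu> i then 1 else 0 :: int) < (\<Sum>i\<in>{1..j}. if k < lookup lam i then 1 else 0)"
  proof (rule sum_strict_mono_ex1)
    show "\<forall>i\<in>{1..j}. (if k < lookup \<nu> i then 1 else 0 :: int) \<le> (if k < lookup lam i then 1 else 0)"
    proof
      fix i assume "i \<in> {1..j}"
      then show "(if k < lookup \<nu> i then 1 else 0 :: int) \<le> (if k < lookup lam i then 1 else 0)"
        using j(3)[of i] by (cases "i = j") (auto simp: k_def)
    qed
    show "\<exists>i\<in>{1..j}. (if k < lookup \<nu> i then 1 else 0 :: int) < (if k < lookup lam i then 1 else 0)"
      using j by (intro bexI[of _ j]) (auto simp: k_def)
  qed simp
  moreover have "hull_fun n k j \<nu> \<le> hull_fun n k j lam" using b j(1) by (simp add: below_def)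
  ultimately show False using hull_fun_count[of j n k] j(1) e[of k] by simp
qed

lemma push_permutes_in_expos:
  assumes w: "w permutes {1..n}" and m: "m \<in> expos n"
  shows "push w m \<in> expos n" and "hull_fun n k 0 (push w m) = hull_fun n k 0 m"
proof -
  have l: "lookup (push w m) (w i) = lookup m i" for i by (rule lookup_push_inj[OF permutes_inj[OF w]])
  show "push w m \<in> expos n"
    unfolding expos_def mem_Collect_eq
  proof
    fix k assume "k \<in> keys (push w m)"
    then have "lookup m (inv w k) \<noteq> 0"
      using l[of "inv w k"] unfolding permutes_inverses(1)[OF w] in_keys_iff by simp
    then have "inv w k \<in> keys m" by (simp only: in_keys_iff not_False_eq_True)
    then have "inv w k \<in> {1..n}" using m unfolding expos_def by blast
    then show "k \<in> {1..n}" using permutes_in_image[OF permutes_inv[OF w]] by blast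
  qed
  have "hull_fun n k 0 (push w m) = (\<Sum>i\<in>{1..n}. max 0 (lookup (push w m) (w i) - k - (if w i \<le> 0 then 1 else 0)))"
    unfolding hull_fun_def by (rule sum.reindex_bij_betw[OF permutes_imp_bij[OF w], symmetric])
  also have "\<dots> = hull_fun n k 0 m"
    unfolding hull_fun_def l
  proof (intro sum.cong refl)
    fix i assume i: "i \<in> {1..n}"
    then have "w i \<in> {1..n}" by (simp only: permutes_in_image[OF w])
    then show "max 0 (lookup m i - k - (if w i \<le> 0 then 1 else 0)) = max 0 (lookup m i - k - (if i \<le> 0 then 1 else 0))"
      using i by simp
  qed
  finally show "hull_fun n k 0 (push w m) = hull_fun n k 0 m" .
qed

context electronic
begin

text \<open>Exponents of w E_lambda are rearrangements of exponents below lambda, and majorization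
  survives rearrangement. The coefficient at lambda is that of E_lambda at a rearrangement of
  lambda, which the support bound makes 0 unless it is lambda itself.\<close>

lemma lead_act_E:
  assumes lam: "lam \<in> decreasing_expos n" and w: "w permutes {1..n}"
  shows "lead (act w (E lam)) lam (if push w lam = lam then 1 else 0)"
proof -
  note d = decreasing_exposD(1,2)[OF lam]
  have ex: "keys (E lam) \<subseteq> expos n" using E_in_laurents[OF d(2)] by (simp add: laurents_def)
  have sup: "below n \<nu> lam" if "\<nu> \<in> keys (E lam)" for \<nu> using E_support[OF d(1)] that by blast
  have one: "lookup (E lam) lam = 1" using E_support[OF d(1)] by blast
  have "\<xi> \<le> lam" if "\<xi> \<in> keys (act w (E lam))" for \<xi>
  proof -
    have "\<xi> \<in> push w ` keys (E lam)" using that keys_msubst by (rule subsetD[rotated])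
    then obtain \<nu> where \<nu>: "\<nu> \<in> keys (E lam)" "\<xi> = push w \<nu>" by blast
    then have "\<nu> \<in> expos n" using ex by blast
    note p = push_permutes_in_expos[OF w this]
    show ?thesis unfolding \<nu>(2)
      by (rule hull_fun_le_imp_le[OF lam p(1)]) (use sup[OF \<nu>(1)] in \<open>simp add: p(2) below_def\<close>)
  qed
  moreover have "lookup (act w (E lam)) lam = (if push w lam = lam then 1 else 0)"
  proof -
    define \<nu> where "\<nu> = push (inv w) lam"
    have v: "inv w permutes {1..n}" using w by (rule permutes_inv)
    have pp: "push w (push (inv w) m) = m" "push (inv w) (push w m) = m" for m
    proof -
      have "push id m = m" by (induction m rule: laurent_induct) (simp_all add: push_add)
      then show "push w (push (inv w) m) = m" "push (inv w) (push w m) = m"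
        by (simp_all add: push_push permutes_inv_o[OF w])
    qed
    have "inj (push w)" by (metis injI pp(2))
    then have "lookup (act w (E lam)) (push w \<nu>) = lookup (E lam) \<nu>"
      using lookup_msubst[of w UNIV "E lam" \<nu> "\<lambda>_. 1"] by simp
    then have l: "lookup (act w (E lam)) lam = lookup (E lam) \<nu>" by (simp add: \<nu>_def pp)
    show ?thesis
    proof (cases "push w lam = lam")
      case True
      then have "\<nu> = lam" using pp(2)[of lam] by (simp add: \<nu>_def)
      then show ?thesis using l one True by simp
    next
      case False
      have "\<nu> \<notin> keys (E lam)"
      proof
        assume "\<nu> \<in> keys (E lam)"
        then have "\<nu> = lam"
          using below_rearrangement_eq[OF lam, of \<nu>] push_permutes_in_expos[OF v d(2)] sup by (simp add: \<nu>_def)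
        then show False using False pp(1)[of lam] by (simp add: \<nu>_def)
      qed
      then show ?thesis using l False by (simp add: in_keys_iff)
    qed
  qed
  ultimately show ?thesis by (simp add: lead_def)
qed

theorem bosonic_eval:
  assumes lam: "lam \<in> decreasing_expos n" and W: "stab_poincare n lam \<noteq> 0"
  shows "ev (\<lambda>i. tt ^ (i - 1)) (bosonic_macdonald n E lam) = E_val lam / stab_poincare n lam
     * (\<Prod>(i, j)\<in>pairs n. (tt ^ (i - 1) - tt * tt ^ (j - 1)) / (tt ^ (i - 1) - tt ^ (j - 1)))"
proof -
  define y :: "nat \<Rightarrow> coeff_field" where "y = (\<lambda>i. tt ^ (i - 1))"
  have nz: "y i \<noteq> 0" for i by (simp add: y_def)
  obtain B where B: "antisymmetrization n (E lam) = vdm n * B"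
    using vdm_dvd_antisymmetrization by (auto simp: dvd_def)
  have S: "t_symmetrization n (E lam) = to_fract B"
  proof -
    have "t_symmetrization n (E lam) * to_fract (vdm n) = to_fract B * to_fract (vdm n)"
      unfolding t_symmetrization_vdm B by (simp add: mult.commute)
    then show ?thesis by simp
  qed
  have "lead (vdm n * B) (lam + stair n) (stab_poincare n lam)"
    unfolding B[symmetric] by (rule lead_antisymmetrization) (rule lead_act_E[OF lam])
  then have lB: "lookup B lam = stab_poincare n lam" by (rule lead_quotient[OF _ lead_vdm W])
  define P where "P = lconst (1 / stab_poincare n lam) * B"
  have lc: "lookup (lconst c * B) lam = c * lookup B lam" for c
    using lookup_single_mult[of 0 c B lam] by simp
  have P: "bosonic_macdonald n E lam = P"
    unfolding bosonic_macdonald_def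
  proof (rule the_equality)
    show "\<exists>W. to_fract P = const (1 / W) * t_symmetrization n (E lam) \<and> lookup P lam = 1"
      using W by (intro exI[of _ "stab_poincare n lam"]) (simp add: P_def S const_def lc lB)
    fix Q assume "\<exists>W. to_fract Q = const (1 / W) * t_symmetrization n (E lam) \<and> lookup Q lam = 1"
    then obtain W' where Q: "to_fract Q = const (1 / W') * t_symmetrization n (E lam)" "lookup Q lam = 1" by blast
    have "to_fract Q = to_fract (lconst (1 / W') * B)" using Q(1) unfolding S const_def by (simp only: to_fract_mult)
    then have Q': "Q = lconst (1 / W') * B" by (simp only: to_fract_eq_iff)
    \<comment> \<open>The coefficient of x^lambda determines 1/W', which settles uniqueness. The
      value W' = 0, where 1/W' = 0, is excluded as well since the coefficient is 1.\<close>
    then have "1 / W' = 1 / stab_poincare n lam"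
      using Q(2) W unfolding Q' lc lB by (metis nonzero_eq_divide_eq)
    then show "Q = P" unfolding Q' P_def by simp
  qed
  have v: "ev y (vdm n) = (\<Prod>(i, j)\<in>pairs n. y i - y j)"
    by (simp add: vdm_def ev_prod nz split_def ev_diff)
  have yb: "base_pt = y" by (simp add: fun_eq_iff base_pt_def y_def)
  have "y i - y j \<noteq> 0" if "(i, j) \<in> pairs n" for i j
    using generic_distinct[OF generic_base_pt, of i j] that by (auto simp: yb pairs_def)
  then have v0: "(\<Prod>(i, j)\<in>pairs n. y i - y j) \<noteq> 0" by (auto simp: prod_zero_iff)
  have "(\<Prod>(i, j)\<in>pairs n. y i - y j) * ev y B = ev y (vdm n * B)"
    by (simp only: v ev_mult nz not_False_eq_True)
  also have "\<dots> = E_val lam * (\<Prod>(i, j)\<in>pairs n. y i - tt * y j)"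
    unfolding B[symmetric] E_val_def yb using ev_antisymmetrization[of n "E lam"] by (simp only: y_def)
  finally have "ev y B = E_val lam * ((\<Prod>(i, j)\<in>pairs n. y i - tt * y j) / (\<Prod>(i, j)\<in>pairs n. y i - y j))"
    using v0 by (simp add: field_simps)
  then have "ev y (bosonic_macdonald n E lam)
     = E_val lam / stab_poincare n lam * ((\<Prod>(i, j)\<in>pairs n. y i - tt * y j) / (\<Prod>(i, j)\<in>pairs n. y i - y j))"
    by (simp add: P P_def ev_mult nz)
  then show ?thesis by (simp add: y_def split_def prod_dividef)
qed

end

section \<open>The stabilizer\<close>

lemma pairs_Suc: "pairs (Suc m) = pairs m \<union> (\<lambda>i. (i, Suc m)) ` {1..m}"
  by (auto simp: pairs_def)

lemma prod_pairs_Suc: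
  "(\<Prod>p\<in>pairs (Suc m). f p) = (\<Prod>p\<in>pairs m. f p) * (\<Prod>i\<in>{1..m}. f (i, Suc m))"
proof -
  have "(\<Prod>p\<in>pairs (Suc m). f p) = (\<Prod>p\<in>pairs m. f p) * (\<Prod>p\<in>(\<lambda>i. (i, Suc m)) ` {1..m}. f p)"
    unfolding pairs_Suc by (rule prod.union_disjoint[OF finite_pairs]) (auto simp: pairs_def)
  also have "(\<Prod>p\<in>(\<lambda>i. (i, Suc m)) ` {1..m}. f p) = (\<Prod>i\<in>{1..m}. f (i, Suc m))"
    by (subst prod.reindex) (auto simp: inj_on_def)
  finally show ?thesis .
qed

text \<open>For w fixing m + 1, the word of w composed with this cycle is the word of w with the
  value m + 1 inserted at position p.\<close>

definition to_last :: "nat \<Rightarrow> nat \<Rightarrow> nat \<Rightarrow> nat" where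
  "to_last m p i = (if i = p then Suc m else if p < i \<and> i \<le> Suc m then i - 1 else i)"

lemma to_last_permutes:
  assumes "p \<in> {1..Suc m}"
  shows "to_last m p permutes {1..Suc m}"
proof (rule bij_imp_permutes)
  show "bij_betw (to_last m p) {1..Suc m} {1..Suc m}"
    by (rule bij_betw_byWitness[where f' = "\<lambda>i. if i = Suc m then p else if p \<le> i then Suc i else i"])
      (use assms in \<open>auto simp: to_last_def\<close>)
  show "to_last m p x = x" if "x \<notin> {1..Suc m}" for x using that assms by (auto simp: to_last_def)
qed

definition stabilizer :: "nat \<Rightarrow> (nat \<Rightarrow> int) \<Rightarrow> (nat \<Rightarrow> nat) set" where
  "stabilizer m g = {w. w permutes {1..m} \<and> (\<forall>i\<in>{1..m}. g (w i) = g i)}"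

definition inv_weight :: "nat \<Rightarrow> (nat \<Rightarrow> nat) \<Rightarrow> coeff_field" where
  "inv_weight m w = (\<Prod>(i, j)\<in>pairs m. if w i < w j then 1 else tt)"

lemma inv_weight_Suc_fix:
  assumes w: "w permutes {1..m}"
  shows "inv_weight (Suc m) w = inv_weight m w"
proof -
  have f: "w (Suc m) = Suc m" by (rule permutes_not_in[OF w]) simp
  have "w i < Suc m" if "i \<in> {1..m}" for i
  proof -
    have "w i \<in> {1..m}" using that by (simp only: permutes_in_image[OF w])
    then show ?thesis by simp
  qed
  then show ?thesis unfolding inv_weight_def prod_pairs_Suc by (simp add: f)
qed

text \<open>The inserted largest value forms an inversion with each of the m + 1 - p entries to its
  right and with no other entry.\<close>

lemma inv_weight_to_last:
  assumes w: "w permutes {1..m}" and p: "p \<in> {1..Suc m}"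
  shows "inv_weight (Suc m) (w \<circ> to_last m p) = tt ^ (Suc m - p) * inv_weight m w"
proof -
  let ?c = "to_last m p"
  have c: "?c permutes {1..Suc m}" by (rule to_last_permutes[OF p])
  have f: "w (Suc m) = Suc m" by (rule permutes_not_in[OF w]) simp
  have wlt: "w i < Suc m" if "i \<in> {1..m}" for i
  proof -
    have "w i \<in> {1..m}" using that by (simp only: permutes_in_image[OF w])
    then show ?thesis by simp
  qed
  have term_eq: "(if w (?c i) < w (?c j) then 1 else tt)
     = (if w (fst (sort_pair ?c (i, j))) < w (snd (sort_pair ?c (i, j))) then 1 else tt) * (if i = p then tt else 1)"
    if ij: "(i, j) \<in> pairs (Suc m)" for i j
  proof (cases "i = p")
    case True
    then have cj: "?c i = Suc m" "?c j \<in> {1..m}" using ij p by (auto simp: to_last_def pairs_def)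
    then have "sort_pair ?c (i, j) = (?c j, Suc m)" by (auto simp: sort_pair_def min_def max_def)
    moreover have "w (?c j) < Suc m" by (rule wlt[OF cj(2)])
    ultimately show ?thesis using True cj(1) f by simp
  next
    case False
    then have "?c i < ?c j" using ij p by (auto simp: to_last_def pairs_def)
    then have "sort_pair ?c (i, j) = (?c i, ?c j)" by (simp add: sort_pair_def)
    then show ?thesis using False by simp
  qed
  have "inv_weight (Suc m) (w \<circ> ?c)
     = (\<Prod>r\<in>pairs (Suc m). (if w (fst (sort_pair ?c r)) < w (snd (sort_pair ?c r)) then 1 else tt) * (if fst r = p then tt else 1))"
    unfolding inv_weight_def
  proof (rule prod.cong[OF refl])
    fix r assume r: "r \<in> pairs (Suc m)"
    show "(case r of (i, j) \<Rightarrow> if (w \<circ> ?c) i < (w \<circ> ?c) j then 1 else tt)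
      = (if w (fst (sort_pair ?c r)) < w (snd (sort_pair ?c r)) then 1 else tt) * (if fst r = p then tt else 1)"
      using term_eq[of "fst r" "snd r"] r by (simp add: split_def)
  qed
  also have "\<dots> = (\<Prod>r\<in>pairs (Suc m). if w (fst (sort_pair ?c r)) < w (snd (sort_pair ?c r)) then 1 else tt)
      * (\<Prod>r\<in>pairs (Suc m). if fst r = p then tt else 1)"
    by (rule prod.distrib)
  also have "(\<Prod>r\<in>pairs (Suc m). if w (fst (sort_pair ?c r)) < w (snd (sort_pair ?c r)) then 1 else tt) = inv_weight (Suc m) w"
    unfolding inv_weight_def split_def by (rule prod.reindex_bij_betw[OF sort_pair_bij[OF c]])
  also have "(\<Prod>r\<in>pairs (Suc m). if fst r = p then tt else 1) = tt ^ (Suc m - p)"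
  proof -
    have "(\<Prod>r\<in>pairs (Suc m). if fst r = p then tt else 1) = (\<Prod>r\<in>{r \<in> pairs (Suc m). fst r = p}. tt)"
      by (rule prod.inter_filter[symmetric]) simp
    also have "{r \<in> pairs (Suc m). fst r = p} = Pair p ` {Suc p..Suc m}" using p by (auto simp: pairs_def)
    also have "(\<Prod>r\<in>Pair p ` {Suc p..Suc m}. tt) = tt ^ (Suc m - p)"
      by (subst prod.reindex) (simp_all add: inj_on_def)
    finally show ?thesis .
  qed
  finally show ?thesis unfolding inv_weight_Suc_fix[OF w] by (simp only: mult.commute)
qed

text \<open>A permutation of \<open>1, \<dots>, m + 1\<close> is given by the position \<open>p\<close> of the value \<open>m + 1\<close> and the remaining word.\<close>

lemma stabilizer_Suc:
  assumes dec: "\<And>i j. 1 \<le> i \<Longrightarrow> i \<le> j \<Longrightarrow> j \<le> Suc m \<Longrightarrow> g j \<le> g i"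
  shows "bij_betw (\<lambda>(p, w). w \<circ> to_last m p)
     ({p \<in> {1..Suc m}. g p = g (Suc m)} \<times> stabilizer m g) (stabilizer (Suc m) g)"
  unfolding bij_betw_def
proof
  let ?F = "\<lambda>(p, w). w \<circ> to_last m p"
  let ?D = "{p \<in> {1..Suc m}. g p = g (Suc m)} \<times> stabilizer m g"
  have fix_last: "w (Suc m) = Suc m" if "w \<in> stabilizer m g" for w
    using that permutes_not_in[of w "{1..m}" "Suc m"] by (simp add: stabilizer_def)
  show "inj_on ?F ?D"
  proof (rule inj_onI, clarify)
    fix p w p' w'
    assume a: "p \<in> {1..Suc m}" "p' \<in> {1..Suc m}" "w \<in> stabilizer m g" "w' \<in> stabilizer m g"
      and e: "w \<circ> to_last m p = w' \<circ> to_last m p'"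
    have "w (to_last m p p) = w' (to_last m p' p)" using e by (metis comp_apply)
    moreover have "to_last m p p = Suc m" by (simp add: to_last_def)
    ultimately have "w' (to_last m p' p) = w' (Suc m)" using fix_last[OF a(3)] fix_last[OF a(4)] by simp
    moreover have "inj w'" using a(4) permutes_inj unfolding stabilizer_def by blast
    ultimately have "to_last m p' p = Suc m" by (simp add: inj_eq)
    then have pp: "p = p'" using a by (auto simp: to_last_def split: if_splits)
    have "bij (to_last m p)" using to_last_permutes[OF a(1)] permutes_bij by blast
    then have "w = w'" using e pp by (metis bij_is_surj surj_fun_eq UNIV_I comp_apply ext surj_def)
    then show "p = p' \<and> w = w'" using pp by simp
  qed
  show "?F ` ?D = stabilizer (Suc m) g"
  proof
    show "?F ` ?D \<subseteq> stabilizer (Suc m) g"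
    proof clarify
      fix p w assume p: "p \<in> {1..Suc m}" "g p = g (Suc m)" and w: "w \<in> stabilizer m g"
      have wp: "w permutes {1..Suc m}" using w permutes_subset[of w "{1..m}" "{1..Suc m}"] by (auto simp: stabilizer_def)
      have gw: "g (w i) = g i" if "i \<in> {1..Suc m}" for i
        using w that fix_last[OF w] by (cases "i = Suc m") (auto simp: stabilizer_def)
      \<comment> \<open>A decreasing g with equal values at p and m + 1 is constant between them,
        and the cycle moves only these positions.\<close>
      have gc: "g (to_last m p i) = g i" if i: "i \<in> {1..Suc m}" for i
      proof (cases "p < i")
        case True
        then have le: "1 \<le> p" "p \<le> i" "i \<le> Suc m" "p \<le> i - 1" "i - 1 \<le> Suc m" "1 \<le> i" "1 \<le> i - 1"
          using p i by auto
        have "g i = g (Suc m)"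
          using dec[OF le(1-3)] dec[OF le(6,3) order_refl] p(2) by linarith
        moreover have "g (i - 1) = g (Suc m)"
          using dec[OF le(1,4,5)] dec[OF le(7,5) order_refl] p(2) by linarith
        moreover have "to_last m p i = i - 1" using True i by (simp add: to_last_def)
        ultimately show ?thesis by (simp only:)
      qed (use p in \<open>auto simp: to_last_def\<close>)
      have cp: "to_last m p permutes {1..Suc m}" by (rule to_last_permutes[OF p(1)])
      have "g (w (to_last m p i)) = g i" if i: "i \<in> {1..Suc m}" for i
      proof -
        have "to_last m p i \<in> {1..Suc m}" using i by (simp only: permutes_in_image[OF cp])
        then show ?thesis using gw gc[OF i] by simp
      qed
      then show "w \<circ> to_last m p \<in> stabilizer (Suc m) g"
        using permutes_compose[OF cp wp] by (simp add: stabilizer_def)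
    qed
    show "stabilizer (Suc m) g \<subseteq> ?F ` ?D"
    proof
      fix v assume v: "v \<in> stabilizer (Suc m) g"
      then have vp: "v permutes {1..Suc m}" and gv: "\<And>i. i \<in> {1..Suc m} \<Longrightarrow> g (v i) = g i"
        by (simp_all add: stabilizer_def)
      define p where "p = inv v (Suc m)"
      have vpp: "v p = Suc m" by (simp add: p_def permutes_inverses(1)[OF vp])
      have p: "p \<in> {1..Suc m}" using permutes_in_image[OF vp, of p] vpp by simp
      have gp: "g p = g (Suc m)" using gv[OF p] vpp by simp
      have cp: "to_last m p permutes {1..Suc m}" by (rule to_last_permutes[OF p])
      define w where "w = v \<circ> inv (to_last m p)"
      have wc: "w (to_last m p i) = v i" for i by (simp add: w_def permutes_inverses(2)[OF cp])
      have wS: "w permutes {1..Suc m}" unfolding w_def by (rule permutes_compose[OF permutes_inv[OF cp] vp])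
      have "w (Suc m) = Suc m" using wc[of p] vpp by (simp add: to_last_def)
      then have wp: "w permutes {1..m}"
        by (intro permutes_superset[OF wS]) (auto simp: le_Suc_eq)
      have "g (w i) = g i" if i: "i \<in> {1..m}" for i
      proof (cases "i < p")
        case True
        then have "to_last m p i = i" by (simp add: to_last_def)
        then show ?thesis using wc[of i] gv[of i] i by simp
      next
        case False
        then have "to_last m p (Suc i) = i" using i by (simp add: to_last_def)
        then have "g (w i) = g (Suc i)" using wc[of "Suc i"] gv[of "Suc i"] i by simp
        moreover have "g (Suc i) = g (Suc m)" "g i = g (Suc m)"
          using dec[of p i] dec[of p "Suc i"] dec[of i "Suc m"] dec[of "Suc i" "Suc m"] False i p gp by auto
        ultimately show ?thesis by simp
      qed
      then have "w \<in> stabilizer m g" using wp by (simp add: stabilizer_def)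
      moreover have "v = w \<circ> to_last m p" using wc by (simp add: fun_eq_iff)
      ultimately show "v \<in> ?F ` ?D" using p gp by (intro image_eqI[of _ _ "(p, w)"]) auto
    qed
  qed
qed

definition t_ratio :: "nat \<Rightarrow> coeff_field" where
  "t_ratio h = (1 - tt ^ Suc h) / (1 - tt ^ h)"

lemma one_minus_qt_nz:
  assumes "a \<noteq> 0 \<or> h \<noteq> 0"
  shows "1 - qq ^ a * tt ^ h \<noteq> 0"
proof
  assume "1 - qq ^ a * tt ^ h = 0"
  then have "qq ^ a * tt ^ h = qq ^ 0 * tt ^ 0" by simp
  from qq_tt_monomial_eq[OF this] show False using assms by simp
qed

lemma one_minus_tt_nz: "h \<noteq> 0 \<Longrightarrow> 1 - tt ^ h \<noteq> 0"
  using one_minus_qt_nz[of 0 h] by simp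

lemma t_ratio_nz: "h \<noteq> 0 \<Longrightarrow> t_ratio h \<noteq> 0"
  using one_minus_tt_nz[of h] one_minus_tt_nz[of "Suc h"] unfolding t_ratio_def by (simp del: power_Suc)

text \<open>Both sides equal (1 - t^(h+1))/(1 - t), the left one as a geometric sum and the right
  one by telescoping.\<close>

lemma t_integer_block:
  "h \<le> m \<Longrightarrow> (\<Sum>p\<in>{Suc m - h..Suc m}. tt ^ (Suc m - p)) = (\<Prod>i\<in>{Suc m - h..m}. t_ratio (Suc m - i))"
proof -
  have nz: "1 - tt \<noteq> 0" using one_minus_tt_nz[of 1] by simp
  have s: "h \<le> m \<Longrightarrow> (\<Sum>p\<in>{Suc m - h..Suc m}. tt ^ (Suc m - p)) = (1 - tt ^ Suc h) / (1 - tt)" for h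
  proof (induction h)
    case 0
    then show ?case using nz by simp
  next
    case (Suc h)
    have "{Suc m - Suc h..Suc m} = insert (Suc m - Suc h) {Suc m - h..Suc m}" using Suc.prems by auto
    moreover have "Suc m - Suc h \<notin> {Suc m - h..Suc m}" using Suc.prems by auto
    moreover have "Suc m - (Suc m - Suc h) = Suc h" using Suc.prems by simp
    ultimately have "(\<Sum>p\<in>{Suc m - Suc h..Suc m}. tt ^ (Suc m - p)) = tt ^ Suc h + (1 - tt ^ Suc h) / (1 - tt)"
      using Suc by (simp del: power_Suc)
    then show ?case using nz by (simp add: field_simps)
  qed
  have p: "h \<le> m \<Longrightarrow> (\<Prod>i\<in>{Suc m - h..m}. t_ratio (Suc m - i)) = (1 - tt ^ Suc h) / (1 - tt)" for h
  proof (induction h)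
    case 0
    then show ?case using nz by simp
  next
    case (Suc h)
    have "{Suc m - Suc h..m} = insert (Suc m - Suc h) {Suc m - h..m}" using Suc.prems by auto
    moreover have "Suc m - Suc h \<notin> {Suc m - h..m}" using Suc.prems by auto
    moreover have "Suc m - (Suc m - Suc h) = Suc h" using Suc.prems by simp
    ultimately have "(\<Prod>i\<in>{Suc m - Suc h..m}. t_ratio (Suc m - i)) = t_ratio (Suc h) * ((1 - tt ^ Suc h) / (1 - tt))"
      using Suc by (simp del: power_Suc)
    then show ?case using nz one_minus_tt_nz[of "Suc h"] by (simp add: t_ratio_def del: power_Suc)
  qed
  show "h \<le> m \<Longrightarrow> ?thesis" using s p by simp
qed

text \<open>Macdonald's product over positive roots for the Poincare polynomial, here of a Young
  subgroup; j - i is the height of a root. Inserting the value m + 1 multiplies the sum by a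
  t-integer, whose size is that of the last block of equal values of g.\<close>

lemma sum_inv_weight_stabilizer:
  assumes "\<And>i j. 1 \<le> i \<Longrightarrow> i \<le> j \<Longrightarrow> j \<le> m \<Longrightarrow> g j \<le> g i"
  shows "(\<Sum>w\<in>stabilizer m g. inv_weight m w) = (\<Prod>(i, j)\<in>pairs m. if g i = g j then t_ratio (j - i) else 1)"
  using assms
proof (induction m)
  case 0
  have p: "pairs 0 = {}" by (auto simp: pairs_def)
  have s: "stabilizer 0 g = {id}" by (auto simp: stabilizer_def)
  show ?case by (simp add: inv_weight_def p s)
next
  case (Suc m)
  note dec = Suc.prems
  let ?D = "{p \<in> {1..Suc m}. g p = g (Suc m)}"
  have IH: "(\<Sum>w\<in>stabilizer m g. inv_weight m w) = (\<Prod>(i, j)\<in>pairs m. if g i = g j then t_ratio (j - i) else 1)"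
    by (rule Suc.IH, rule dec) simp_all
  have "(\<Sum>w\<in>stabilizer (Suc m) g. inv_weight (Suc m) w)
     = (\<Sum>x\<in>?D \<times> stabilizer m g. inv_weight (Suc m) (case x of (p, w) \<Rightarrow> w \<circ> to_last m p))"
    by (rule sum.reindex_bij_betw[OF stabilizer_Suc[OF dec], symmetric])
  also have "\<dots> = (\<Sum>(p, w)\<in>?D \<times> stabilizer m g. tt ^ (Suc m - p) * inv_weight m w)"
    by (intro sum.cong refl) (auto simp: inv_weight_to_last stabilizer_def)
  also have "\<dots> = (\<Sum>p\<in>?D. tt ^ (Suc m - p)) * (\<Sum>w\<in>stabilizer m g. inv_weight m w)"
    by (simp only: sum_product sum.cartesian_product)
  also have "(\<Sum>p\<in>?D. tt ^ (Suc m - p)) = (\<Prod>i\<in>{1..m}. if g i = g (Suc m) then t_ratio (Suc m - i) else 1)"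
  proof -
    define s where "s = (LEAST p. p \<in> ?D)"
    have last: "Suc m \<in> ?D" by simp
    have sD: "s \<in> ?D" unfolding s_def by (rule LeastI[of "\<lambda>p. p \<in> ?D", OF last])
    have sle: "s \<le> p" if "p \<in> ?D" for p unfolding s_def by (rule Least_le[of "\<lambda>p. p \<in> ?D", OF that])
    have D: "?D = {s..Suc m}"
    proof
      show "?D \<subseteq> {s..Suc m}" using sle by auto
      show "{s..Suc m} \<subseteq> ?D"
      proof
        fix p assume p: "p \<in> {s..Suc m}"
        have s1: "1 \<le> s" and gs: "g s = g (Suc m)" using sD by simp_all
        have "g (Suc m) \<le> g p" by (rule dec) (use p s1 in simp_all)
        moreover have "g p \<le> g s" by (rule dec) (use p s1 in simp_all)
        ultimately have "g p = g (Suc m)" using gs by linarith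
        then show "p \<in> ?D" using s1 p by simp
      qed
    qed
    define h where "h = Suc m - s"
    have h: "h \<le> m" "s = Suc m - h" using sD by (auto simp: h_def)
    have "(\<Prod>i\<in>{1..m}. if g i = g (Suc m) then t_ratio (Suc m - i) else 1) = (\<Prod>i\<in>{i \<in> {1..m}. g i = g (Suc m)}. t_ratio (Suc m - i))"
      by (rule prod.inter_filter[symmetric]) simp
    also have "{i \<in> {1..m}. g i = g (Suc m)} = {s..m}"
    proof -
      have "i \<in> ?D \<longleftrightarrow> i \<in> {s..Suc m}" for i by (simp only: D)
      moreover have "i \<in> {1..m} \<and> g i = g (Suc m) \<longleftrightarrow> i \<in> ?D \<and> i \<le> m" for i by fastforce
      moreover have "i \<in> {s..m} \<longleftrightarrow> i \<in> {s..Suc m} \<and> i \<le> m" for i by fastforce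
      ultimately show ?thesis by blast
    qed
    finally have "(\<Prod>i\<in>{1..m}. if g i = g (Suc m) then t_ratio (Suc m - i) else 1) = (\<Prod>i\<in>{s..m}. t_ratio (Suc m - i))" .
    moreover have "(\<Sum>p\<in>{s..Suc m}. tt ^ (Suc m - p)) = (\<Prod>i\<in>{s..m}. t_ratio (Suc m - i))"
      unfolding h(2) by (rule t_integer_block[OF h(1)])
    ultimately show ?thesis by (simp only: D)
  qed
  finally show ?case unfolding IH by (simp add: prod_pairs_Suc mult.commute)
qed

lemma stab_poincare_eq:
  assumes lam: "lam \<in> decreasing_expos n"
  shows "stab_poincare n lam = (\<Prod>(i, j)\<in>pairs n. if lookup lam i = lookup lam j then t_ratio (j - i) else 1)"
proof -
  note d = decreasing_exposD[OF lam]
  have iff: "push w lam = lam \<longleftrightarrow> (\<forall>i\<in>{1..n}. lookup lam (w i) = lookup lam i)" if w: "w permutes {1..n}" for w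
  proof -
    have l: "lookup (push w lam) (w i) = lookup lam i" for i by (rule lookup_push_inj[OF permutes_inj[OF w]])
    show ?thesis
    proof
      assume "push w lam = lam"
      then show "\<forall>i\<in>{1..n}. lookup lam (w i) = lookup lam i" using l by metis
    next
      assume a: "\<forall>i\<in>{1..n}. lookup lam (w i) = lookup lam i"
      show "push w lam = lam"
      proof (rule expos_eqI[OF push_permutes_in_expos(1)[OF w d(2)] d(2)])
        fix r assume "r \<in> {1..n}"
        then have "inv w r \<in> {1..n}" by (simp only: permutes_in_image[OF permutes_inv[OF w]])
        then show "lookup (push w lam) r = lookup lam r"
          using a l[of "inv w r"] unfolding permutes_inverses(1)[OF w] by (metis permutes_inverses(1)[OF w])
      qed
    qed
  qed
  have "stab_poincare n lam = (\<Sum>w | w permutes {1..n}. if w \<in> stabilizer n (lookup lam) then inv_weight n w else 0)"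
    unfolding stab_poincare_def by (intro sum.cong refl) (simp add: iff stabilizer_def inv_weight_def)
  also have "\<dots> = (\<Sum>w\<in>{w \<in> {w. w permutes {1..n}}. w \<in> stabilizer n (lookup lam)}. inv_weight n w)"
    by (rule sum.inter_filter[symmetric]) (simp add: finite_permutations)
  also have "{w \<in> {w. w permutes {1..n}}. w \<in> stabilizer n (lookup lam)} = stabilizer n (lookup lam)"
    by (auto simp: stabilizer_def)
  finally show ?thesis using sum_inv_weight_stabilizer[of n "lookup lam"] d(3) by simp
qed

lemma stab_poincare_nz:
  assumes "lam \<in> decreasing_expos n"
  shows "stab_poincare n lam \<noteq> 0"
proof -
  have "(case p of (i, j) \<Rightarrow> if lookup lam i = lookup lam j then t_ratio (j - i) else 1) \<noteq> 0" if "p \<in> pairs n" for p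
    using that t_ratio_nz[of "snd p - fst p"] by (cases p) (simp add: pairs_def)
  then show ?thesis unfolding stab_poincare_eq[OF assms] prod_zero_iff[OF finite_pairs] by blast
qed

section \<open>The product over boxes\<close>

lemma decreasing_level_set:
  assumes lam: "lam \<in> decreasing_expos n"
  shows "{k \<in> {1..n}. c \<le> lookup lam k} = {1..card {k \<in> {1..n}. c \<le> lookup lam k}}"
proof (cases "{k \<in> {1..n}. c \<le> lookup lam k} = {}")
  case True
  then show ?thesis by (simp only: card.empty) simp
next
  case False
  let ?D = "{k \<in> {1..n}. c \<le> lookup lam k}"
  define m where "m = Max ?D"
  have "finite ?D" by simp
  then have m: "m \<in> ?D" "\<And>k. k \<in> ?D \<Longrightarrow> k \<le> m" unfolding m_def using Max_in[of ?D] False Max_ge[of ?D] by blast+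
  have "?D = {1..m}"
  proof
    show "?D \<subseteq> {1..m}" using m(2) by auto
    show "{1..m} \<subseteq> ?D"
    proof
      fix k assume k: "k \<in> {1..m}"
      then have "lookup lam m \<le> lookup lam k" using decreasing_exposD(3)[OF lam, of k m] m(1) by auto
      then show "k \<in> ?D" using m(1) k by auto
    qed
  qed
  then show ?thesis by (simp only: card_atLeastAtMost) simp
qed

text \<open>For decreasing lambda this reverses each block of equal entries and maps the block to
  itself. Reindexing by it turns differences of \<open>v_perm\<close> into differences of
  positions.\<close>

definition rho :: "nat \<Rightarrow> expo \<Rightarrow> nat \<Rightarrow> nat" where
  "rho n \<mu> i = n + 1 - v_perm n \<mu> i"

lemma v_perm_mem: "i \<in> {1..n} \<Longrightarrow> v_perm n \<mu> i \<in> {1..n}"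
  using v_perm_bij[of n \<mu>] unfolding bij_betw_def by blast

lemma rho_bij: "bij_betw (rho n \<mu>) {1..n} {1..n}"
proof -
  have "bij_betw (\<lambda>i. n + 1 - i) {1..n} {1..n}"
    by (rule bij_betw_byWitness[where f' = "\<lambda>i. n + 1 - i"]) auto
  from bij_betw_trans[OF v_perm_bij this] show ?thesis by (simp add: rho_def[abs_def] comp_def)
qed

text \<open>The value of \<open>rho\<close> at i counts the entries that do not precede i. This set
  lies between the level sets of lambda_i + 1 and lambda_i, strictly above the first; both are
  initial segments, so the counted position lies in their difference.\<close>

lemma lookup_rho:
  assumes lam: "lam \<in> decreasing_expos n" and i: "i \<in> {1..n}"
  shows "lookup lam (rho n lam i) = lookup lam i"
proof -
  define A where "A = {k \<in> {1..n}. precedes lam k i}"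
  define C where "C = {1..n} - A"
  have "card A \<le> card {1..n}" by (rule card_mono) (auto simp: A_def)
  then have "card A \<le> n" by simp
  moreover have "card C = n - card A" unfolding C_def by (subst card_Diff_subset) (auto simp: A_def)
  ultimately have rho: "rho n lam i = card C"
    unfolding rho_def v_perm_precedes A_def[symmetric] by simp
  define D where "D c = {k \<in> {1..n}. c \<le> lookup lam k}" for c
  have D: "k \<in> D c \<longleftrightarrow> 1 \<le> k \<and> k \<le> card (D c)" for c k
  proof -
    have "D c = {1..card (D c)}" unfolding D_def by (rule decreasing_level_set[OF lam])
    from arg_cong[where f = "\<lambda>X. k \<in> X", OF this] show ?thesis by (simp only: atLeastAtMost_iff)
  qed
  have fin: "finite (D c)" "finite C" for c by (simp_all add: D_def C_def)
  have C: "k \<in> C \<longleftrightarrow> k \<in> {1..n} \<and> \<not> precedes lam k i" for k unfolding C_def A_def by blast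
  have "D (lookup lam i + 1) \<subseteq> C"
  proof
    fix k assume "k \<in> D (lookup lam i + 1)"
    then show "k \<in> C" unfolding C by (simp add: D_def precedes_def)
  qed
  moreover have "i \<in> C" unfolding C using i by (simp add: precedes_def)
  moreover have "i \<notin> D (lookup lam i + 1)" by (simp add: D_def)
  ultimately have "D (lookup lam i + 1) \<subset> C" by blast
  then have 1: "card (D (lookup lam i + 1)) < card C" by (rule psubset_card_mono[OF fin(2)])
  have "C \<subseteq> D (lookup lam i)"
  proof
    fix k assume "k \<in> C"
    then show "k \<in> D (lookup lam i)" unfolding C D_def precedes_def by simp
  qed
  then have 2: "card C \<le> card (D (lookup lam i))" by (rule card_mono[OF fin(1)])
  have r: "rho n lam i \<in> {1..n}" using rho_bij i unfolding bij_betw_def by blast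
  have "rho n lam i \<in> D (lookup lam i)" unfolding D using r rho 2 by simp
  then have "lookup lam i \<le> lookup lam (rho n lam i)" by (simp add: D_def)
  moreover have "rho n lam i \<notin> D (lookup lam i + 1)" unfolding D using rho 1 by simp
  then have "lookup lam (rho n lam i) \<le> lookup lam i" using r by (simp add: D_def)
  ultimately show ?thesis by simp
qed

lemma pairs_filter: "pairs n = {p \<in> {1..n} \<times> {1..n}. fst p < snd p}"
  by (auto simp: pairs_def)

lemma prod_pairs_square:
  "(\<Prod>i\<in>{1..n}. \<Prod>j\<in>{1..n}. if i < j then f i j else 1) = (\<Prod>(i, j)\<in>pairs n. f i j)"
proof -
  have "(\<Prod>i\<in>{1..n}. \<Prod>j\<in>{1..n}. if i < j then f i j else 1)
     = (\<Prod>p\<in>{1..n} \<times> {1..n}. if fst p < snd p then f (fst p) (snd p) else 1)"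
    by (simp add: prod.cartesian_product split_def)
  also have "\<dots> = (\<Prod>p\<in>{p \<in> {1..n} \<times> {1..n}. fst p < snd p}. f (fst p) (snd p))"
    by (rule prod.inter_filter[symmetric]) simp
  finally show ?thesis unfolding pairs_filter[symmetric] by (simp add: split_def)
qed

lemma val_formula_decreasing:
  assumes lam: "lam \<in> decreasing_expos n"
  shows "val_formula n lam = tt powi n_stat n lam
     * (\<Prod>(i, j)\<in>pairs n. q_ratio (j - i) (nat (lookup lam i - lookup lam j - 1)))"
proof -
  let ?r = "rho n lam"
  have v: "int n - int (v_perm n lam i) = int (?r i) - 1" if "i \<in> {1..n}" for i
    using v_perm_mem[OF that, of lam] by (simp add: rho_def of_nat_diff)
  have "(\<Sum>i\<in>{1..n}. (int n - int (v_perm n lam i)) * lookup lam i)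
      = (\<Sum>i\<in>{1..n}. (int (?r i) - 1) * lookup lam (?r i))"
    by (intro sum.cong refl) (simp only: v lookup_rho[OF lam])
  also have "\<dots> = n_stat n lam"
    unfolding n_stat_def by (rule sum.reindex_bij_betw[OF rho_bij])
  finally have s: "(\<Sum>i\<in>{1..n}. (int n - int (v_perm n lam i)) * lookup lam i) = n_stat n lam" .
  define H where "H a b = (if a < b then q_ratio (b - a) (nat (lookup lam a - lookup lam b - 1)) else 1)" for a b
  have p: "pair_term n lam i j = H (?r i) (?r j)" if i: "i \<in> {1..n}" and j: "j \<in> {1..n}" for i j
  proof -
    have vi: "v_perm n lam i \<in> {1..n}" "v_perm n lam j \<in> {1..n}" using v_perm_mem i j by blast+
    then have less: "?r i < ?r j \<longleftrightarrow> v_perm n lam j < v_perm n lam i"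
      and diff: "?r j - ?r i = v_perm n lam i - v_perm n lam j"
      by (auto simp: rho_def)
    show ?thesis
    proof (cases "v_perm n lam j < v_perm n lam i")
      case True
      then have "precedes lam j i" using v_perm_less_iff[OF j i] by simp
      moreover have "i < j" if "lookup lam j < lookup lam i"
      proof (rule ccontr)
        assume "\<not> i < j"
        then have "lookup lam i \<le> lookup lam j" using decreasing_exposD(3)[OF lam, of j i] i j by simp
        then show False using that by simp
      qed
      \<comment> \<open>For equal entries j stands before i, and the two sides are
        \<open>nat 0\<close> and \<open>nat (-1)\<close>, both 0.\<close>
      ultimately have "nat (lookup lam i - lookup lam j - (if i < j then 1 else 0)) = nat (lookup lam i - lookup lam j - 1)"
        by (auto simp: precedes_def)
      then show ?thesis using True less diff by (simp add: pair_term_def H_def lookup_rho[OF lam i] lookup_rho[OF lam j])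
    next
      case False
      then show ?thesis using less by (simp add: pair_term_def H_def)
    qed
  qed
  have "(\<Prod>i\<in>{1..n}. \<Prod>j\<in>{1..n}. pair_term n lam i j) = (\<Prod>i\<in>{1..n}. \<Prod>j\<in>{1..n}. H (?r i) (?r j))"
    by (intro prod.cong refl) (simp only: p)
  also have "\<dots> = (\<Prod>i\<in>{1..n}. \<Prod>j\<in>{1..n}. H i j)"
    by (rule prod_pairs_reindex[OF rho_bij, symmetric])
  also have "\<dots> = (\<Prod>(i, j)\<in>pairs n. q_ratio (j - i) (nat (lookup lam i - lookup lam j - 1)))"
    unfolding H_def by (rule prod_pairs_square)
  finally show ?thesis unfolding val_formula_def s by simp
qed

text \<open>\<open>q_ratio\<close> with the factor for k = 0 included. For unequal entries that
  factor comes from the symmetrization; for equal entries the normalizing constant cancels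
  it.\<close>

definition q_full :: "nat \<Rightarrow> nat \<Rightarrow> coeff_field" where
  "q_full h N = (\<Prod>k<N. (1 - qq ^ k * tt ^ Suc h) / (1 - qq ^ k * tt ^ h))"

lemma q_full_Suc: "q_full h (Suc N) = t_ratio h * q_ratio h N"
proof (induction N)
  case 0
  then show ?case by (simp add: q_full_def q_ratio_def t_ratio_def)
next
  case (Suc N)
  have "q_full h (Suc (Suc N)) = q_full h (Suc N) * ((1 - qq ^ Suc N * tt ^ Suc h) / (1 - qq ^ Suc N * tt ^ h))"
    unfolding q_full_def by (rule prod.lessThan_Suc)
  then show ?case using Suc by (simp add: q_ratio_Suc del: power_Suc)
qed

lemma principal_factor:
  assumes "1 \<le> i" "i < j"
  shows "(tt ^ (i - 1) - tt * tt ^ (j - 1)) / (tt ^ (i - 1) - tt ^ (j - 1)) = t_ratio (j - i)"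
proof -
  have "tt ^ (j - 1) = tt ^ (i - 1) * tt ^ (j - i)" using assms by (simp flip: power_add)
  then have "tt ^ (i - 1) - tt * tt ^ (j - 1) = tt ^ (i - 1) * (1 - tt ^ Suc (j - i))"
    "tt ^ (i - 1) - tt ^ (j - 1) = tt ^ (i - 1) * (1 - tt ^ (j - i))"
    by (simp_all add: algebra_simps)
  then show ?thesis unfolding t_ratio_def by (simp del: power_Suc)
qed

lemma pair_product_eq:
  assumes lam: "lam \<in> decreasing_expos n"
  shows "val_formula n lam / stab_poincare n lam
     * (\<Prod>(i, j)\<in>pairs n. (tt ^ (i - 1) - tt * tt ^ (j - 1)) / (tt ^ (i - 1) - tt ^ (j - 1)))
     = tt powi n_stat n lam * (\<Prod>(i, j)\<in>pairs n. q_full (j - i) (nat (lookup lam i - lookup lam j)))"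
proof -
  define R where "R p = t_ratio (snd p - fst p)" for p :: "nat \<times> nat"
  define Q where "Q p = q_ratio (snd p - fst p) (nat (lookup lam (fst p) - lookup lam (snd p) - 1))" for p
  define S where "S p = (if lookup lam (fst p) = lookup lam (snd p) then R p else 1)" for p
  have r: "(\<Prod>(i, j)\<in>pairs n. (tt ^ (i - 1) - tt * tt ^ (j - 1)) / (tt ^ (i - 1) - tt ^ (j - 1))) = (\<Prod>p\<in>pairs n. R p)"
    by (intro prod.cong refl) (auto simp: R_def pairs_def principal_factor[unfolded One_nat_def])
  have s: "stab_poincare n lam = (\<Prod>p\<in>pairs n. S p)"
    unfolding stab_poincare_eq[OF lam] S_def R_def split_def ..
  have v: "val_formula n lam = tt powi n_stat n lam * (\<Prod>p\<in>pairs n. Q p)"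
    unfolding val_formula_decreasing[OF lam] by (simp add: Q_def split_def)
  have q: "(\<Prod>p\<in>pairs n. Q p) / (\<Prod>p\<in>pairs n. S p) * (\<Prod>p\<in>pairs n. R p)
      = (\<Prod>p\<in>pairs n. q_full (snd p - fst p) (nat (lookup lam (fst p) - lookup lam (snd p))))"
    unfolding prod_dividef[symmetric] prod.distrib[symmetric]
  proof (intro prod.cong refl)
    fix p assume p: "p \<in> pairs n"
    then have h: "snd p - fst p \<noteq> 0" by (auto simp: pairs_def)
    show "Q p / S p * R p = q_full (snd p - fst p) (nat (lookup lam (fst p) - lookup lam (snd p)))"
    proof (cases "lookup lam (fst p) = lookup lam (snd p)")
      case True
      then show ?thesis using t_ratio_nz[OF h] by (simp add: Q_def S_def R_def q_ratio_def q_full_def)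
    next
      case False
      moreover have "lookup lam (snd p) \<le> lookup lam (fst p)"
        using decreasing_exposD(3)[OF lam, of "fst p" "snd p"] p by (auto simp: pairs_def)
      ultimately have "nat (lookup lam (fst p) - lookup lam (snd p)) = Suc (nat (lookup lam (fst p) - lookup lam (snd p) - 1))"
        by simp
      then show ?thesis using False by (simp add: Q_def S_def R_def q_full_Suc mult.commute)
    qed
  qed
  have assoc: "a * b / c * d = a * (b / c * d)" for a b c d :: coeff_field by simp
  show ?thesis unfolding r s v assoc q by (simp only: split_def)
qed

lemma telescope_row:
  assumes "r \<le> l" "l \<le> n"
  shows "(\<Prod>b\<in>{Suc l..n}. (1 - qq ^ k * tt ^ Suc (b - r)) / (1 - qq ^ k * tt ^ (b - r)))
     = (1 - qq ^ k * tt ^ Suc (n - r)) / (1 - qq ^ k * tt ^ Suc (l - r))"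
  using assms(2)
proof (induction n rule: dec_induct)
  case base
  then show ?case using one_minus_qt_nz[of k "Suc (l - r)"] by (simp del: power_Suc)
next
  case (step n)
  have e: "Suc n - r = Suc (n - r)" using step assms by simp
  have nz: "1 - qq ^ k * tt ^ Suc (n - r) \<noteq> 0" by (rule one_minus_qt_nz) simp
  have "{Suc l..Suc n} = insert (Suc n) {Suc l..n}" using step by auto
  then have "(\<Prod>b\<in>{Suc l..Suc n}. (1 - qq ^ k * tt ^ Suc (b - r)) / (1 - qq ^ k * tt ^ (b - r)))
     = (1 - qq ^ k * tt ^ Suc (Suc n - r)) / (1 - qq ^ k * tt ^ (Suc n - r))
       * ((1 - qq ^ k * tt ^ Suc (n - r)) / (1 - qq ^ k * tt ^ Suc (l - r)))"
    using step.IH by (simp del: power_Suc)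
  then show ?case unfolding e using nz by (simp del: power_Suc)
qed

text \<open>For fixed k the factors of row r run over the rows b with lambda_b < lambda_r - k, which
  form a final segment, so they telescope. The numerator left depends only on k, n and r; the
  denominator involves the number \<open>ell k\<close> of rows reaching column lambda_r - k.\<close>

lemma row_product:
  assumes lam: "lam \<in> decreasing_expos n" and r: "r \<in> {1..n}"
  shows "(\<Prod>b\<in>{Suc r..n}. q_full (b - r) (nat (lookup lam r - lookup lam b)))
     = (\<Prod>c\<in>{1..lookup lam r}. (1 - qq powi coarm (r, c) * tt powi (int n - coleg (r, c)))
         / (1 - qq powi arm lam (r, c) * tt powi (leg n lam (r, c) + 1)))"
proof -
  have pos: "0 \<le> lookup lam b" if "b \<in> {1..n}" for b
    using decreasing_exposD(1)[OF lam] that by (simp add: nonneg_expos_def)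
  define L where "L = nat (lookup lam r)"
  have L: "int L = lookup lam r" using pos[OF r] by (simp add: L_def)
  define ell where "ell k = card {j \<in> {1..n}. lookup lam r - int k \<le> lookup lam j}" for k :: nat
  define X where "X k h = (1 - qq ^ k * tt ^ Suc h) / (1 - qq ^ k * tt ^ h)" for k h
  have row: "(\<Prod>b\<in>{Suc r..n}. if int k < lookup lam r - lookup lam b then X k (b - r) else 1)
      = (1 - qq ^ k * tt ^ Suc (n - r)) / (1 - qq ^ k * tt ^ Suc (ell k - r))"
    and ell: "r \<le> ell k" if k: "k < L" for k
  proof -
    have D: "{j \<in> {1..n}. lookup lam r - int k \<le> lookup lam j} = {1..ell k}"
      unfolding ell_def by (rule decreasing_level_set[OF lam])
    have mem: "lookup lam r - int k \<le> lookup lam j \<longleftrightarrow> j \<le> ell k" if "j \<in> {1..n}" for j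
    proof -
      have "j \<in> {j \<in> {1..n}. lookup lam r - int k \<le> lookup lam j} \<longleftrightarrow> j \<in> {1..ell k}" unfolding D ..
      then show ?thesis using that by simp
    qed
    show "r \<le> ell k" using mem[OF r] by simp
    have "ell k \<le> card {1..n}" unfolding ell_def by (rule card_mono) auto
    then have "ell k \<le> n" by simp
    have "(\<Prod>b\<in>{Suc r..n}. if int k < lookup lam r - lookup lam b then X k (b - r) else 1)
       = (\<Prod>b\<in>{b \<in> {Suc r..n}. int k < lookup lam r - lookup lam b}. X k (b - r))"
      by (rule prod.inter_filter[symmetric]) simp
    also have "{b \<in> {Suc r..n}. int k < lookup lam r - lookup lam b} = {Suc (ell k)..n}"
    proof -
      have "int k < lookup lam r - lookup lam b \<longleftrightarrow> ell k < b" if "b \<in> {1..n}" for b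
        using mem[OF that] by linarith
      then show ?thesis using \<open>r \<le> ell k\<close> r by auto
    qed
    also have "(\<Prod>b\<in>{Suc (ell k)..n}. X k (b - r)) = (1 - qq ^ k * tt ^ Suc (n - r)) / (1 - qq ^ k * tt ^ Suc (ell k - r))"
      unfolding X_def by (rule telescope_row[OF \<open>r \<le> ell k\<close> \<open>ell k \<le> n\<close>])
    finally show "(\<Prod>b\<in>{Suc r..n}. if int k < lookup lam r - lookup lam b then X k (b - r) else 1)
      = (1 - qq ^ k * tt ^ Suc (n - r)) / (1 - qq ^ k * tt ^ Suc (ell k - r))" .
  qed
  have q: "q_full (b - r) (nat (lookup lam r - lookup lam b))
      = (\<Prod>k<L. if int k < lookup lam r - lookup lam b then X k (b - r) else 1)" if b: "b \<in> {Suc r..n}" for b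
  proof -
    have "0 \<le> lookup lam b" using b r by (intro pos) auto
    then have "{k \<in> {..<L}. int k < lookup lam r - lookup lam b} = {..<nat (lookup lam r - lookup lam b)}"
      using L by auto
    then show ?thesis
      unfolding q_full_def X_def[symmetric] by (subst prod.inter_filter[symmetric]) simp_all
  qed
  have "(\<Prod>b\<in>{Suc r..n}. q_full (b - r) (nat (lookup lam r - lookup lam b)))
     = (\<Prod>b\<in>{Suc r..n}. \<Prod>k<L. if int k < lookup lam r - lookup lam b then X k (b - r) else 1)"
    by (intro prod.cong refl q)
  also have "\<dots> = (\<Prod>k<L. \<Prod>b\<in>{Suc r..n}. if int k < lookup lam r - lookup lam b then X k (b - r) else 1)"
    by (rule prod.swap)
  also have "\<dots> = (\<Prod>k<L. (1 - qq ^ k * tt ^ Suc (n - r)) / (1 - qq ^ k * tt ^ Suc (ell k - r)))"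
    by (intro prod.cong refl row) simp
  also have "\<dots> = (\<Prod>k<L. 1 - qq ^ k * tt ^ Suc (n - r)) / (\<Prod>k<L. 1 - qq ^ k * tt ^ Suc (ell k - r))"
    by (rule prod_dividef)
  also have "(\<Prod>k<L. 1 - qq ^ k * tt ^ Suc (n - r))
      = (\<Prod>c\<in>{1..lookup lam r}. 1 - qq powi coarm (r, c) * tt powi (int n - coleg (r, c)))"
  proof -
    \<comment> \<open>Numerators are matched with columns by c = k + 1, so that k is the
      coarm.\<close>
    have b: "bij_betw (\<lambda>k. int (Suc k)) {..<L} {1..lookup lam r}"
      by (rule bij_betw_byWitness[where f' = "\<lambda>c. nat (c - 1)"]) (use L in auto)
    have "int n - coleg (r, int (Suc k)) = int (Suc (n - r))" for k
      using r by (simp add: coleg_def of_nat_diff)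
    moreover have "coarm (r, int (Suc k)) = int k" for k by (simp add: coarm_def)
    ultimately have "(\<Prod>k<L. 1 - qq ^ k * tt ^ Suc (n - r))
        = (\<Prod>k<L. 1 - qq powi coarm (r, int (Suc k)) * tt powi (int n - coleg (r, int (Suc k))))"
      by (simp only: power_int_of_nat)
    then show ?thesis
      using prod.reindex_bij_betw[OF b, of "\<lambda>c. 1 - qq powi coarm (r, c) * tt powi (int n - coleg (r, c))"] by (simp only:)
  qed
  also have "(\<Prod>k<L. 1 - qq ^ k * tt ^ Suc (ell k - r))
      = (\<Prod>c\<in>{1..lookup lam r}. 1 - qq powi arm lam (r, c) * tt powi (leg n lam (r, c) + 1))"
  proof -
    \<comment> \<open>Denominators are matched with the same columns in reverse, by c = lambda_r -
      k, so that k is the arm. Numerator and denominator of one box thus come from different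
      k.\<close>
    have b: "bij_betw (\<lambda>k. lookup lam r - int k) {..<L} {1..lookup lam r}"
      by (rule bij_betw_byWitness[where f' = "\<lambda>c. nat (lookup lam r - c)"]) (use L in auto)
    have "leg n lam (r, lookup lam r - int k) + 1 = int (Suc (ell k - r))" if "k < L" for k
      using ell[OF that] by (simp add: leg_def ell_def of_nat_diff)
    moreover have "arm lam (r, lookup lam r - int k) = int k" for k by (simp add: arm_def)
    ultimately have "(\<Prod>k<L. 1 - qq ^ k * tt ^ Suc (ell k - r))
        = (\<Prod>k<L. 1 - qq powi arm lam (r, lookup lam r - int k) * tt powi (leg n lam (r, lookup lam r - int k) + 1))"
      by (intro prod.cong refl) (simp only: power_int_of_nat lessThan_iff)
    then show ?thesis
      using prod.reindex_bij_betw[OF b, of "\<lambda>c. 1 - qq powi arm lam (r, c) * tt powi (leg n lam (r, c) + 1)"] by (simp only:)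
  qed
  finally show ?thesis by (simp only: prod_dividef)
qed

lemma boxes_product:
  assumes lam: "lam \<in> decreasing_expos n"
  shows "(\<Prod>(i, j)\<in>pairs n. q_full (j - i) (nat (lookup lam i - lookup lam j)))
     = (\<Prod>b\<in>boxes n lam. (1 - qq powi coarm b * tt powi (int n - coleg b))
         / (1 - qq powi arm lam b * tt powi (leg n lam b + 1)))"
proof -
  have "pairs n = Sigma {1..n} (\<lambda>i. {Suc i..n})" by (auto simp: pairs_def)
  then have "(\<Prod>(i, j)\<in>pairs n. q_full (j - i) (nat (lookup lam i - lookup lam j)))
     = (\<Prod>i\<in>{1..n}. \<Prod>j\<in>{Suc i..n}. q_full (j - i) (nat (lookup lam i - lookup lam j)))"
    by (simp add: prod.Sigma)
  also have "\<dots> = (\<Prod>r\<in>{1..n}. \<Prod>c\<in>{1..lookup lam r}. (1 - qq powi coarm (r, c) * tt powi (int n - coleg (r, c)))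
         / (1 - qq powi arm lam (r, c) * tt powi (leg n lam (r, c) + 1)))"
    by (intro prod.cong refl row_product[OF lam])
  also have "\<dots> = (\<Prod>b\<in>boxes n lam. (1 - qq powi coarm b * tt powi (int n - coleg b))
         / (1 - qq powi arm lam b * tt powi (leg n lam b + 1)))"
    unfolding boxes_def by (subst prod.Sigma) (simp_all add: split_def)
  finally show ?thesis .
qed

theorem theorem5p3:
  fixes n :: nat and E :: "expo \<Rightarrow> laurent" and lam :: expo
  assumes "n \<ge> 1"
    and "electronic_macdonald n E"
    and "lam \<in> expos n"
    and "\<forall>i\<in>{1..n}. 0 \<le> lookup lam i"
    and "\<forall>i\<in>{1..<n}. lookup lam (i + 1) \<le> lookup lam i"
  shows "laurent_eval id (\<lambda>i. tt ^ (i - 1)) (bosonic_macdonald n E lam) =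
         tt powi n_stat n lam *
         (\<Prod>b\<in>boxes n lam.
            (1 - qq powi coarm b * tt powi (int n - coleg b)) /
            (1 - qq powi arm lam b * tt powi (leg n lam b + 1)))"
proof -
  interpret electronic n E
    using assms(1,2) by unfold_locales
  have mono: "lookup lam j \<le> lookup lam i" if "1 \<le> i" "i \<le> j" "j \<le> n" for i j
    using that(2,3)
  proof (induction j rule: dec_induct)
    case (step j)
    then show ?case using assms(5)[rule_format, of j] that(1) by fastforce
  qed simp
  then have lam: "lam \<in> decreasing_expos n"
    using assms(3,4) by (auto simp: decreasing_expos_def nonneg_expos_def)
  note d = decreasing_exposD(1)[OF lam]
  have "laurent_eval id (\<lambda>i. tt ^ (i - 1)) (bosonic_macdonald n E lam)
     = val_formula n lam / stab_poincare n lam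
       * (\<Prod>(i, j)\<in>pairs n. (tt ^ (i - 1) - tt * tt ^ (j - 1)) / (tt ^ (i - 1) - tt ^ (j - 1)))"
    unfolding bosonic_eval[OF lam stab_poincare_nz[OF lam]] E_val_eq_val_formula[OF d] ..
  then show ?thesis
    unfolding pair_product_eq[OF lam] boxes_product[OF lam] .
qed

end
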